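(* Let $s\in\mathbb{N}=\{0,1,2,\dots\}$ and consider a system $(Q,G_{+-})$ (as defined in the context) with $Q\in\mathbb{R}^{p\times m}$ and $G_{+-}\in C^{s+1}([0,1])^{p\times m}$. (1) Assume that $\gamma^l=0$ for all $l\in\{0,\ldots,s\}$, where $$\gamma^0=Q_1,\qquad \gamma^l=G_1^{(l-1)}(0)\quad (l\ge 1).$$ Then $T_{\inf}(Q,G_{+-})=T_{\inf}(\bar Q,\bar G_{+-})$, where the system $(\bar Q,\bar G_{+-})$ has the same $j$-th row as $(Q,G_{+-})$ for every $j\ne 1$ (i.e. $\bar Q_j=Q_j$ and $\bar G_j=G_j$), and its first row is $$\bar Q_1=\lambda_{m+1}(0)^s\,G_1^{(s)}(0),\qquad \bar G_1(x)=(\mathcal{D}_1^{s+1}G_1)(x).$$ (2) Let $k\in\{2,\ldots,p\}$ be fixed. Assume that there exist row vectors $a^0,\ldots,a^s\in\mathbb{R}^{1\times(k-1)}$ such that $$\omega^l+a^l\,Q_{1:k-1}=0\qquad \text{for all } l\in\{0,\ldots,s\},$$ where $$\omega^0=Q_k,\qquad \omega^l=\bar\omega^l(0)\quad (l\ge1),$$ $$\bar\omega^l(x)=(\mathcal{D}_k^{l-1}G_k)(x)+\sum_{i=0}^{l-1}a^i\,(\mathcal{D}_k^{l-1-i}G^{\zeta}_{1:k-1})(x)\qquad (1\le l\le s+1).$$ Then $T_{\inf}(Q,G_{+-})=T_{\inf}(\bar Q,\bar G_{+-})$, where the system $(\bar Q,\bar G_{+-})$ has the same $j$-th row as $(Q,G_{+-})$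 for every $j\ne k$, and its $k$-th row is $$\bar Q_k=\omega^{s+1},\qquad \bar G_k(x)=(\mathcal{D}_k\bar\omega^{s+1})(x).$$
   Context: Let $m,p\ge1$, $n=m+p$. The matrix $\Lambda=\mathrm{diag}(\lambda_1,\ldots,\lambda_n)\in C^{r+1}([0,1])^{n\times n}$, $r\in\mathbb{N}$, with $s\le r$, satisfies $\lambda_1(x)<\cdots<\lambda_m(x)<0<\lambda_{m+1}(x)<\cdots<\lambda_{m+p}(x)$ for all $x\in[0,1]$; it is extended to a $C^{r+1}$ function on $\mathbb{R}$ satisfying the same inequalities (the results do not depend on the extension). For a vector $y\in\mathbb{R}^n$, $y_-$ denotes its first $m$ components and $y_+$ its last $p$ components; $\Lambda_-=\mathrm{diag}(\lambda_1,\ldots,\lambda_m)$, $\Lambda_+=\mathrm{diag}(\lambda_{m+1},\ldots,\lambda_{m+p})$. For $Q\in\mathbb{R}^{p\times m}$ and $G_{+-}:[0,1]\to\mathbb{R}^{p\times m}$, the system $(Q,G_{+-})$ is the control system $$\partial_t y_-(t,x)+\Lambda_-(x)\,\partial_x y_-(t,x)=0,\qquad \partial_t y_+(t,x)+\Lambda_+(x)\,\partial_x y_+(t,x)=G_{+-}(x)\,y_-(t,0),$$ $$y_-(t,1)=u(t),\qquad y_+(t,0)=Q\,y_-(t,0),\qquad y(0,x)=y^0(x),$$ for $t\in(0,T)$, $x\in(0,1)$, with initial datum $y^0\in L^2(0,1)^n$ and control $u\in L^2(0,T)^m$. Solutions are understood along the characteristics (broad solutions) and belong to $C^0([0,T];L^2(0,1)^n)\cap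 C^0([0,1];L^2(0,T)^n)$. The system is null controllable in time $T>0$ if for every $y^0\in L^2(0,1)^n$ there is $u\in L^2(0,T)^m$ such that the solution satisfies $y(T,\cdot)=0$. The minimal null control time is $T_{\inf}(Q,G_{+-})=\inf\{T>0: (Q,G_{+-})\text{ is null controllable in time }T\}\in[0,+\infty]$. Notation: $Q_j$ and $G_j$ are the $j$-th rows of $Q$ and $G_{+-}$; $Q_{1:k-1}$ is the submatrix formed by the first $k-1$ rows of $Q$. $\mathcal{D}_j=\lambda_{m+j}\frac{d}{dx}$, and $\mathcal{D}_j^l$ is its $l$-th iterate ($\mathcal{D}_j^0=\mathrm{Id}$). For $k\geq 2$, $$G^{\zeta}_{1:k-1}(x)=\begin{pmatrix}G_1(\zeta_{k1}(x))\\ \vdots\\ G_{k-1}(\zeta_{k,k-1}(x))\end{pmatrix},$$ where, for $1\le i\le k-1$, $\zeta_{ki}$ is the solution to $\zeta_{ki}'(x)=\dfrac{\lambda_{m+i}(\zeta_{ki}(x))}{\lambda_{m+k}(x)}$ for $x\in\mathbb{R}$, $\zeta_{ki}(0)=0$ (it maps $[0,1]$ into $[0,1]$). *)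

theory Defs
  imports "HOL-Analysis.Analysis"
begin

text \<open>
  Conventions. Components and rows are numbered from 1, as on paper. The speeds are
  \<open>lam i\<close> for \<open>1 \<le> i \<le> m + p\<close>; the entries of \<open>Q\<close> and \<open>G\<close> (that is, of \<open>G\<^sub>+\<^sub>-\<close>) are
  \<open>Q j i\<close> and \<open>G j i x\<close> for \<open>1 \<le> j \<le> p\<close>, \<open>1 \<le> i \<le> m\<close>, so that \<open>Q j\<close> and \<open>G j\<close> are the
  \<open>j\<close>-th rows. Values at other indices, or at \<open>x\<close> outside \<open>[0,1]\<close>, are never used.

  Characteristics and the functions \<open>\<zeta>\<close> are only used as long as they stay in \<open>[0,1]\<close>.
  They are therefore defined there, from the values of \<open>lam\<close> on \<open>[0,1]\<close> alone, and no
  extension of \<open>lam\<close> to the real line is chosen.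
\<close>

section \<open>Regularity\<close>

fun C_k_on :: "nat \<Rightarrow> (real \<Rightarrow> real) \<Rightarrow> real set \<Rightarrow> bool" where
  "C_k_on 0 f S \<longleftrightarrow> continuous_on S f"
| "C_k_on (Suc k) f S \<longleftrightarrow>
     (\<exists>f'. (\<forall>x\<in>S. (f has_real_derivative f' x) (at x within S)) \<and> C_k_on k f' S)"

text \<open>Derivatives on \<open>[0,1]\<close> are one-sided at the endpoints.\<close>

definition D01 :: "(real \<Rightarrow> real) \<Rightarrow> real \<Rightarrow> real" where
  "D01 f x = vector_derivative f (at x within {0..1})"

definition weighted_D :: "(real \<Rightarrow> real) \<Rightarrow> (real \<Rightarrow> real) \<Rightarrow> real \<Rightarrow> real" where
  "weighted_D c f x = c x * D01 f x"

definition L2_on :: "real set \<Rightarrow> (real \<Rightarrow> real) \<Rightarrow> bool" where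
  "L2_on S f \<longleftrightarrow>
     f \<in> borel_measurable (lebesgue_on S) \<and> integrable (lebesgue_on S) (\<lambda>x. (f x)\<^sup>2)"

definition continuous_into_L2 :: "real set \<Rightarrow> real set \<Rightarrow> (real \<Rightarrow> real \<Rightarrow> real) \<Rightarrow> bool" where
  "continuous_into_L2 A S F \<longleftrightarrow>
     (\<forall>a\<in>A. L2_on S (F a)) \<and>
     (\<forall>a\<in>A. ((\<lambda>b. \<integral>x. (F b x - F a x)\<^sup>2 \<partial>lebesgue_on S) \<longlongrightarrow> 0) (at a within A))"


section \<open>The control system\<close>

definition hyperbolic :: "nat \<Rightarrow> nat \<Rightarrow> (nat \<Rightarrow> real \<Rightarrow> real) \<Rightarrow> bool" where
  "hyperbolic m p lam \<longleftrightarrow>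
     (\<forall>x\<in>{0..1}. (\<forall>i j. 1 \<le> i \<and> i < j \<and> j \<le> m + p \<longrightarrow> lam i x < lam j x) \<and>
                 lam m x < 0 \<and> 0 < lam (m + 1) x)"

text \<open>
  \<open>c\<close> is, on \<open>[a,t]\<close>, the characteristic of speed \<open>v\<close> that ends in the point \<open>(t,x)\<close>.
\<close>
definition characteristic ::
  "(real \<Rightarrow> real) \<Rightarrow> real \<Rightarrow> real \<Rightarrow> real \<Rightarrow> (real \<Rightarrow> real) \<Rightarrow> bool" where
  "characteristic v a t x c \<longleftrightarrow>
     a \<le> t \<and> c t = x \<and>
     (\<forall>\<tau>\<in>{a..t}. c \<tau> \<in> {0..1} \<and> (c has_real_derivative v (c \<tau>)) (at \<tau> within {a..t}))"

definition inflow_point :: "nat \<Rightarrow> nat \<Rightarrow> real" where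
  "inflow_point m i = (if i \<le> m then 1 else 0)"

definition inflow_value ::
  "nat \<Rightarrow> (nat \<Rightarrow> nat \<Rightarrow> real) \<Rightarrow> (nat \<Rightarrow> real \<Rightarrow> real) \<Rightarrow> (nat \<Rightarrow> real \<Rightarrow> real \<Rightarrow> real)
     \<Rightarrow> nat \<Rightarrow> real \<Rightarrow> real" where
  "inflow_value m Q u y i t =
     (if i \<le> m then u i t else (\<Sum>h=1..m. Q (i - m) h * y h t 0))"

definition source_term ::
  "nat \<Rightarrow> (nat \<Rightarrow> nat \<Rightarrow> real \<Rightarrow> real) \<Rightarrow> (nat \<Rightarrow> real \<Rightarrow> real \<Rightarrow> real)
     \<Rightarrow> nat \<Rightarrow> real \<Rightarrow> real \<Rightarrow> real" where
  "source_term m G y i t x =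
     (if i \<le> m then 0 else (\<Sum>h=1..m. G (i - m) h x * y h t 0))"

text \<open>
  Broad solutions \<open>y i t x\<close>: the system is integrated along the characteristic that ends in
  \<open>(t,x)\<close>, for almost every \<open>(t,x)\<close>. The backward characteristic leaves the domain at time \<open>a\<close>,
  either through the line \<open>t = 0\<close>, where the initial datum is read, or through the inflow
  boundary, where the boundary condition is read. Given \<open>(t,x)\<close>, with \<open>t > 0\<close> and
  \<open>0 < x < 1\<close>, both \<open>a\<close> and \<open>c\<close> on \<open>[a,t]\<close> are unique. The two continuity requirements give
  a meaning to \<open>y(t,\<cdot>)\<close> for every \<open>t\<close>, and to the trace \<open>y(\<cdot>,0)\<close> in the boundary condition
  and the source term.
\<close>
definition broad_solution ::
  "nat \<Rightarrow> nat \<Rightarrow> (nat \<Rightarrow> real \<Rightarrow> real) \<Rightarrow> (nat \<Rightarrow> nat \<Rightarrow> real) \<Rightarrow> (nat \<Rightarrow> nat \<Rightarrow> real \<Rightarrow> real)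
     \<Rightarrow> real \<Rightarrow> (nat \<Rightarrow> real \<Rightarrow> real) \<Rightarrow> (nat \<Rightarrow> real \<Rightarrow> real) \<Rightarrow> (nat \<Rightarrow> real \<Rightarrow> real \<Rightarrow> real)
     \<Rightarrow> bool" where
  "broad_solution m p lam Q G T y0 u y \<longleftrightarrow>
     (\<forall>i\<in>{1..m+p}.
        continuous_into_L2 {0..T} {0<..<1} (\<lambda>t x. y i t x) \<and>
        continuous_into_L2 {0..1} {0<..<T} (\<lambda>x t. y i t x) \<and>
        (AE (t, x) in lebesgue_on ({0<..<T} \<times> {0<..<1}).
           \<exists>a c. 0 \<le> a \<and> characteristic (lam i) a t x c \<and>
                 (a = 0 \<or> c a = inflow_point m i) \<and>
                 y i t x =
                   (if a = 0 then y0 i (c 0) else inflow_value m Q u y i a)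
                   + (LINT \<tau>|lebesgue_on {a..t}. source_term m G y i \<tau> (c \<tau>))))"

definition null_controllable ::
  "nat \<Rightarrow> nat \<Rightarrow> (nat \<Rightarrow> real \<Rightarrow> real) \<Rightarrow> (nat \<Rightarrow> nat \<Rightarrow> real) \<Rightarrow> (nat \<Rightarrow> nat \<Rightarrow> real \<Rightarrow> real)
     \<Rightarrow> real \<Rightarrow> bool" where
  "null_controllable m p lam Q G T \<longleftrightarrow>
     (\<forall>y0. (\<forall>i\<in>{1..m+p}. L2_on {0<..<1} (y0 i)) \<longrightarrow>
        (\<exists>u y. (\<forall>i\<in>{1..m}. L2_on {0<..<T} (u i)) \<and>
               broad_solution m p lam Q G T y0 u y \<and>
               (\<forall>i\<in>{1..m+p}. AE x in lebesgue_on {0<..<1}. y i T x = 0)))"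

definition T_inf ::
  "nat \<Rightarrow> nat \<Rightarrow> (nat \<Rightarrow> real \<Rightarrow> real) \<Rightarrow> (nat \<Rightarrow> nat \<Rightarrow> real) \<Rightarrow> (nat \<Rightarrow> nat \<Rightarrow> real \<Rightarrow> real)
     \<Rightarrow> ereal" where
  "T_inf m p lam Q G = Inf (ereal ` {T. 0 < T \<and> null_controllable m p lam Q G T})"


section \<open>The reduced systems\<close>

definition gamma_row ::
  "(nat \<Rightarrow> nat \<Rightarrow> real) \<Rightarrow> (nat \<Rightarrow> nat \<Rightarrow> real \<Rightarrow> real) \<Rightarrow> nat \<Rightarrow> nat \<Rightarrow> real" where
  "gamma_row Q G l h = (if l = 0 then Q 1 h else (D01 ^^ (l - 1)) (G 1 h) 0)"

text \<open>
  The functions \<open>\<zeta>\<^sub>k\<^sub>i\<close>, restricted to \<open>[0,1]\<close>. Since \<open>lam\<close> is only used on \<open>[0,1]\<close>, that \<open>z\<close>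
  takes its values there is part of being a solution.
\<close>
definition is_zeta ::
  "nat \<Rightarrow> (nat \<Rightarrow> real \<Rightarrow> real) \<Rightarrow> nat \<Rightarrow> nat \<Rightarrow> (real \<Rightarrow> real) \<Rightarrow> bool" where
  "is_zeta m lam k i z \<longleftrightarrow>
     z 0 = 0 \<and>
     (\<forall>x\<in>{0..1}. z x \<in> {0..1} \<and>
        (z has_real_derivative lam (m + i) (z x) / lam (m + k) x) (at x within {0..1}))"

text \<open>
  \<open>omega_bar\<close> is meant for \<open>l \<ge> 1\<close>; \<open>zeta j\<close> stands for \<open>\<zeta>\<^sub>k\<^sub>j\<close>, \<open>a i\<close> for the row vector
  \<open>a\<^sup>i\<close> with entries \<open>a i j\<close>, \<open>1 \<le> j \<le> k - 1\<close>, and \<open>h\<close> for the column.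
\<close>
definition omega_bar ::
  "nat \<Rightarrow> (nat \<Rightarrow> real \<Rightarrow> real) \<Rightarrow> (nat \<Rightarrow> nat \<Rightarrow> real \<Rightarrow> real) \<Rightarrow> nat \<Rightarrow> (nat \<Rightarrow> real \<Rightarrow> real)
     \<Rightarrow> (nat \<Rightarrow> nat \<Rightarrow> real) \<Rightarrow> nat \<Rightarrow> nat \<Rightarrow> real \<Rightarrow> real" where
  "omega_bar m lam G k zeta a l h x =
     (weighted_D (lam (m + k)) ^^ (l - 1)) (G k h) x
     + (\<Sum>i<l. \<Sum>j=1..k-1.
          a i j * (weighted_D (lam (m + k)) ^^ (l - 1 - i)) (\<lambda>\<xi>. G j h (zeta j \<xi>)) x)"

definition omega_row ::
  "nat \<Rightarrow> (nat \<Rightarrow> real \<Rightarrow> real) \<Rightarrow> (nat \<Rightarrow> nat \<Rightarrow> real) \<Rightarrow> (nat \<Rightarrow> nat \<Rightarrow> real \<Rightarrow> real) \<Rightarrow> nat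
     \<Rightarrow> (nat \<Rightarrow> real \<Rightarrow> real) \<Rightarrow> (nat \<Rightarrow> nat \<Rightarrow> real) \<Rightarrow> nat \<Rightarrow> nat \<Rightarrow> real" where
  "omega_row m lam Q G k zeta a l h =
     (if l = 0 then Q k h else omega_bar m lam G k zeta a l h 0)"

end

theory Submission
  imports Defs
begin

text \<open>
  The components \<open>y\<^sub>-\<close> do not feel \<open>y\<^sub>+\<close>, and \<open>y\<^sub>+\<close> feels \<open>y\<^sub>-\<close> only through the trace
  \<open>w(t) = y\<^sub>-(t,0)\<close>. Let \<open>\<theta>\<close> be the time that row \<open>j\<close> needs to travel from \<open>0\<close> to \<open>x\<close>, let
  \<open>L\<^sub>j\<close> be the travel time to \<open>1\<close>, and let \<open>g\<^sub>j\<close> be \<open>G\<^sub>j\<close> written in the coordinate \<open>\<theta>\<close>.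
  Integrating along characteristics, the value of \<open>y\<^sub>m\<^sub>+\<^sub>j(T,\<cdot>)\<close> at travel time \<open>\<theta> < T\<close> is
  \<open>Q\<^sub>j v(\<theta>) + (g\<^sub>j * v)(\<theta>)\<close>, where \<open>v(\<sigma>) = w(T - \<sigma>)\<close> and \<open>*\<close> is the convolution on
  \<open>(0,\<theta>)\<close>. So reaching the null state in row \<open>j\<close> is a Volterra equation for \<open>v\<close>, and it
  suffices to show that the old and the new equation of row \<open>k\<close> have the same solutions
  among those \<open>v\<close> that satisfy the equations of the rows \<open>j < k\<close>.

  Two operations transform the equation of row \<open>k\<close> without changing these solutions.
  First, \<open>f * v = 0\<close> on \<open>(0,L)\<close> holds iff \<open>f(0) v + f' * v = 0\<close> does, because \<open>f * v\<close> is
  the primitive of \<open>f(0) v + f' * v\<close> that vanishes at \<open>0\<close> (\<open>conv_zero_iff_derivative\<close>).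
  Second, multiples of the rows \<open>j < k\<close> may be added; they hold on \<open>(0,L\<^sub>k)\<close> since these
  rows are slower, \<open>L\<^sub>k \<le> L\<^sub>j\<close>. In the travel time of row \<open>k\<close> the function \<open>G\<^sub>j \<circ> \<zeta>\<^sub>k\<^sub>j\<close>
  is just \<open>g\<^sub>j\<close>, and \<open>\<D>\<^sub>k\<close> is \<open>d/d\<theta>\<close>. Hence adding \<open>a\<^sup>l\<close> times the rows \<open>j < k\<close> cancels
  the term \<open>\<omega>\<^sup>l v\<close> and leaves the convolution equation whose kernel is the next
  \<open>\<omega>\<close>-function (\<open>eliminate_trace_term\<close>), and differentiating this equation produces a new
  trace term. Doing both \<open>s + 1\<close> times ends with row \<open>k\<close> of the reduced system
  (\<open>reduced_row_vanishes_iff\<close>). The first assertion is the case \<open>k = 1\<close>, where nothing is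
  added; there the hypotheses on ordinary derivatives at \<open>0\<close> amount to those on iterates
  of \<open>\<D>\<^sub>1\<close> by the Leibniz rule (\<open>weighted_D_funpow_at_zero\<close>).

  To pass from the equations back to null controllability in a fixed time \<open>T\<close>
  (\<open>null_controllable_replace_row\<close>), the control and all components except \<open>y\<^sub>m\<^sub>+\<^sub>k\<close> are
  kept. The new component arises from the old one by adding a function of \<open>w\<close> alone, since
  the contributions of the initial datum cancel; it is continuous in time and in space
  with values in square integrable functions because translations are
  (\<open>L2_translation_continuous\<close>). This argument needs \<open>L\<^sub>k \<le> T\<close>. Otherwise neither system
  is null controllable in time \<open>T\<close> (\<open>null_controllable_imp_duration_le\<close>): the datum far
  from the outflow boundary is still visible at time \<open>T\<close> and only a continuous source
  contribution could compensate it, which is impossible for a step.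
\<close>

section \<open>Lebesgue measure on the line\<close>

lemma sigma_finite_lebesgue: "sigma_finite_measure (lebesgue :: real measure)"
proof
  have "emeasure lebesgue {- real n..real n} \<noteq> \<infinity>" for n :: nat
    by simp
  moreover have "(\<Union>n::nat. {- real n..real n}) = (UNIV :: real set)"
  proof (intro UNIV_eq_I[symmetric])
    fix x :: real
    obtain n :: nat where "\<bar>x\<bar> \<le> real n" using real_arch_simple by blast
    thus "x \<in> (\<Union>n::nat. {- real n..real n})" by (auto simp: abs_le_iff intro!: exI[of _ n])
  qed
  ultimately show "\<exists>A::real set set. countable A \<and> A \<subseteq> sets lebesgue \<and> \<Union>A = space lebesgue \<and> (\<forall>a\<in>A. emeasure lebesgue a \<noteq> \<infinity>)"
    by (intro exI[of _ "range (\<lambda>n::nat. {- real n..real n})"]) auto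
qed

interpretation lebesgue: sigma_finite_measure "lebesgue :: real measure"
  by (rule sigma_finite_lebesgue)

interpretation lebesgue_pair: pair_sigma_finite "lebesgue :: real measure" "lebesgue :: real measure" ..

text \<open>
  Lebesgue measure in the plane is the completion of the product measure and not the
  product of the completions; Fubini's theorem is applied to a Borel null set that
  contains the exceptional set.
\<close>
lemma AE_lebesgue_prod_slices:
  fixes P :: "real \<Rightarrow> real \<Rightarrow> bool"
  assumes "AE z in lebesgue. P (fst z) (snd z)"
  shows "AE t in lebesgue. AE x in lebesgue. P t x"
proof -
  have "AE z in (lborel :: (real \<times> real) measure). P (fst z) (snd z)"
    using assms by (simp add: AE_completion_iff)
  hence "AE z in (lborel \<Otimes>\<^sub>M lborel :: (real \<times> real) measure). P (fst z) (snd z)"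
    unfolding lborel_prod .
  from lborel_pair.AE_pair[OF this] show ?thesis by (simp add: AE_completion_iff)
qed

lemma enn2real_eq_imp_eq:
  fixes a b :: ennreal
  assumes "enn2real a = enn2real b" "a \<noteq> \<infinity>" "b \<noteq> \<infinity>"
  shows "a = b"
  using assms by (cases a; cases b) auto

lemma ennreal_eq_neg_imp_zero: "ennreal r = ennreal (- r) \<Longrightarrow> r = 0"
  by (cases "0 \<le> r") (auto simp: ennreal_neg)

text \<open>
  The positive and the negative part of a Borel version of \<open>f\<close> are densities of two
  measures that agree on all rays and therefore coincide.
\<close>
lemma integral_rays_zero_imp_AE_zero:
  fixes f :: "real \<Rightarrow> real"
  assumes f: "integrable lebesgue f"
    and zero: "\<And>a. (LINT x|lebesgue. indicator {a<..} x * f x) = 0"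
  shows "AE x in lebesgue. f x = 0"
proof -
  obtain g where g[measurable]: "g \<in> borel_measurable lborel" and fg: "AE x in lborel. f x = g x"
    using completion_ex_borel_measurable_real[of f lborel] f by auto
  have fg': "AE x in lebesgue. f x = g x" using fg by (rule AE_completion)
  have gL: "g \<in> borel_measurable lebesgue"
    using g by (rule measurable_completion)
  have "integrable lebesgue g"
    using integrable_cong_AE[OF _ gL fg'] f by auto
  hence gi: "integrable lborel g" by (simp add: integrable_completion)
  have eq: "(\<integral>\<^sup>+x\<in>{a<..}. ennreal (g x) \<partial>lborel) = (\<integral>\<^sup>+x\<in>{a<..}. ennreal (- g x) \<partial>lborel)"
    "(\<integral>\<^sup>+x\<in>{a<..}. ennreal (g x) \<partial>lborel) \<noteq> \<infinity>" for a
  proof -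
    have i: "integrable lborel (\<lambda>x. indicator {a<..} x * g x)"
      using integrable_mult_indicator[OF _ gi, of "{a<..}"] by simp
    have "(LINT x|lborel. indicator {a<..} x * g x) = (LINT x|lebesgue. indicator {a<..} x * g x)"
      by (rule integral_completion[symmetric]) measurable
    also have "\<dots> = (LINT x|lebesgue. indicator {a<..} x * f x)"
      using fg' borel_measurable_integrable[OF f] gL
      by (intro integral_cong_AE borel_measurable_times borel_measurable_indicator) auto
    finally have 0: "(LINT x|lborel. indicator {a<..} x * g x) = 0" using zero by simp
    have e1: "(\<integral>\<^sup>+x. ennreal (indicator {a<..} x * g x) \<partial>lborel) = (\<integral>\<^sup>+x\<in>{a<..}. ennreal (g x) \<partial>lborel)"
      by (intro nn_integral_cong) (auto split: split_indicator)
    have e2: "(\<integral>\<^sup>+x. ennreal (- (indicator {a<..} x * g x)) \<partial>lborel) = (\<integral>\<^sup>+x\<in>{a<..}. ennreal (- g x) \<partial>lborel)"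
      by (intro nn_integral_cong) (auto split: split_indicator)
    have fin: "(\<integral>\<^sup>+x. ennreal (indicator {a<..} x * g x) \<partial>lborel) \<noteq> \<infinity>"
         "(\<integral>\<^sup>+x. ennreal (- (indicator {a<..} x * g x)) \<partial>lborel) \<noteq> \<infinity>"
      using i unfolding real_integrable_def by auto
    have "enn2real (\<integral>\<^sup>+x. ennreal (indicator {a<..} x * g x) \<partial>lborel)
        = enn2real (\<integral>\<^sup>+x. ennreal (- (indicator {a<..} x * g x)) \<partial>lborel)"
      using real_lebesgue_integral_def[OF i] 0 by simp
    hence "(\<integral>\<^sup>+x. ennreal (indicator {a<..} x * g x) \<partial>lborel)
        = (\<integral>\<^sup>+x. ennreal (- (indicator {a<..} x * g x)) \<partial>lborel)"
      using fin by (rule enn2real_eq_imp_eq)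
    thus "(\<integral>\<^sup>+x\<in>{a<..}. ennreal (g x) \<partial>lborel) = (\<integral>\<^sup>+x\<in>{a<..}. ennreal (- g x) \<partial>lborel)"
      "(\<integral>\<^sup>+x\<in>{a<..}. ennreal (g x) \<partial>lborel) \<noteq> \<infinity>"
      using fin by (simp_all add: e1 e2)
  qed
  have "density lborel (\<lambda>x. ennreal (g x)) = density lborel (\<lambda>x. ennreal (- g x))"
    using eq by (intro measure_eqI_lessThan) (auto simp: emeasure_density less_top)
  hence "AE x in lborel. ennreal (g x) = ennreal (- g x)"
    by (subst (asm) sigma_finite_measure.density_unique_iff[OF sigma_finite_lborel]) auto
  hence "AE x in lborel. g x = 0"
    by (rule AE_mp) (intro AE_I2 impI, rule ennreal_eq_neg_imp_zero)
  hence "AE x in lebesgue. g x = 0" by (rule AE_completion)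
  with fg' show ?thesis by eventually_elim simp
qed

section \<open>Square integrable functions\<close>

lemma sq_sum_le: "(a + b)\<^sup>2 \<le> 2 * a\<^sup>2 + 2 * (b :: real)\<^sup>2"
  using zero_le_power2[of "a - b"] by (simp add: power2_sum power2_diff)

lemma L2_on_UNIV_indicator:
  assumes "S \<in> sets lebesgue"
  shows "L2_on S f \<longleftrightarrow> L2_on UNIV (\<lambda>x. indicator S x * f x)"
proof -
  have "(indicator S x * f x)\<^sup>2 = indicator S x * (f x)\<^sup>2" for x
    by (auto split: split_indicator)
  thus ?thesis using assms
    by (simp add: L2_on_def borel_measurable_restrict_space_iff integrable_restrict_space lebesgue_on_UNIV_eq)
qed

lemma L2_on_cmult: "L2_on S f \<Longrightarrow> L2_on S (\<lambda>x. c * f x)"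
  by (auto simp: L2_on_def power_mult_distrib)

lemma L2_on_add:
  assumes "L2_on S f" "L2_on S g"
  shows "L2_on S (\<lambda>x. f x + g x)"
proof -
  have "integrable (lebesgue_on S) (\<lambda>x. (f x + g x)\<^sup>2)"
  proof (rule Bochner_Integration.integrable_bound)
    show "integrable (lebesgue_on S) (\<lambda>x. 2 * (f x)\<^sup>2 + 2 * (g x)\<^sup>2)"
      using assms by (auto simp: L2_on_def)
    have "(f x + g x)\<^sup>2 \<le> 2 * (f x)\<^sup>2 + 2 * (g x)\<^sup>2" for x
      by (rule sq_sum_le)
    thus "AE x in lebesgue_on S. norm ((f x + g x)\<^sup>2) \<le> norm (2 * (f x)\<^sup>2 + 2 * (g x)\<^sup>2)"
      by (auto intro!: AE_I2)
  qed (use assms in \<open>auto simp: L2_on_def\<close>)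
  thus ?thesis using assms by (auto simp: L2_on_def)
qed

lemma L2_on_diff: "L2_on S f \<Longrightarrow> L2_on S g \<Longrightarrow> L2_on S (\<lambda>x. f x - g x)"
  using L2_on_add[of S f "\<lambda>x. (-1) * g x"] L2_on_cmult[of S g "-1"] by simp

lemma L2_on_sum: "(\<And>i. i \<in> I \<Longrightarrow> L2_on S (f i)) \<Longrightarrow> L2_on S (\<lambda>x. \<Sum>i\<in>I. f i x)"
  by (induction I rule: infinite_finite_induct) (auto simp: L2_on_add, auto simp: L2_on_def)

lemma L2_on_imp_integrable:
  assumes "L2_on S f" "S \<in> lmeasurable"
  shows "integrable (lebesgue_on S) f"
proof (rule Bochner_Integration.integrable_bound)
  have "integrable (lebesgue_on S) (\<lambda>x. 1 :: real)"
    by (rule finite_measure.integrable_const[OF finite_measure_lebesgue_on[OF assms(2)]])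
  thus "integrable (lebesgue_on S) (\<lambda>x. 1 + (f x)\<^sup>2)"
    using assms(1) by (intro Bochner_Integration.integrable_add) (simp_all add: L2_on_def)
  have "\<bar>f x\<bar> \<le> 1 + (f x)\<^sup>2" for x
    using zero_le_power2[of "\<bar>f x\<bar> - 1"] by (simp add: power2_diff)
  thus "AE x in lebesgue_on S. norm (f x) \<le> norm (1 + (f x)\<^sup>2)"
    by auto
qed (use assms in \<open>auto simp: L2_on_def\<close>)

lemma L2_on_subset:
  assumes f: "L2_on S f" and A: "A \<subseteq> S" "A \<in> sets lebesgue" "S \<in> sets lebesgue"
  shows "L2_on A f"
proof -
  have f': "L2_on UNIV (\<lambda>x. indicator S x * f x)" using f A L2_on_UNIV_indicator by blast
  have e: "indicator A x * f x = indicator A x * (indicator S x * f x)" for x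
    using A by (auto split: split_indicator)
  have f'm: "(\<lambda>x. indicator S x * f x) \<in> borel_measurable lebesgue"
    using f' by (simp add: L2_on_def lebesgue_on_UNIV_eq)
  have "integrable lebesgue (\<lambda>x. indicator A x *\<^sub>R (indicator S x * f x)\<^sup>2)"
    using f' A by (intro integrable_mult_indicator) (auto simp: L2_on_def lebesgue_on_UNIV_eq)
  moreover have "indicator A x *\<^sub>R (indicator S x * f x)\<^sup>2 = (indicator A x * f x)\<^sup>2" for x
    using A by (auto split: split_indicator)
  moreover have "(\<lambda>x. indicator A x * (indicator S x * f x)) \<in> borel_measurable lebesgue"
    by (rule borel_measurable_times[OF borel_measurable_indicator[OF A(2)] f'm])
  ultimately show ?thesis using A
    by (subst L2_on_UNIV_indicator) (auto simp: L2_on_def lebesgue_on_UNIV_eq e[symmetric])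
qed

lemma integrable_cmult_indicator_Icc: "integrable lebesgue (\<lambda>x. c * indicator {a..b::real} x :: real)"
  by (cases "a \<le> b") (auto intro!: integrable_mult_right integrable_real_indicator)

section \<open>Continuity of translations\<close>

lemma L2_on_translate:
  assumes "L2_on UNIV f" "c \<noteq> 0"
  shows "L2_on UNIV (\<lambda>x. f (t + c * x))"
    and "(LINT x|lebesgue. (f x)\<^sup>2) = \<bar>c\<bar> * (LINT x|lebesgue. (f (t + c * x))\<^sup>2)"
proof -
  have "f \<in> borel_measurable lebesgue" using assms by (simp add: L2_on_def lebesgue_on_UNIV_eq)
  moreover have "(\<lambda>x. t + c * x) \<in> lebesgue \<rightarrow>\<^sub>M lebesgue"
    using lebesgue_affine_measurable[where c= "\<lambda>x::real. c"] \<open>c \<noteq> 0\<close> by simp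
  ultimately have "(\<lambda>x. f (t + c * x)) \<in> borel_measurable lebesgue" by (rule measurable_compose_rev)
  thus "L2_on UNIV (\<lambda>x. f (t + c * x))"
    using assms lebesgue_integrable_real_affine_iff[OF assms(2), of "\<lambda>x. (f x)\<^sup>2" t]
    by (simp add: L2_on_def lebesgue_on_UNIV_eq)
  show "(LINT x|lebesgue. (f x)\<^sup>2) = \<bar>c\<bar> * (LINT x|lebesgue. (f (t + c * x))\<^sup>2)"
    using lebesgue_integral_real_affine[OF assms(2), of "\<lambda>x. (f x)\<^sup>2" t] by simp
qed

text \<open>
  Cutting off large values changes \<open>f\<close> little, by dominated convergence. The bounded
  function that remains is an almost everywhere limit of continuous functions, and once
  these are cut off in the same way and localized to a neighbourhood of the support,
  dominated convergence applies again.
\<close>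
lemma L2_approx_continuous:
  assumes f: "L2_on UNIV f" and supp: "\<And>x. \<bar>x\<bar> > R \<Longrightarrow> f x = 0" and "0 < e"
  obtains g M where "continuous_on UNIV g" "\<And>x. \<bar>x\<bar> > R + 1 \<Longrightarrow> g x = 0" "\<And>x. \<bar>g x\<bar> \<le> M"
    "L2_on UNIV g" "(LINT x|lebesgue. (f x - g x)\<^sup>2) < e"
proof -
  have fm[measurable]: "f \<in> borel_measurable lebesgue" and f2: "integrable lebesgue (\<lambda>x. (f x)\<^sup>2)"
    using f by (simp_all add: L2_on_def lebesgue_on_UNIV_eq)
  define clip :: "real \<Rightarrow> real \<Rightarrow> real" where "clip = (\<lambda>M y. max (-M) (min M y))"
  have clip_meas[measurable]: "clip M \<in> borel_measurable borel" for M
    unfolding clip_def by measurable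
  have "(\<lambda>n. LINT x|lebesgue. (f x - clip (real n) (f x))\<^sup>2) \<longlonglongrightarrow> (LINT x|(lebesgue::real measure). 0)"
  proof (rule integral_dominated_convergence[where w="\<lambda>x. (f x)\<^sup>2"])
    show "AE x in lebesgue. (\<lambda>n. (f x - clip (real n) (f x))\<^sup>2) \<longlonglongrightarrow> 0"
    proof (intro AE_I2)
      fix x
      obtain N :: nat where N: "\<bar>f x\<bar> \<le> real N" using real_arch_simple by blast
      have "\<forall>\<^sub>F n in sequentially. 0 = (f x - clip (real n) (f x))\<^sup>2"
        using eventually_ge_at_top[of N] by eventually_elim (use N in \<open>auto simp: clip_def\<close>)
      thus "(\<lambda>n. (f x - clip (real n) (f x))\<^sup>2) \<longlonglongrightarrow> 0"
        by (rule Lim_transform_eventually[OF tendsto_const])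
    qed
    show "AE x in lebesgue. norm ((f x - clip (real n) (f x))\<^sup>2) \<le> (f x)\<^sup>2" for n
    proof (intro AE_I2)
      fix x
      have "\<bar>f x - clip (real n) (f x)\<bar> \<le> \<bar>f x\<bar>" by (auto simp: clip_def)
      hence "(f x - clip (real n) (f x))\<^sup>2 \<le> (f x)\<^sup>2" by (simp only: abs_le_square_iff)
      thus "norm ((f x - clip (real n) (f x))\<^sup>2) \<le> (f x)\<^sup>2" by simp
    qed
  qed (use f2 in measurable)
  hence "\<forall>\<^sub>F n in sequentially. (LINT x|lebesgue. (f x - clip (real n) (f x))\<^sup>2) < e / 4"
    using \<open>0 < e\<close> by (intro order_tendstoD(2)) auto
  then obtain n where n: "(LINT x|lebesgue. (f x - clip (real n) (f x))\<^sup>2) < e / 4"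
    using eventually_happens' sequentially_bot by blast
  define M where "M = real n"
  have M: "0 \<le> M" by (simp add: M_def)
  have clip_le: "\<bar>clip M y\<bar> \<le> M" for y using M by (auto simp: clip_def)
  \<comment> \<open>The continuous cutoff is \<open>1\<close> where \<open>f\<close> may be nonzero.\<close>
  define bump :: "real \<Rightarrow> real" where "bump = (\<lambda>x. max 0 (min 1 (R + 1 - \<bar>x\<bar>)))"
  have bump: "0 \<le> bump x" "bump x \<le> 1" "\<bar>x\<bar> > R + 1 \<Longrightarrow> bump x = 0" "\<bar>x\<bar> \<le> R \<Longrightarrow> bump x = 1" for x
    by (auto simp: bump_def)
  have "f measurable_on UNIV" using fm by (intro lebesgue_measurable_imp_measurable_on) auto
  then obtain N k where N: "negligible N" and k: "\<And>j. continuous_on UNIV (k j :: real \<Rightarrow> real)"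
    and lim: "\<And>x. x \<notin> N \<Longrightarrow> (\<lambda>j. k j x) \<longlonglongrightarrow> f x"
    unfolding measurable_on_def by auto
  define g where "g = (\<lambda>j x. bump x * clip M (k j x))"
  have gc: "continuous_on UNIV (g j)" for j
    unfolding g_def bump_def clip_def by (intro continuous_intros k)
  have gm[measurable]: "g j \<in> borel_measurable lebesgue" for j
    using borel_measurable_continuous_onI[OF gc[of j]] by (intro measurable_completion) simp
  have gs: "g j x = 0" if "\<bar>x\<bar> > R + 1" for j x using bump(3)[OF that] by (simp add: g_def)
  have gM: "\<bar>g j x\<bar> \<le> M" for j x
    using mult_mono[OF bump(2)[of x] clip_le[of "k j x"]] bump(1)[of x] by (auto simp: g_def abs_mult)
  have fb: "clip M (f x) = bump x * clip M (f x)" for x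
  proof (cases "\<bar>x\<bar> \<le> R")
    case False thus ?thesis using supp[of x] M by (simp add: clip_def)
  qed (simp add: bump)
  have "(\<lambda>j. LINT x|lebesgue. (clip M (f x) - g j x)\<^sup>2) \<longlonglongrightarrow> (LINT x|(lebesgue::real measure). 0)"
  proof (rule integral_dominated_convergence[where w="\<lambda>x. (2 * M)\<^sup>2 * indicator {-(R+1)..R+1} x"])
    have "AE x in lebesgue. x \<notin> N" using N by (simp add: negligible_iff_null_sets AE_not_in)
    thus "AE x in lebesgue. (\<lambda>j. (clip M (f x) - g j x)\<^sup>2) \<longlonglongrightarrow> 0"
    proof eventually_elim
      case (elim x)
      have "(\<lambda>j. (clip M (f x) - g j x)\<^sup>2) \<longlonglongrightarrow> (clip M (f x) - bump x * clip M (f x))\<^sup>2"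
        unfolding g_def clip_def by (intro tendsto_intros lim[OF elim])
      thus ?case using fb[of x] by simp
    qed
    show "AE x in lebesgue. norm ((clip M (f x) - g j x)\<^sup>2) \<le> (2 * M)\<^sup>2 * indicator {-(R+1)..R+1} x" for j
    proof (intro AE_I2)
      fix x
      show "norm ((clip M (f x) - g j x)\<^sup>2) \<le> (2 * M)\<^sup>2 * indicator {-(R+1)..R+1} x"
      proof (cases "\<bar>x\<bar> > R + 1")
        case True
        hence "clip M (f x) - g j x = 0" using supp[of x] gs[of x j] M by (simp add: clip_def)
        thus ?thesis by simp
      next
        case False
        have "\<bar>clip M (f x) - g j x\<bar> \<le> \<bar>2 * M\<bar>" using clip_le[of "f x"] gM[of j x] M by linarith
        hence "(clip M (f x) - g j x)\<^sup>2 \<le> (2 * M)\<^sup>2" by (simp only: abs_le_square_iff)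
        thus ?thesis using False by (auto simp: indicator_def abs_le_iff)
      qed
    qed
    show "integrable lebesgue (\<lambda>x. (2 * M)\<^sup>2 * indicator {-(R+1)..R+1} x)"
      by (rule integrable_cmult_indicator_Icc)
  qed measurable
  hence "\<forall>\<^sub>F j in sequentially. (LINT x|lebesgue. (clip M (f x) - g j x)\<^sup>2) < e / 4"
    using \<open>0 < e\<close> by (intro order_tendstoD(2)) auto
  then obtain j where j: "(LINT x|lebesgue. (clip M (f x) - g j x)\<^sup>2) < e / 4"
    using eventually_happens' sequentially_bot by blast
  have gL2: "L2_on UNIV (g j)"
  proof -
    have "integrable lebesgue (\<lambda>x. (g j x)\<^sup>2)"
    proof (rule Bochner_Integration.integrable_bound[where f = "\<lambda>x. M\<^sup>2 * indicator {-(R+1)..R+1} x"])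
      show "AE x in lebesgue. norm ((g j x)\<^sup>2) \<le> norm (M\<^sup>2 * indicator {-(R+1)..R+1} x)"
      proof (intro AE_I2)
        fix x
        have "(g j x)\<^sup>2 \<le> M\<^sup>2" using gM[of j x] M abs_le_square_iff[of "g j x" M] by simp
        thus "norm ((g j x)\<^sup>2) \<le> norm (M\<^sup>2 * indicator {-(R+1)..R+1} x)"
          using gs[of x j] by (auto simp: indicator_def abs_le_iff not_le)
      qed
      show "integrable lebesgue (\<lambda>x. M\<^sup>2 * indicator {-(R+1)..R+1} x)"
        by (rule integrable_cmult_indicator_Icc)
    qed measurable
    thus ?thesis by (simp add: L2_on_def lebesgue_on_UNIV_eq)
  qed
  have cL2: "L2_on UNIV (\<lambda>x. clip M (f x))"
  proof -
    have "integrable lebesgue (\<lambda>x. (clip M (f x))\<^sup>2)"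
    proof (rule Bochner_Integration.integrable_bound[OF f2])
      show "AE x in lebesgue. norm ((clip M (f x))\<^sup>2) \<le> norm ((f x)\<^sup>2)"
      proof (intro AE_I2)
        fix x
        have "\<bar>clip M (f x)\<bar> \<le> \<bar>f x\<bar>" using M by (auto simp: clip_def)
        thus "norm ((clip M (f x))\<^sup>2) \<le> norm ((f x)\<^sup>2)" by (simp add: abs_le_square_iff)
      qed
    qed measurable
    thus ?thesis by (simp add: L2_on_def lebesgue_on_UNIV_eq)
  qed
  have sq: "integrable lebesgue (\<lambda>x. (u x - v x)\<^sup>2)" if "L2_on UNIV u" "L2_on UNIV v" for u v
    using L2_on_diff[OF that] by (simp add: L2_on_def lebesgue_on_UNIV_eq)
  have "(LINT x|lebesgue. (f x - g j x)\<^sup>2) \<le> (LINT x|lebesgue. 2 * (f x - clip M (f x))\<^sup>2 + 2 * (clip M (f x) - g j x)\<^sup>2)"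
  proof (rule integral_mono)
    fix x
    from sq_sum_le[of "f x - clip M (f x)" "clip M (f x) - g j x"]
    show "(f x - g j x)\<^sup>2 \<le> 2 * (f x - clip M (f x))\<^sup>2 + 2 * (clip M (f x) - g j x)\<^sup>2" by simp
  qed (use sq f gL2 cL2 in auto)
  also have "\<dots> = 2 * (LINT x|lebesgue. (f x - clip M (f x))\<^sup>2) + 2 * (LINT x|lebesgue. (clip M (f x) - g j x)\<^sup>2)"
    using sq f gL2 cL2 by simp
  also have "\<dots> < e" using n j by (simp add: M_def)
  finally show ?thesis using that[of "g j" M] gc gs gM gL2 by blast
qed

text \<open>
  For continuous functions of bounded support this is dominated convergence. An
  approximation error is invariant under translation, so that the general case follows.
\<close>
lemma L2_translation_continuous:
  assumes f: "L2_on UNIV f" and supp: "\<And>x. \<bar>x\<bar> > R \<Longrightarrow> f x = 0"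
  shows "((\<lambda>h. LINT x|lebesgue. (f (x + h) - f x)\<^sup>2) \<longlongrightarrow> 0) (at 0)"
proof (rule tendstoI)
  fix e :: real assume "0 < e"
  have e9: "0 < e / 9" using \<open>0 < e\<close> by simp
  obtain g M where g: "continuous_on UNIV g" "\<And>x. \<bar>x\<bar> > R + 1 \<Longrightarrow> g x = 0" "\<And>x. \<bar>g x\<bar> \<le> M"
    "L2_on UNIV g" and fg: "(LINT x|lebesgue. (f x - g x)\<^sup>2) < e / 9"
    using L2_approx_continuous[OF f supp e9] by blast
  have gm[measurable]: "g \<in> borel_measurable borel"
    using g(1) by (rule borel_measurable_continuous_onI)
  have "((\<lambda>h. LINT x|lebesgue. (g (x + h) - g x)\<^sup>2) \<longlongrightarrow> 0) (at 0)"
    unfolding tendsto_at_iff_sequentially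
  proof (intro allI impI)
    fix X :: "nat \<Rightarrow> real" assume X0: "X \<longlonglongrightarrow> 0"
    then have "\<forall>\<^sub>F n in sequentially. \<bar>X n\<bar> < 1"
      using tendstoD[OF X0, of 1] by (simp add: dist_real_def)
    then obtain n0 where n0: "\<And>n. n \<ge> n0 \<Longrightarrow> \<bar>X n\<bar> < 1" by (auto simp: eventually_sequentially)
    have "(\<lambda>n. LINT x|lebesgue. (g (x + X (n + n0)) - g x)\<^sup>2) \<longlonglongrightarrow> (LINT x|(lebesgue::real measure). 0)"
    proof (rule integral_dominated_convergence[where w="\<lambda>x. (2 * M)\<^sup>2 * indicator {-(R+2)..R+2} x"])
      show "AE x in lebesgue. (\<lambda>n. (g (x + X (n + n0)) - g x)\<^sup>2) \<longlonglongrightarrow> 0"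
      proof (intro AE_I2)
        fix x
        have "isCont g x" using g(1) by (simp add: continuous_on_eq_continuous_at)
        moreover have "(\<lambda>n. x + X (n + n0)) \<longlonglongrightarrow> x + 0"
          by (intro tendsto_intros LIMSEQ_ignore_initial_segment X0)
        ultimately have "(\<lambda>n. g (x + X (n + n0))) \<longlonglongrightarrow> g x"
          using isCont_tendsto_compose[of x g "\<lambda>n. x + X (n + n0)" sequentially] by simp
        hence "(\<lambda>n. (g (x + X (n + n0)) - g x)\<^sup>2) \<longlonglongrightarrow> (g x - g x)\<^sup>2" by (intro tendsto_intros)
        thus "(\<lambda>n. (g (x + X (n + n0)) - g x)\<^sup>2) \<longlonglongrightarrow> 0" by simp
      qed
      show "AE x in lebesgue. norm ((g (x + X (n + n0)) - g x)\<^sup>2) \<le> (2 * M)\<^sup>2 * indicator {-(R+2)..R+2} x" for n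
      proof (intro AE_I2)
        fix x
        have "\<bar>X (n + n0)\<bar> < 1" by (intro n0) simp
        show "norm ((g (x + X (n + n0)) - g x)\<^sup>2) \<le> (2 * M)\<^sup>2 * indicator {-(R+2)..R+2} x"
        proof (cases "\<bar>x\<bar> > R + 2")
          case True
          hence "g (x + X (n + n0)) - g x = 0" using g(2)[of x] g(2)[of "x + X (n + n0)"] \<open>\<bar>X (n + n0)\<bar> < 1\<close> by force
          thus ?thesis by simp
        next
          case False
          have "\<bar>g (x + X (n + n0)) - g x\<bar> \<le> \<bar>2 * M\<bar>" using g(3)[of x] g(3)[of "x + X (n + n0)"] by linarith
          hence "(g (x + X (n + n0)) - g x)\<^sup>2 \<le> (2 * M)\<^sup>2" by (simp only: abs_le_square_iff)
          thus ?thesis using False by (auto simp: indicator_def abs_le_iff)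
        qed
      qed
      show "integrable lebesgue (\<lambda>x. (2 * M)\<^sup>2 * indicator {-(R+2)..R+2} x)"
        by (rule integrable_cmult_indicator_Icc)
      have "(\<lambda>x. (g (x + c) - g x)\<^sup>2) \<in> borel_measurable lborel" for c by measurable
      thus "(\<lambda>x. (g (x + X (n + n0)) - g x)\<^sup>2) \<in> borel_measurable lebesgue" for n
        by (intro measurable_completion)
    qed simp
    hence "(\<lambda>n. LINT x|lebesgue. (g (x + X n) - g x)\<^sup>2) \<longlonglongrightarrow> 0"
      using LIMSEQ_offset[of "\<lambda>n. LINT x|lebesgue. (g (x + X n) - g x)\<^sup>2" n0] by simp
    thus "((\<lambda>h. LINT x|lebesgue. (g (x + h) - g x)\<^sup>2) \<circ> X) \<longlonglongrightarrow> 0" by (simp add: o_def)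
  qed
  hence "\<forall>\<^sub>F h in at 0. (LINT x|lebesgue. (g (x + h) - g x)\<^sup>2) < e / 9"
    using \<open>0 < e\<close> by (intro order_tendstoD(2)) auto
  thus "\<forall>\<^sub>F h in at 0. dist (LINT x|lebesgue. (f (x + h) - f x)\<^sup>2) 0 < e"
  proof eventually_elim
    case (elim h)
    have fh: "L2_on UNIV (\<lambda>x. f (x + h))" and gh: "L2_on UNIV (\<lambda>x. g (x + h))"
      using L2_on_translate(1)[OF f, of 1 h] L2_on_translate(1)[OF g(4), of 1 h] by (simp_all add: add.commute)
    have tr: "(LINT x|lebesgue. (f (x + h) - g (x + h))\<^sup>2) = (LINT x|lebesgue. (f x - g x)\<^sup>2)"
      using L2_on_translate(2)[OF L2_on_diff[OF f g(4)], of 1 h] by (simp add: add.commute)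
    have sq: "integrable lebesgue (\<lambda>x. (u x - v x)\<^sup>2)" if "L2_on UNIV u" "L2_on UNIV v" for u v
      using L2_on_diff[OF that] by (simp add: L2_on_def lebesgue_on_UNIV_eq)
    have "(LINT x|lebesgue. (f (x + h) - f x)\<^sup>2) \<le> (LINT x|lebesgue. 3 * (f (x + h) - g (x + h))\<^sup>2 + 3 * (g (x + h) - g x)\<^sup>2 + 3 * (f x - g x)\<^sup>2)"
    proof (rule integral_mono)
      fix x
      have "(a + b - c)\<^sup>2 \<le> 3 * a\<^sup>2 + 3 * b\<^sup>2 + 3 * c\<^sup>2" for a b c :: real
      proof -
        have "0 \<le> (a - b)\<^sup>2 + (a + c)\<^sup>2 + (b + c)\<^sup>2" by simp
        thus ?thesis by (simp add: power2_eq_square algebra_simps)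
      qed
      from this[of "f (x + h) - g (x + h)" "g (x + h) - g x" "f x - g x"]
      show "(f (x + h) - f x)\<^sup>2 \<le> 3 * (f (x + h) - g (x + h))\<^sup>2 + 3 * (g (x + h) - g x)\<^sup>2 + 3 * (f x - g x)\<^sup>2" by simp
    qed (use sq f g(4) fh gh in auto)
    also have "\<dots> = 3 * (LINT x|lebesgue. (f (x + h) - g (x + h))\<^sup>2) + 3 * (LINT x|lebesgue. (g (x + h) - g x)\<^sup>2) + 3 * (LINT x|lebesgue. (f x - g x)\<^sup>2)"
      using sq f g(4) fh gh by simp
    also have "\<dots> < e" using elim fg tr by simp
    finally show ?case by (simp add: dist_real_def)
  qed
qed

lemma L2_shift_tendsto:
  assumes F: "L2_on UNIV F" "\<And>s. \<bar>s\<bar> > R \<Longrightarrow> F s = 0" and \<phi>: "(\<phi> \<longlongrightarrow> 0) A"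
  shows "((\<lambda>b. LINT s|lebesgue. (F (s + \<phi> b) - F s)\<^sup>2) \<longlongrightarrow> 0) A"
proof -
  let ?g = "\<lambda>h. LINT s|lebesgue. (F (s + h) - F s)\<^sup>2"
  have "?g 0 = 0" by simp
  hence "(?g \<longlongrightarrow> ?g 0) (at 0)" using L2_translation_continuous[OF F] by simp
  hence "(?g \<longlongrightarrow> ?g 0) (nhds 0)" by (rule tendsto_at_iff_tendsto_nhds[of ?g 0, THEN iffD1])
  from filterlim_compose[OF this \<phi>] show ?thesis by simp
qed

section \<open>Continuous functions with values in square integrable functions\<close>

lemma L2_on_diff_integrable:
  "L2_on S f \<Longrightarrow> L2_on S g \<Longrightarrow> integrable (lebesgue_on S) (\<lambda>x. (f x - g x)\<^sup>2)"
  using L2_on_diff[of S f g] by (simp add: L2_on_def)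

lemma continuous_into_L2_add:
  assumes F: "continuous_into_L2 A S F" and G: "continuous_into_L2 A S G"
  shows "continuous_into_L2 A S (\<lambda>a x. F a x + G a x)"
  unfolding continuous_into_L2_def
proof (intro conjI ballI)
  show "L2_on S (\<lambda>x. F a x + G a x)" if "a \<in> A" for a
    using F G that by (intro L2_on_add) (auto simp: continuous_into_L2_def)
  fix a assume a: "a \<in> A"
  let ?I = "\<lambda>H b. \<integral>x. (H b x - H a x)\<^sup>2 \<partial>lebesgue_on S"
  have lim: "((\<lambda>b. 2 * ?I F b + 2 * ?I G b) \<longlongrightarrow> 2 * 0 + 2 * 0) (at a within A)"
    using F G a by (intro tendsto_intros) (auto simp: continuous_into_L2_def)
  show "(?I (\<lambda>b x. F b x + G b x) \<longlongrightarrow> 0) (at a within A)"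
  proof (rule tendsto_sandwich[OF _ _ tendsto_const])
    show "((\<lambda>b. 2 * ?I F b + 2 * ?I G b) \<longlongrightarrow> 0) (at a within A)" using lim by simp
    show "\<forall>\<^sub>F b in at a within A. 0 \<le> ?I (\<lambda>b x. F b x + G b x) b" by simp
    have "?I (\<lambda>b x. F b x + G b x) b \<le> 2 * ?I F b + 2 * ?I G b" if b: "b \<in> A" for b
    proof -
      have L: "L2_on S (F a)" "L2_on S (F b)" "L2_on S (G a)" "L2_on S (G b)"
        using F G a b by (auto simp: continuous_into_L2_def)
      note i = L2_on_diff_integrable[OF L(2) L(1)] L2_on_diff_integrable[OF L(4) L(3)]
      have "?I (\<lambda>b x. F b x + G b x) b \<le> (\<integral>x. 2 * (F b x - F a x)\<^sup>2 + 2 * (G b x - G a x)\<^sup>2 \<partial>lebesgue_on S)"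
      proof (rule integral_mono)
        show "integrable (lebesgue_on S) (\<lambda>x. (F b x + G b x - (F a x + G a x))\<^sup>2)"
          using L by (intro L2_on_diff_integrable L2_on_add)
        show "(F b x + G b x - (F a x + G a x))\<^sup>2 \<le> 2 * (F b x - F a x)\<^sup>2 + 2 * (G b x - G a x)\<^sup>2" for x
          using sq_sum_le[of "F b x - F a x" "G b x - G a x"] by (simp add: algebra_simps)
      qed (use i in auto)
      also have "\<dots> = 2 * ?I F b + 2 * ?I G b" using i by simp
      finally show ?thesis .
    qed
    thus "\<forall>\<^sub>F b in at a within A. ?I (\<lambda>b x. F b x + G b x) b \<le> 2 * ?I F b + 2 * ?I G b"
      by (auto simp: eventually_at_filter)
  qed
qed

lemma continuous_into_L2_cmult:
  assumes "continuous_into_L2 A S F"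
  shows "continuous_into_L2 A S (\<lambda>a x. r * F a x)"
proof -
  have "(r * u - r * v)\<^sup>2 = r\<^sup>2 * (u - v)\<^sup>2" for u v :: real
    by (simp add: right_diff_distrib[symmetric] power_mult_distrib)
  thus ?thesis using assms
    by (auto simp: continuous_into_L2_def L2_on_cmult intro!: tendsto_mult_right_zero)
qed

lemma continuous_into_L2_diff:
  "continuous_into_L2 A S F \<Longrightarrow> continuous_into_L2 A S G \<Longrightarrow> continuous_into_L2 A S (\<lambda>a x. F a x - G a x)"
  using continuous_into_L2_add[of A S F "\<lambda>a x. (-1) * G a x"] continuous_into_L2_cmult[of A S G "-1"] by simp

text \<open>
  By uniform continuity on a compact set the slices converge uniformly.
\<close>
lemma continuous_into_L2_continuous:
  fixes H :: "real \<Rightarrow> real \<Rightarrow> real"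
  assumes A: "compact A" and cont: "continuous_on (A \<times> {c..d}) (\<lambda>(a, x). H a x)"
    and S: "S \<in> sets lebesgue" "S \<subseteq> {c..d}"
  shows "continuous_into_L2 A S H"
  unfolding continuous_into_L2_def
proof (intro conjI ballI)
  have L: "L2_on S (H a)" if a: "a \<in> A" for a
  proof (rule L2_on_subset[OF _ S(2) S(1)])
    have "continuous_on {c..d} (H a)"
      using continuous_on_compose2[OF cont continuous_on_Pair[OF continuous_on_const[of "{c..d}" a] continuous_on_id]] a
      by auto
    thus "L2_on {c..d} (H a)" unfolding L2_on_def
      by (auto intro!: continuous_imp_integrable_real continuous_intros continuous_imp_measurable_on_sets_lebesgue)
  qed simp
  show "L2_on S (H a)" if "a \<in> A" for a using L[OF that] .
  have Sfin: "S \<in> lmeasurable"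
    using S by (metis bounded_closed_interval bounded_set_imp_lmeasurable bounded_subset)
  fix a assume a: "a \<in> A"
  show "((\<lambda>b. \<integral>x. (H b x - H a x)\<^sup>2 \<partial>lebesgue_on S) \<longlongrightarrow> 0) (at a within A)"
  proof (rule tendstoI)
    fix e :: real assume e: "0 < e"
    define k where "k = measure lebesgue S + 1"
    have k: "k > 0" "measure lebesgue S < k" by (auto simp: k_def add_nonneg_pos)
    have "uniformly_continuous_on (A \<times> {c..d}) (\<lambda>(a, x). H a x)"
      using A by (intro compact_uniformly_continuous[OF cont] compact_Times) auto
    then obtain r where r: "r > 0" "\<And>p q. p \<in> A \<times> {c..d} \<Longrightarrow> q \<in> A \<times> {c..d} \<Longrightarrow> dist q p < r \<Longrightarrow>
        dist ((\<lambda>(a, x). H a x) q) ((\<lambda>(a, x). H a x) p) < sqrt (e / k)"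
      using e k unfolding uniformly_continuous_on_def by (metis divide_pos_pos real_sqrt_gt_0_iff)
    have "dist (\<integral>x. (H b x - H a x)\<^sup>2 \<partial>lebesgue_on S) 0 < e" if b: "b \<in> A" "dist b a < r" for b
    proof -
      have le: "(H b x - H a x)\<^sup>2 \<le> e / k" if x: "x \<in> S" for x
      proof -
        have "dist (b, x) (a, x) < r" using b by (simp add: dist_Pair_Pair)
        hence "\<bar>H b x - H a x\<bar> < sqrt (e / k)"
          using r(2)[of "(a, x)" "(b, x)"] a b x S by (auto simp: dist_real_def)
        hence "\<bar>H b x - H a x\<bar>\<^sup>2 \<le> (sqrt (e / k))\<^sup>2" by (intro power_mono) auto
        thus ?thesis using e k by simp
      qed
      have c: "integrable (lebesgue_on S) (\<lambda>x. e / k :: real)"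
        by (rule finite_measure.integrable_const[OF finite_measure_lebesgue_on[OF Sfin]])
      have "(\<integral>x. (H b x - H a x)\<^sup>2 \<partial>lebesgue_on S) \<le> (\<integral>x. e / k \<partial>lebesgue_on S)"
        using le by (intro integral_mono L2_on_diff_integrable L c) (auto simp: a b)
      also have "\<dots> = e / k * measure lebesgue S" using S(1) by (simp add: measure_restrict_space)
      also have "\<dots> < e / k * k" using e k by (intro mult_strict_left_mono) auto
      finally show ?thesis using k by (simp add: dist_real_def)
    qed
    thus "\<forall>\<^sub>F b in at a within A. dist (\<integral>x. (H b x - H a x)\<^sup>2 \<partial>lebesgue_on S) 0 < e"
      using r(1) by (auto simp: eventually_at)
  qed
qed

text \<open>
  A broad solution is described for almost every time only. This lemma carries such a
  description over to the final time: for times \<open>b\<close> arbitrarily close to \<open>T\<close> the slice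
  \<open>d b\<close> vanishes on \<open>B\<close>, so that the integral of \<open>(d T)\<^sup>2\<close> over \<open>B\<close> is at most that of
  \<open>(d b - d T)\<^sup>2\<close>, which tends to \<open>0\<close>.
\<close>
lemma continuous_into_L2_AE_zero_endpoint:
  assumes d: "continuous_into_L2 {0..T} S d" and S: "S \<in> sets lebesgue"
    and B: "B \<in> sets lebesgue" "B \<subseteq> S" and t0: "0 \<le> t0" "t0 < T"
    and ae: "AE t in lebesgue. t0 < t \<and> t < T \<longrightarrow> (AE x in lebesgue. x \<in> B \<longrightarrow> d t x = 0)"
  shows "AE x in lebesgue. x \<in> B \<longrightarrow> d T x = 0"
proof -
  have L: "L2_on S (d t)" if "t \<in> {0..T}" for t using d that by (auto simp: continuous_into_L2_def)
  have LB: "L2_on B (d T)" using t0 by (intro L2_on_subset[OF L B(2) B(1) S]) auto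
  hence i: "integrable lebesgue (\<lambda>x. indicator B x * (d T x)\<^sup>2)"
    using B by (simp add: L2_on_def integrable_restrict_space)
  have "(LINT x|lebesgue. indicator B x * (d T x)\<^sup>2) \<le> 0 + e" if e: "e > 0" for e
  proof -
    have "((\<lambda>b. \<integral>x. (d b x - d T x)\<^sup>2 \<partial>lebesgue_on S) \<longlongrightarrow> 0) (at T within {0..T})"
      using d t0 by (auto simp: continuous_into_L2_def)
    hence "\<forall>\<^sub>F b in at T within {0..T}. (\<integral>x. (d b x - d T x)\<^sup>2 \<partial>lebesgue_on S) < e"
      using e by (rule order_tendstoD)
    then obtain r where r: "r > 0" "\<And>b. b \<in> {0..T} \<Longrightarrow> b \<noteq> T \<Longrightarrow> dist b T < r \<Longrightarrow> (\<integral>x. (d b x - d T x)\<^sup>2 \<partial>lebesgue_on S) < e"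
      unfolding eventually_at by blast
    define l where "l = max t0 (T - r)"
    have "l < T" using r t0 by (simp add: l_def)
    have "\<exists>b. l < b \<and> b < T \<and> (AE x in lebesgue. x \<in> B \<longrightarrow> d b x = 0)"
    proof (rule ccontr)
      assume neg: "\<not> ?thesis"
      from ae have "AE t in lebesgue. t \<in> {l<..<T} \<longrightarrow> t \<in> {}"
        by eventually_elim (use neg in \<open>auto simp: l_def\<close>)
      from mem_closed_if_AE_lebesgue_open[OF _ _ this, of "(l + T) / 2"] \<open>l < T\<close> show False by auto
    qed
    then obtain b where b: "l < b" "b < T" and zero: "AE x in lebesgue. x \<in> B \<longrightarrow> d b x = 0" by blast
    have bT: "b \<in> {0..T}" using b t0 by (auto simp: l_def)
    have i2: "integrable (lebesgue_on S) (\<lambda>x. (d b x - d T x)\<^sup>2)"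
      using t0 bT by (intro L2_on_diff_integrable L) auto
    hence i3: "integrable lebesgue (\<lambda>x. indicator S x * (d b x - d T x)\<^sup>2)"
      using S by (simp add: integrable_restrict_space)
    have "(LINT x|lebesgue. indicator B x * (d T x)\<^sup>2) \<le> (LINT x|lebesgue. indicator S x * (d b x - d T x)\<^sup>2)"
    proof (rule integral_mono_AE[OF i i3])
      show "AE x in lebesgue. indicator B x * (d T x)\<^sup>2 \<le> indicator S x * (d b x - d T x)\<^sup>2"
        using zero by eventually_elim (use B in \<open>auto split: split_indicator\<close>)
    qed
    also have "\<dots> = (\<integral>x. (d b x - d T x)\<^sup>2 \<partial>lebesgue_on S)"
      using S by (simp add: integral_restrict_space)
    also have "\<dots> < e" using b bT by (intro r) (auto simp: l_def dist_real_def)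
    finally show ?thesis by simp
  qed
  hence "(LINT x|lebesgue. indicator B x * (d T x)\<^sup>2) \<le> 0" by (rule field_le_epsilon)
  moreover have "(LINT x|lebesgue. indicator B x * (d T x)\<^sup>2) \<ge> 0" by (rule integral_nonneg_AE) simp
  ultimately have "(LINT x|lebesgue. indicator B x * (d T x)\<^sup>2) = 0" by simp
  hence "AE x in lebesgue. indicator B x * (d T x)\<^sup>2 = 0"
    by (subst (asm) integral_nonneg_eq_0_iff_AE[OF i]) auto
  thus ?thesis by eventually_elim auto
qed

section \<open>Duhamel integrals and convolutions\<close>

text \<open>
  The source \<open>g \<cdot> W\<close> collected along a characteristic that has travelled for the time \<open>\<theta>\<close>
  when it arrives at time \<open>t\<close>, where \<open>g\<close> is a function of the travel time.
\<close>
definition duhamel :: "(real \<Rightarrow> real) \<Rightarrow> (real \<Rightarrow> real) \<Rightarrow> real \<Rightarrow> real \<Rightarrow> real" where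
  "duhamel g W t \<theta> = (LINT \<tau>|lebesgue. indicator {t - \<theta><..<t} \<tau> * (g (\<theta> - t + \<tau>) * W \<tau>))"

lemma measurable_lebesgue_continuous:
  assumes "continuous_on UNIV (g :: real \<Rightarrow> real)"
  shows "g \<in> borel_measurable lebesgue"
  using borel_measurable_continuous_onI[OF assms] by (intro measurable_completion) simp

lemma integrable_duhamel:
  fixes g W :: "real \<Rightarrow> real"
  assumes g: "continuous_on UNIV g" "\<And>x. \<bar>g x\<bar> \<le> B" and W: "integrable lebesgue W"
  shows "integrable lebesgue (\<lambda>\<tau>. indicator {a<..<b} \<tau> * (g (c + \<tau>) * W \<tau>))"
proof (rule Bochner_Integration.integrable_bound)
  show "integrable lebesgue (\<lambda>\<tau>. B * W \<tau>)" using W by simp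
  have "continuous_on UNIV (\<lambda>\<tau>. g (c + \<tau>))"
    by (intro continuous_on_compose2[OF g(1)] continuous_intros) auto
  hence "(\<lambda>\<tau>. g (c + \<tau>)) \<in> borel_measurable lebesgue" by (rule measurable_lebesgue_continuous)
  thus "(\<lambda>\<tau>. indicator {a<..<b} \<tau> * (g (c + \<tau>) * W \<tau>)) \<in> borel_measurable lebesgue"
    using W by (intro borel_measurable_times[OF borel_measurable_indicator]) auto
  have "\<bar>g (c + \<tau>) * W \<tau>\<bar> \<le> \<bar>B * W \<tau>\<bar>" for \<tau>
    using mult_right_mono[OF order_trans[OF g(2)[of "c + \<tau>"] abs_ge_self[of B]] abs_ge_zero[of "W \<tau>"]]
    by (simp add: abs_mult)
  thus "AE \<tau> in lebesgue. norm (indicator {a<..<b} \<tau> * (g (c + \<tau>) * W \<tau>)) \<le> norm (B * W \<tau>)"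
    by (intro AE_I2) (simp add: indicator_def)
qed

text \<open>
  Although \<open>W\<close> need not be continuous, moving \<open>t\<close> and \<open>\<theta>\<close> only moves the kernel and the
  endpoints of the interval, so that the integrands converge off two points.
\<close>
lemma continuous_duhamel:
  assumes g: "continuous_on UNIV g" "\<And>x. \<bar>g x\<bar> \<le> B" and W: "integrable lebesgue W"
  shows "continuous_on UNIV (\<lambda>(t, \<theta>). duhamel g W t \<theta>)"
proof (rule continuous_on_sequentiallyI)
  fix u :: "nat \<Rightarrow> real \<times> real" and p :: "real \<times> real" assume "u \<longlonglongrightarrow> p"
  obtain t \<theta> where p: "p = (t, \<theta>)" by fastforce
  define t' \<theta>' where "t' = (\<lambda>n. fst (u n))" and "\<theta>' = (\<lambda>n. snd (u n))"
  have t': "t' \<longlonglongrightarrow> t" and \<theta>': "\<theta>' \<longlonglongrightarrow> \<theta>"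
    using tendsto_fst[OF \<open>u \<longlonglongrightarrow> p\<close>] tendsto_snd[OF \<open>u \<longlonglongrightarrow> p\<close>] by (simp_all add: p t'_def \<theta>'_def)
  have d': "(\<lambda>n. t' n - \<theta>' n) \<longlonglongrightarrow> t - \<theta>" by (intro tendsto_intros t' \<theta>')
  have "(\<lambda>n. duhamel g W (t' n) (\<theta>' n)) \<longlonglongrightarrow> duhamel g W t \<theta>"
    unfolding duhamel_def
  proof (rule integral_dominated_convergence[where w="\<lambda>\<tau>. B * \<bar>W \<tau>\<bar>"])
    show "integrable lebesgue (\<lambda>\<tau>. B * \<bar>W \<tau>\<bar>)" using W by simp
    show "AE \<tau> in lebesgue. norm (indicator {t' n - \<theta>' n<..<t' n} \<tau> * (g (\<theta>' n - t' n + \<tau>) * W \<tau>)) \<le> B * \<bar>W \<tau>\<bar>" for n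
    proof (intro AE_I2)
      fix \<tau>
      have "\<bar>g (\<theta>' n - t' n + \<tau>)\<bar> * \<bar>W \<tau>\<bar> \<le> B * \<bar>W \<tau>\<bar>" by (intro mult_right_mono g) auto
      moreover from order_trans[OF abs_ge_zero this[unfolded abs_mult[symmetric]]] have "0 \<le> B * \<bar>W \<tau>\<bar>" .
      ultimately show "norm (indicator {t' n - \<theta>' n<..<t' n} \<tau> * (g (\<theta>' n - t' n + \<tau>) * W \<tau>)) \<le> B * \<bar>W \<tau>\<bar>"
        by (auto simp: indicator_def abs_mult)
    qed
    have "AE \<tau> in lebesgue. \<tau> \<notin> {t, t - \<theta>}"
      by (intro AE_not_in) (simp add: negligible_iff_null_sets[symmetric])
    thus "AE \<tau> in lebesgue. (\<lambda>n. indicator {t' n - \<theta>' n<..<t' n} \<tau> * (g (\<theta>' n - t' n + \<tau>) * W \<tau>))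
        \<longlonglongrightarrow> indicator {t - \<theta><..<t} \<tau> * (g (\<theta> - t + \<tau>) * W \<tau>)"
    proof eventually_elim
      case (elim \<tau>)
      have "(\<lambda>n. g (\<theta>' n - t' n + \<tau>)) \<longlonglongrightarrow> g (\<theta> - t + \<tau>)"
        using g(1) by (intro isCont_tendsto_compose[of _ g] tendsto_intros t' \<theta>') (auto simp: continuous_on_eq_continuous_at)
      moreover have "(\<lambda>n. indicat_real {t' n - \<theta>' n<..<t' n} \<tau>) \<longlonglongrightarrow> indicat_real {t - \<theta><..<t} \<tau>"
      proof (rule Lim_transform_eventually[OF tendsto_const])
        consider "\<tau> < t - \<theta>" | "t < \<tau>" | "t - \<theta> < \<tau>" "\<tau> < t" using elim by force
        thus "\<forall>\<^sub>F n in sequentially. indicat_real {t - \<theta><..<t} \<tau> = indicat_real {t' n - \<theta>' n<..<t' n} \<tau>"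
        proof cases
          case 1
          from order_tendstoD(1)[OF d' 1] show ?thesis by eventually_elim (use 1 in auto)
        next
          case 2
          from order_tendstoD(2)[OF t' 2] show ?thesis by eventually_elim (use 2 in auto)
        next
          case 3
          from order_tendstoD(2)[OF d' 3(1)] order_tendstoD(1)[OF t' 3(2)] show ?thesis
            by eventually_elim (use 3 in auto)
        qed
      qed
      ultimately show ?case by (intro tendsto_intros)
    qed
  qed (use integrable_duhamel[OF g W] in auto)
  thus "(\<lambda>n. case u n of (t, \<theta>) \<Rightarrow> duhamel g W t \<theta>) \<longlonglongrightarrow> (case p of (t, \<theta>) \<Rightarrow> duhamel g W t \<theta>)"
    by (simp add: p t'_def \<theta>'_def case_prod_beta)
qed

definition convolution :: "(real \<Rightarrow> real) \<Rightarrow> (real \<Rightarrow> real) \<Rightarrow> real \<Rightarrow> real" where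
  "convolution g v \<theta> = (LINT \<sigma>|lebesgue. indicator {0<..<\<theta>} \<sigma> * (g (\<theta> - \<sigma>) * v \<sigma>))"

lemma duhamel_eq_conv: "duhamel g W t \<theta> = convolution g (\<lambda>\<sigma>. W (t - \<sigma>)) \<theta>"
  unfolding duhamel_def convolution_def
  by (subst lebesgue_integral_real_affine[of "-1" _ t])
     (auto simp: algebra_simps split: split_indicator intro!: Bochner_Integration.integral_cong)

section \<open>Travel time along characteristics\<close>

locale positive_speed =
  fixes c :: "real \<Rightarrow> real"
  assumes speed_continuous: "continuous_on {0..1} c"
    and speed_pos: "\<And>x. x \<in> {0..1} \<Longrightarrow> 0 < c x"
begin

definition travel :: "real \<Rightarrow> real" where
  "travel x = integral {0..x} (\<lambda>\<xi>. 1 / c \<xi>)"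

definition duration :: real where
  "duration = travel 1"

text \<open>
  The inverse of the travel time, extended by constants so that kernels composed with it
  are continuous and bounded on the whole line.
\<close>
definition position :: "real \<Rightarrow> real" where
  "position \<sigma> = the_inv_into {0..1} travel (max 0 (min duration \<sigma>))"

lemma travel_0 [simp]: "travel 0 = 0"
  by (simp add: travel_def)

lemma travel_derivative:
  assumes "x \<in> {0..1}"
  shows "(travel has_real_derivative 1 / c x) (at x within {0..1})"
proof -
  have "continuous_on {0..1} (\<lambda>\<xi>. 1 / c \<xi>)"
    using speed_pos by (intro continuous_intros speed_continuous) force
  from integral_has_real_derivative[OF this assms] show ?thesis
    unfolding travel_def[abs_def] .
qed

lemma continuous_on_travel: "continuous_on {0..1} travel"
  using travel_derivative by (meson DERIV_continuous continuous_on_eq_continuous_within)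

lemma travel_strict_mono:
  assumes "0 \<le> x" "x < y" "y \<le> 1"
  shows "travel x < travel y"
proof (rule DERIV_pos_imp_increasing_open[OF assms(2)])
  fix z assume z: "x < z" "z < y"
  hence "z \<in> {0..1}" "at z within {0..1} = at z" using assms by (auto intro: at_within_Icc_at)
  thus "\<exists>y. (travel has_real_derivative y) (at z) \<and> 0 < y"
    using travel_derivative[of z] speed_pos[of z] by auto
qed (rule continuous_on_subset[OF continuous_on_travel], use assms in auto)

lemma travel_mono: "0 \<le> x \<Longrightarrow> x \<le> y \<Longrightarrow> y \<le> 1 \<Longrightarrow> travel x \<le> travel y"
  using travel_strict_mono[of x y] by (cases "x = y") auto

lemma duration_pos: "0 < duration"
  using travel_strict_mono[of 0 1] by (simp add: duration_def)

lemma travel_bounds: "x \<in> {0..1} \<Longrightarrow> travel x \<in> {0..duration}"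
  using travel_mono[of 0 x] travel_mono[of x 1] by (auto simp: duration_def)

lemma travel_open_bounds: "x \<in> {0<..<1} \<Longrightarrow> travel x \<in> {0<..<duration}"
  using travel_strict_mono[of 0 x] travel_strict_mono[of x 1] by (auto simp: duration_def)

lemma inj_on_travel: "inj_on travel {0..1}"
  by (rule linorder_inj_onI) (use travel_strict_mono in force)+

lemma travel_image: "travel ` {0..1} = {0..duration}"
proof
  show "travel ` {0..1} \<subseteq> {0..duration}" using travel_bounds by auto
  show "{0..duration} \<subseteq> travel ` {0..1}"
  proof
    fix s assume "s \<in> {0..duration}"
    then obtain x where "0 \<le> x" "x \<le> 1" "travel x = s"
      using IVT'[of travel 0 s 1] continuous_on_travel by (auto simp: duration_def)
    thus "s \<in> travel ` {0..1}" by auto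
  qed
qed

lemma position_travel [simp]: "x \<in> {0..1} \<Longrightarrow> position (travel x) = x"
  using travel_bounds[of x] by (simp add: position_def the_inv_into_f_f[OF inj_on_travel])

lemma position_bounds: "position \<sigma> \<in> {0..1}"
proof -
  have "max 0 (min duration \<sigma>) \<in> travel ` {0..1}"
    using duration_pos unfolding travel_image by auto
  from the_inv_into_into[OF inj_on_travel this order_refl] show ?thesis by (simp add: position_def)
qed

lemma travel_position: "\<sigma> \<in> {0..duration} \<Longrightarrow> travel (position \<sigma>) = \<sigma>"
  using f_the_inv_into_f[OF inj_on_travel, of \<sigma>] unfolding travel_image by (simp add: position_def)

lemma position_0 [simp]: "position 0 = 0"
  using position_travel[of 0] by simp

lemma position_image: "position ` {0..duration} = {0..1}"
proof
  show "position ` {0..duration} \<subseteq> {0..1}" using position_bounds by blast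
  show "{0..1} \<subseteq> position ` {0..duration}"
  proof
    fix x :: real assume "x \<in> {0..1}"
    thus "x \<in> position ` {0..duration}"
      using travel_bounds[of x] by (intro image_eqI[of _ _ "travel x"]) auto
  qed
qed

lemma inj_on_position: "inj_on position {0..duration}"
  by (metis inj_on_inverseI travel_position)

lemma continuous_on_position: "continuous_on UNIV position"
proof -
  have "continuous_on (travel ` {0..1}) (the_inv_into {0..1} travel)"
    by (rule continuous_on_inv[OF continuous_on_travel]) (auto simp: the_inv_into_f_f[OF inj_on_travel])
  hence inv: "continuous_on {0..duration} (the_inv_into {0..1} travel)" by (simp only: travel_image)
  have "continuous_on UNIV (\<lambda>\<sigma>. max 0 (min duration \<sigma>))" by (intro continuous_intros)
  moreover have "(\<lambda>\<sigma>. max 0 (min duration \<sigma>)) ` UNIV \<subseteq> {0..duration}" using duration_pos by auto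
  ultimately show ?thesis
    unfolding position_def by (rule continuous_on_compose2[OF inv])
qed

lemma position_derivative:
  assumes "\<sigma> \<in> {0..duration}"
  shows "(position has_real_derivative c (position \<sigma>)) (at \<sigma> within {0..duration})"
proof -
  let ?x = "position \<sigma>"
  have x: "?x \<in> {0..1}" by (rule position_bounds)
  have "(position has_derivative (*) (c ?x)) (at (travel ?x) within travel ` {0..1})"
  proof (rule has_derivative_inverse_within)
    show "(travel has_derivative (*) (1 / c ?x)) (at ?x within {0..1})"
      using travel_derivative[OF x] by (simp add: has_field_derivative_def)
    show "continuous (at (travel ?x) within travel ` {0..1}) position"
      using continuous_on_position by (metis UNIV_I continuous_on_eq_continuous_within continuous_within_subset subset_UNIV)
    show "(*) (c ?x) \<circ> (*) (1 / c ?x) = id" using speed_pos[OF x] by auto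
  qed (use x in \<open>auto intro: linear_times\<close>)
  thus ?thesis using assms by (simp add: travel_image travel_position has_field_derivative_def)
qed

text \<open>
  In the travel time coordinate every characteristic has unit speed.
\<close>
lemma characteristic_explicit:
  assumes ch: "characteristic c a t x \<gamma>" and \<tau>: "\<tau> \<in> {a..t}"
  shows "travel (\<gamma> \<tau>) = travel x - t + \<tau>" "\<gamma> \<tau> = position (travel x - t + \<tau>)"
proof -
  have at: "a \<le> t" "\<gamma> t = x" and \<gamma>: "\<And>s. s \<in> {a..t} \<Longrightarrow> \<gamma> s \<in> {0..1}"
    and d: "\<And>s. s \<in> {a..t} \<Longrightarrow> (\<gamma> has_real_derivative c (\<gamma> s)) (at s within {a..t})"
    using ch by (auto simp: characteristic_def)
  have "\<exists>k. \<forall>s\<in>{a..t}. travel (\<gamma> s) - s = k"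
  proof (rule has_field_derivative_zero_constant)
    fix s assume s: "s \<in> {a..t}"
    have "(travel has_real_derivative 1 / c (\<gamma> s)) (at (\<gamma> s) within \<gamma> ` {a..t})"
      by (rule DERIV_subset[OF travel_derivative]) (use \<gamma> s in auto)
    from DERIV_image_chain[OF this d[OF s]]
    have "((\<lambda>s. travel (\<gamma> s)) has_real_derivative 1) (at s within {a..t})"
      using speed_pos[OF \<gamma>[OF s]] by (simp add: o_def)
    thus "((\<lambda>s. travel (\<gamma> s) - s) has_real_derivative 0) (at s within {a..t})"
      by (auto intro!: derivative_eq_intros)
  qed simp
  then obtain k where k: "\<And>s. s \<in> {a..t} \<Longrightarrow> travel (\<gamma> s) - s = k" by blast
  show *: "travel (\<gamma> \<tau>) = travel x - t + \<tau>" using k[OF \<tau>] k[of t] at by simp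
  show "\<gamma> \<tau> = position (travel x - t + \<tau>)" using *[symmetric] \<gamma>[OF \<tau>] by simp
qed

lemma speed_bounded: obtains C where "0 < C" "\<And>x. x \<in> {0..1} \<Longrightarrow> c x \<le> C"
proof -
  have "bounded (c ` {0..1})"
    by (intro compact_imp_bounded compact_continuous_image speed_continuous) simp
  then obtain C where C: "\<forall>y\<in>c ` {0..1}. norm y \<le> C" unfolding bounded_iff by blast
  hence le: "c x \<le> C" if "x \<in> {0..1}" for x using that by (force simp: abs_le_iff)
  moreover have "0 < C" using speed_pos[of 0] le[of 0] by simp
  ultimately show ?thesis using that by blast
qed

text \<open>
  Substitution \<open>s = travel x\<close>, whose Jacobian \<open>c\<close> is bounded.
\<close>
lemma integrable_travel:
  assumes H: "integrable lebesgue H" and H0: "\<And>s. 0 \<le> H s" and C: "\<And>x. x \<in> {0..1} \<Longrightarrow> c x \<le> C"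
  shows "integrable (lebesgue_on {0<..<1}) (\<lambda>x. H (travel x))"
    and "(LINT x|lebesgue_on {0<..<1}. H (travel x)) \<le> C * (LINT s|lebesgue. H s)"
proof -
  let ?S = "{0..duration}" and ?f = "\<lambda>x. H (travel x)"
  let ?h = "\<lambda>s. \<bar>c (position s)\<bar> * ?f (position s)"
  have h: "?h s = c (position s) * H s" if "s \<in> ?S" for s
    using speed_pos[OF position_bounds[of s]] that by (simp add: travel_position)
  have cm: "(\<lambda>s. c (position s)) \<in> borel_measurable lebesgue"
  proof -
    have "continuous_on UNIV (\<lambda>s. c (position s))"
      by (rule continuous_on_compose2[OF speed_continuous continuous_on_position]) (use position_bounds in auto)
    from borel_measurable_continuous_onI[OF this] show ?thesis by (intro measurable_completion) simp
  qed
  have le: "c (position s) * H s \<le> C * H s" "0 \<le> c (position s) * H s" for s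
    using C[OF position_bounds] speed_pos[OF position_bounds[of s]] H0[of s] by (auto intro: mult_right_mono)
  have hi: "integrable lebesgue (\<lambda>s. c (position s) * H s)"
  proof (rule Bochner_Integration.integrable_bound)
    show "integrable lebesgue (\<lambda>s. C * H s)" using H by simp
    show "AE s in lebesgue. norm (c (position s) * H s) \<le> norm (C * H s)"
      using le order_trans[OF le(2) le(1)] by (auto simp: abs_of_nonneg simp del: abs_mult)
  qed (use cm H in auto)
  have "set_integrable lebesgue ?S (\<lambda>s. c (position s) * H s)"
    using integrable_mult_indicator[OF _ hi, of ?S] by (simp add: set_integrable_def)
  hence hS: "?h absolutely_integrable_on ?S"
    by (rule set_integrable_cong[THEN iffD1, rotated -1]) (use h in auto)
  have cv: "?f absolutely_integrable_on {0..1} \<and> integral {0..1} ?f = integral ?S ?h"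
    using has_absolute_integral_change_of_variables_1'[of ?S position "\<lambda>s. c (position s)" ?f "integral ?S ?h"]
      position_derivative inj_on_position hS by (auto simp: position_image)
  have f1: "set_integrable lebesgue {0<..<1} ?f"
    by (rule set_integrable_subset[OF conjunct1[OF cv]]) (simp, force)
  thus "integrable (lebesgue_on {0<..<1}) ?f"
    by (simp add: set_integrable_def integrable_restrict_space)
  have "(LINT x|lebesgue_on {0<..<1}. ?f x) = (LINT x|lebesgue. indicator {0<..<1} x * ?f x)"
    by (simp add: integral_restrict_space)
  also have "\<dots> \<le> (LINT x|lebesgue. indicator {0..1} x * ?f x)"
  proof (rule integral_mono)
    show "integrable lebesgue (\<lambda>x. indicator {0<..<1} x * ?f x)"
      using f1 by (simp add: set_integrable_def)
    show "integrable lebesgue (\<lambda>x. indicator {0..1} x * ?f x)"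
      using conjunct1[OF cv] by (simp add: set_integrable_def)
  qed (simp add: H0 indicator_def)
  also have "\<dots> = integral {0..1} ?f"
    using set_lebesgue_integral_eq_integral(2)[of "{0..1}" ?f] cv by (simp add: set_lebesgue_integral_def)
  also have "\<dots> = (LINT s|lebesgue. indicator ?S s * ?h s)"
    using set_lebesgue_integral_eq_integral(2)[OF hS] cv by (simp add: set_lebesgue_integral_def)
  also have "\<dots> = (LINT s|lebesgue. indicator ?S s * (c (position s) * H s))"
    using h by (intro Bochner_Integration.integral_cong) (auto split: split_indicator)
  also have "\<dots> \<le> (LINT s|lebesgue. C * H s)"
  proof (rule integral_mono)
    show "integrable lebesgue (\<lambda>s. indicator ?S s * (c (position s) * H s))"
      using integrable_mult_indicator[OF _ hi, of ?S] by simp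
    show "indicator ?S s * (c (position s) * H s) \<le> C * H s" for s
      using le[of s] by (auto split: split_indicator)
  qed (use H in simp)
  finally show "(LINT x|lebesgue_on {0<..<1}. H (travel x)) \<le> C * (LINT s|lebesgue. H s)" by simp
qed

text \<open>
  Differentiable maps preserve null sets, and this applies to the travel time as well as
  to its inverse.
\<close>
lemma AE_travel_iff:
  "(AE x in lebesgue. x \<in> {0<..<1} \<longrightarrow> P (travel x)) \<longleftrightarrow> (AE s in lebesgue. s \<in> {0<..<duration} \<longrightarrow> P s)"
proof -
  have AE_neg: "(AE x in lebesgue. Q x) \<longleftrightarrow> negligible {x. \<not> Q x}" for Q :: "real \<Rightarrow> bool"
    by (simp add: negligible_iff_null_sets completion.AE_iff_null_sets)
  have dp: "position differentiable_on {0..duration}"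
    using position_derivative unfolding differentiable_on_def real_differentiable_def by blast
  have dt: "travel differentiable_on {0..1}"
    using travel_derivative unfolding differentiable_on_def real_differentiable_def by blast
  have pos: "position s \<in> {0<..<1}" if "s \<in> {0<..<duration}" for s
  proof -
    have "position s \<noteq> 0" "position s \<noteq> 1" using travel_position[of s] that by (auto simp: duration_def)
    thus ?thesis using position_bounds[of s] by auto
  qed
  let ?X = "{x. \<not> (x \<in> {0<..<1} \<longrightarrow> P (travel x))}" and ?Y = "{s. \<not> (s \<in> {0<..<duration} \<longrightarrow> P s)}"
  have XY: "?X = position ` ?Y"
  proof (intro equalityI subsetI)
    fix x assume "x \<in> ?X"
    thus "x \<in> position ` ?Y" using travel_open_bounds[of x] by (intro image_eqI[of _ _ "travel x"]) auto
  next
    fix x assume "x \<in> position ` ?Y"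
    thus "x \<in> ?X" using pos by (auto simp: travel_position)
  qed
  have YX: "?Y = travel ` ?X"
  proof (intro equalityI subsetI)
    fix s assume "s \<in> ?Y"
    thus "s \<in> travel ` ?X" using pos[of s] by (intro image_eqI[of _ _ "position s"]) (auto simp: travel_position)
  next
    fix x assume "x \<in> travel ` ?X"
    thus "x \<in> ?Y" using travel_open_bounds by auto
  qed
  have "negligible (position ` ?Y)" if "negligible ?Y"
    by (rule negligible_differentiable_image_negligible[OF order_refl that differentiable_on_subset[OF dp]]) auto
  moreover have "negligible (travel ` ?X)" if "negligible ?X"
    by (rule negligible_differentiable_image_negligible[OF order_refl that differentiable_on_subset[OF dt]]) auto
  ultimately show ?thesis unfolding AE_neg using XY YX by metis
qed

end

section \<open>Differentiation of a convolution equation\<close>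

lemma measurable_fst_lebesgue [measurable]: "fst \<in> borel_measurable ((lebesgue :: real measure) \<Otimes>\<^sub>M (lebesgue :: real measure))"
  using measurable_comp[OF measurable_fst, of "\<lambda>x. x" "lebesgue :: real measure" borel "lebesgue :: real measure"]
  by (simp add: o_def measurable_completion)

lemma measurable_snd_lebesgue [measurable]: "snd \<in> borel_measurable ((lebesgue :: real measure) \<Otimes>\<^sub>M (lebesgue :: real measure))"
  using measurable_comp[OF measurable_snd, of "\<lambda>x. x" "lebesgue :: real measure" borel "lebesgue :: real measure"]
  by (simp add: o_def measurable_completion)

text \<open>
  The fundamental theorem of calculus in the form needed for the inner integral in
  \<open>conv_primitive\<close>.
\<close>
lemma integral_derivative_lebesgue:
  fixes f f' :: "real \<Rightarrow> real"
  assumes f': "continuous_on {0..a} f'" "0 \<le> a"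
    and d: "\<And>s. s \<in> {0..a} \<Longrightarrow> (f has_real_derivative f' s) (at s within {0..a})"
  shows "(LINT s|lebesgue. indicator {0<..<a} s * f' s) = f a - f 0"
proof -
  have ai: "f' absolutely_integrable_on {0..a}"
    using f' by (intro absolutely_integrable_continuous_real)
  hence i: "integrable lebesgue (\<lambda>s. indicator {0..a} s * f' s)" by (simp add: set_integrable_def)
  have "AE s in (lebesgue :: real measure). s \<notin> {0, a}"
    by (intro AE_not_in) (simp add: negligible_iff_null_sets[symmetric])
  hence ae: "AE s in lebesgue. indicator {0..a} s * f' s = indicator {0<..<a} s * f' s"
    by eventually_elim (auto split: split_indicator)
  have i2: "integrable lebesgue (\<lambda>s. indicator {0<..<a} s * f' s)"
    using set_integrable_subset[OF ai, of "{0<..<a}"] by (simp add: set_integrable_def subset_iff)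
  have "(LINT s|lebesgue. indicator {0<..<a} s * f' s) = (LINT s|lebesgue. indicator {0..a} s * f' s)"
    using ae i i2 by (intro integral_cong_AE) auto
  also have "\<dots> = integral {0..a} f'"
    using set_lebesgue_integral_eq_integral(2)[OF ai] by (simp add: set_lebesgue_integral_def)
  also have "\<dots> = f a - f 0"
    using assms by (intro integral_unique fundamental_theorem_of_calculus)
      (auto simp: has_real_derivative_iff_has_vector_derivative[symmetric])
  finally show ?thesis .
qed

lemma integrable_conv_integrand:
  fixes g v :: "real \<Rightarrow> real"
  assumes g: "continuous_on UNIV g" "\<And>x. \<bar>g x\<bar> \<le> B" and v: "integrable lebesgue v"
  shows "integrable lebesgue (\<lambda>\<sigma>. indicator {0<..<\<theta>} \<sigma> * (g (\<theta> - \<sigma>) * v \<sigma>))"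
proof -
  have "continuous_on UNIV (\<lambda>s. g (- s))"
    by (intro continuous_on_compose2[OF g(1)] continuous_intros) auto
  from integrable_duhamel[OF this _ v, of B 0 \<theta> "-\<theta>"] g(2) show ?thesis by simp
qed

text \<open>
  Write \<open>f (\<theta> - \<sigma>)\<close> as \<open>f 0\<close> plus the integral of \<open>f' (s - \<sigma>)\<close> over \<open>\<sigma> < s < \<theta>\<close>, and
  interchange the integrals over the triangle \<open>0 < \<sigma> < s < \<theta>\<close>.
\<close>
lemma conv_primitive:
  fixes f f' v :: "real \<Rightarrow> real"
  assumes f: "continuous_on UNIV f" "\<And>x. \<bar>f x\<bar> \<le> B"
    and f': "continuous_on UNIV f'" "\<And>x. \<bar>f' x\<bar> \<le> B'"
    and d: "\<And>s. s \<in> {0..L} \<Longrightarrow> (f has_real_derivative f' s) (at s within {0..L})"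
    and v: "integrable lebesgue v" and \<theta>: "0 \<le> \<theta>" "\<theta> \<le> L"
  shows "integrable lebesgue (\<lambda>s. indicator {0<..<\<theta>} s * (f 0 * v s + convolution f' v s))"
    and "convolution f v \<theta> = (LINT s|lebesgue. indicator {0<..<\<theta>} s * (f 0 * v s + convolution f' v s))"
proof -
  let ?K = "\<lambda>s \<sigma>. if 0 < \<sigma> \<and> \<sigma> < s \<and> s < \<theta> then f' (s - \<sigma>) * v \<sigma> else 0"
  have [measurable]: "f' \<in> borel_measurable borel" by (rule borel_measurable_continuous_onI[OF f'(1)])
  have [measurable]: "v \<in> borel_measurable lebesgue" using v by simp
  have vs[measurable]: "(\<lambda>z. v (snd z)) \<in> borel_measurable ((lebesgue :: real measure) \<Otimes>\<^sub>M (lebesgue :: real measure))"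
    by measurable
  have B': "0 \<le> B'" using order_trans[OF abs_ge_zero f'(2)] .
  have Ki: "integrable (lebesgue \<Otimes>\<^sub>M lebesgue) (case_prod ?K)"
  proof (rule Bochner_Integration.integrable_bound)
    let ?h = "\<lambda>(s, \<sigma>). B' * (indicator {0<..<\<theta>} s * \<bar>v \<sigma>\<bar>)"
    show "integrable (lebesgue \<Otimes>\<^sub>M lebesgue) ?h"
    proof (rule lebesgue_pair.Fubini_integrable)
      show "?h \<in> borel_measurable (lebesgue \<Otimes>\<^sub>M lebesgue)" by measurable
      have "(LINT \<sigma>|lebesgue. norm (?h (s, \<sigma>))) = B' * (indicator {0<..<\<theta>} s * (LINT \<sigma>|lebesgue. \<bar>v \<sigma>\<bar>))" for s
        using B' by (simp add: abs_mult)
      moreover have "integrable lebesgue (\<lambda>s. B' * (indicator {0<..<\<theta>} s * (LINT \<sigma>|lebesgue. \<bar>v \<sigma>\<bar>)))"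
        by (intro Bochner_Integration.integrable_mult_right Bochner_Integration.integrable_mult_left integrable_real_indicator)
           (use \<theta> in auto)
      ultimately show "integrable lebesgue (\<lambda>s. LINT \<sigma>|lebesgue. norm (?h (s, \<sigma>)))" by simp
      show "AE s in lebesgue. integrable lebesgue (\<lambda>\<sigma>. ?h (s, \<sigma>))"
        using v by auto
    qed
    show "case_prod ?K \<in> borel_measurable (lebesgue \<Otimes>\<^sub>M lebesgue)" by measurable
    have "\<bar>?K s \<sigma>\<bar> \<le> B' * (indicator {0<..<\<theta>} s * \<bar>v \<sigma>\<bar>)" for s \<sigma>
      using mult_right_mono[OF f'(2)[of "s - \<sigma>"], of "\<bar>v \<sigma>\<bar>"] B' by (auto simp: abs_mult indicator_def)
    thus "AE z in lebesgue \<Otimes>\<^sub>M lebesgue. norm (case_prod ?K z) \<le> norm (?h z)"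
      using B' by (intro AE_I2) (auto simp: abs_mult)
  qed
  have inner1: "(LINT \<sigma>|lebesgue. ?K s \<sigma>) = indicator {0<..<\<theta>} s * convolution f' v s" for s
  proof (cases "0 < s \<and> s < \<theta>")
    case True
    thus ?thesis unfolding convolution_def
      by (auto intro!: Bochner_Integration.integral_cong simp: indicator_def)
  next
    case False
    hence "?K s = (\<lambda>\<sigma>. 0)" by auto
    thus ?thesis using False by (simp only: indicator_def) auto
  qed
  have inner2: "(LINT s|lebesgue. ?K s \<sigma>) = indicator {0<..<\<theta>} \<sigma> * (f (\<theta> - \<sigma>) * v \<sigma>) - indicator {0<..<\<theta>} \<sigma> * (f 0 * v \<sigma>)" for \<sigma>
  proof (cases "0 < \<sigma> \<and> \<sigma> < \<theta>")
    case True
    have "(LINT s|lebesgue. ?K s \<sigma>) = (LINT s|lebesgue. indicator {\<sigma><..<\<theta>} s * f' (s - \<sigma>)) * v \<sigma>"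
      unfolding integral_mult_left_zero[symmetric] using True
      by (intro Bochner_Integration.integral_cong refl) (simp add: indicator_def)
    also have "(LINT s|lebesgue. indicator {\<sigma><..<\<theta>} s * f' (s - \<sigma>)) = (LINT s|lebesgue. indicator {0<..<\<theta> - \<sigma>} s * f' s)"
      by (subst lebesgue_integral_real_affine[of 1 _ \<sigma>]) (auto intro!: Bochner_Integration.integral_cong simp: indicator_def)
    also have "\<dots> = f (\<theta> - \<sigma>) - f 0"
      using True \<theta> by (intro integral_derivative_lebesgue continuous_on_subset[OF f'(1)] DERIV_subset[OF d]) auto
    finally show ?thesis using True by (simp add: algebra_simps)
  next
    case False
    hence "(\<lambda>s. ?K s \<sigma>) = (\<lambda>s. 0)" by auto
    hence "(LINT s|lebesgue. ?K s \<sigma>) = 0" by (simp only: integral_zero)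
    thus ?thesis using False by (auto simp: indicator_def)
  qed
  have iv: "integrable lebesgue (\<lambda>s. indicator {0<..<\<theta>} s * (f 0 * v s))"
    using integrable_mult_indicator[of "{0<..<\<theta>}" lebesgue "\<lambda>s. f 0 * v s"] v by simp
  have ic: "integrable lebesgue (\<lambda>s. indicator {0<..<\<theta>} s * convolution f' v s)"
    using lebesgue_pair.integrable_fst[OF Ki] by (simp only: inner1)
  show "integrable lebesgue (\<lambda>s. indicator {0<..<\<theta>} s * (f 0 * v s + convolution f' v s))"
    using Bochner_Integration.integrable_add[OF iv ic] by (simp add: distrib_left)
  have "(LINT s|lebesgue. indicator {0<..<\<theta>} s * (f 0 * v s + convolution f' v s))
      = (LINT s|lebesgue. indicator {0<..<\<theta>} s * (f 0 * v s)) + (LINT s|lebesgue. indicator {0<..<\<theta>} s * convolution f' v s)"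
    using iv ic by (simp add: distrib_left)
  also have "(LINT s|lebesgue. indicator {0<..<\<theta>} s * convolution f' v s) = (LINT s|lebesgue. LINT \<sigma>|lebesgue. ?K s \<sigma>)"
    by (simp only: inner1)
  also have "\<dots> = (LINT \<sigma>|lebesgue. LINT s|lebesgue. ?K s \<sigma>)"
    using lebesgue_pair.integral_fst[OF Ki] lebesgue_pair.integral_snd[OF Ki] by simp
  also have "\<dots> = convolution f v \<theta> - (LINT s|lebesgue. indicator {0<..<\<theta>} s * (f 0 * v s))"
    unfolding inner2 convolution_def using integrable_conv_integrand[OF f v] iv by (rule Bochner_Integration.integral_diff)
  finally show "convolution f v \<theta> = (LINT s|lebesgue. indicator {0<..<\<theta>} s * (f 0 * v s + convolution f' v s))" by simp
qed

text \<open>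
  The primitive is continuous, so if it vanishes almost everywhere it vanishes on the
  closed interval. The integral over a ray is a difference of two of its values.
\<close>
lemma AE_zero_iff_primitive_zero:
  fixes E :: "real \<Rightarrow> real"
  assumes L: "0 < L" and Z: "integrable lebesgue (\<lambda>s. indicator {0<..<L} s * E s)"
  shows "(AE s in lebesgue. s \<in> {0<..<L} \<longrightarrow> E s = 0) \<longleftrightarrow>
    (AE \<theta> in lebesgue. \<theta> \<in> {0<..<L} \<longrightarrow> (LINT s|lebesgue. indicator {0<..<\<theta>} s * E s) = 0)"
proof
  assume E: "AE s in lebesgue. s \<in> {0<..<L} \<longrightarrow> E s = 0"
  have "(LINT s|lebesgue. indicator {0<..<\<theta>} s * E s) = 0" if "\<theta> \<in> {0<..<L}" for \<theta>
  proof (rule integral_eq_zero_AE)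
    show "AE s in lebesgue. indicator {0<..<\<theta>} s * E s = 0"
      using E by eventually_elim (use that in \<open>auto simp: indicator_def\<close>)
  qed
  thus "AE \<theta> in lebesgue. \<theta> \<in> {0<..<L} \<longrightarrow> (LINT s|lebesgue. indicator {0<..<\<theta>} s * E s) = 0" by auto
next
  assume P: "AE \<theta> in lebesgue. \<theta> \<in> {0<..<L} \<longrightarrow> (LINT s|lebesgue. indicator {0<..<\<theta>} s * E s) = 0"
  let ?Z = "\<lambda>s. indicator {0<..<L} s * E s"
  let ?P = "\<lambda>\<theta>. LINT s|lebesgue. indicator {0<..<\<theta>} s * ?Z s"
  have PE: "?P \<theta> = (LINT s|lebesgue. indicator {0<..<\<theta>} s * E s)" if "\<theta> \<le> L" for \<theta>
    using that by (intro Bochner_Integration.integral_cong) (auto simp: indicator_def)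
  \<comment> \<open>The primitive is the Duhamel integral with constant kernel at \<open>t = \<theta>\<close>.\<close>
  have "continuous_on UNIV (\<lambda>\<theta>. case (\<theta>, \<theta>) of (t, \<theta>) \<Rightarrow> duhamel (\<lambda>_. 1) ?Z t \<theta>)"
    by (rule continuous_on_compose2[OF continuous_duhamel[where B=1]]) (use Z in \<open>auto intro!: continuous_intros\<close>)
  hence cont: "continuous_on UNIV ?P" by (simp add: duhamel_def)
  have cl: "closed {\<theta>. ?P \<theta> = 0}"
    using continuous_closed_vimage[OF closed_singleton[of 0], of ?P] cont
    by (simp add: vimage_def continuous_on_eq_continuous_at)
  have sub: "{0<..<L} \<subseteq> {\<theta>. ?P \<theta> = 0}"
  proof
    fix \<theta> assume \<theta>: "\<theta> \<in> {0<..<L}"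
    have "AE \<theta> in lebesgue. \<theta> \<in> {0<..<L} \<longrightarrow> \<theta> \<in> {\<theta>. ?P \<theta> = 0}"
      using P by eventually_elim (use PE in auto)
    from mem_closed_if_AE_lebesgue_open[OF _ cl this \<theta>] show "\<theta> \<in> {\<theta>. ?P \<theta> = 0}" by simp
  qed
  have "closure {0<..<L} \<subseteq> {\<theta>. ?P \<theta> = 0}" using sub cl by (rule closure_minimal)
  hence P0: "?P \<theta> = 0" if "\<theta> \<in> {0..L}" for \<theta> using that L by auto
  have PL: "?P L = (LINT s|lebesgue. ?Z s)"
    by (intro Bochner_Integration.integral_cong) (auto simp: indicator_def)
  have "AE s in lebesgue. ?Z s = 0"
  proof (rule integral_rays_zero_imp_AE_zero[OF Z])
    fix a :: real
    \<comment> \<open>The function is supported in \<open>{0<..<L}\<close>, so the ray may be started at a point \<open>b\<close> of \<open>{0..L}\<close>.\<close>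
    define b where "b = max 0 (min a L)"
    have b: "b \<in> {0..L}" using L by (auto simp: b_def)
    have iz: "integrable lebesgue (\<lambda>s. indicator A s * ?Z s)" if "A \<in> sets lebesgue" for A
      using integrable_mult_indicator[OF that Z] by simp
    have ae: "AE s in (lebesgue :: real measure). s \<noteq> b"
      using AE_not_in[of "{b}" lebesgue] by (simp add: negligible_iff_null_sets[symmetric])
    have "(LINT s|lebesgue. indicator {a<..} s * ?Z s) = (LINT s|lebesgue. ?Z s - indicator {0<..<b} s * ?Z s)"
    proof (rule integral_cong_AE)
      show "AE s in lebesgue. indicator {a<..} s * ?Z s = ?Z s - indicator {0<..<b} s * ?Z s"
        using ae by eventually_elim (auto simp: indicator_def b_def max_def min_def split: if_splits)
      show "(\<lambda>s. indicator {a<..} s * ?Z s) \<in> borel_measurable lebesgue"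
        by (rule borel_measurable_integrable[OF iz]) simp
      show "(\<lambda>s. ?Z s - indicator {0<..<b} s * ?Z s) \<in> borel_measurable lebesgue"
        by (intro borel_measurable_diff borel_measurable_integrable[OF Z] borel_measurable_integrable[OF iz]) simp
    qed
    also have "\<dots> = (LINT s|lebesgue. ?Z s) - ?P b"
      by (rule Bochner_Integration.integral_diff[OF Z iz]) simp
    also have "\<dots> = 0" using P0[OF b] P0[of L] PL L by simp
    finally show "(LINT s|lebesgue. indicator {a<..} s * ?Z s) = 0" .
  qed
  thus "AE s in lebesgue. s \<in> {0<..<L} \<longrightarrow> E s = 0" by eventually_elim auto
qed

text \<open>
  Differentiation of a Volterra equation of the first kind: by \<open>conv_primitive\<close> the first
  equation says that the primitive of the second one is zero.
\<close>
lemma conv_zero_iff_derivative: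
  fixes f f' v :: "nat \<Rightarrow> real \<Rightarrow> real"
  assumes f: "\<And>h. h \<in> H \<Longrightarrow> continuous_on UNIV (f h)" "\<And>h x. h \<in> H \<Longrightarrow> \<bar>f h x\<bar> \<le> B h"
    and f': "\<And>h. h \<in> H \<Longrightarrow> continuous_on UNIV (f' h)" "\<And>h x. h \<in> H \<Longrightarrow> \<bar>f' h x\<bar> \<le> B' h"
    and d: "\<And>h s. h \<in> H \<Longrightarrow> s \<in> {0..L} \<Longrightarrow> (f h has_real_derivative f' h s) (at s within {0..L})"
    and v: "\<And>h. h \<in> H \<Longrightarrow> integrable lebesgue (v h)" and L: "0 < L"
  shows "(AE \<theta> in lebesgue. \<theta> \<in> {0<..<L} \<longrightarrow> (\<Sum>h\<in>H. convolution (f h) (v h) \<theta>) = 0) \<longleftrightarrow>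
    (AE \<theta> in lebesgue. \<theta> \<in> {0<..<L} \<longrightarrow> (\<Sum>h\<in>H. f h 0 * v h \<theta> + convolution (f' h) (v h) \<theta>) = 0)"
proof -
  let ?E = "\<lambda>s. \<Sum>h\<in>H. f h 0 * v h s + convolution (f' h) (v h) s"
  have i: "integrable lebesgue (\<lambda>s. indicator {0<..<\<theta>} s * (f h 0 * v h s + convolution (f' h) (v h) s))"
    if "h \<in> H" "\<theta> \<in> {0..L}" for h \<theta>
    using that by (intro conv_primitive(1)[OF f(1) f(2) f'(1) f'(2) d v]) auto
  have *: "(\<Sum>h\<in>H. convolution (f h) (v h) \<theta>) = (LINT s|lebesgue. indicator {0<..<\<theta>} s * ?E s)" if \<theta>: "\<theta> \<in> {0<..<L}" for \<theta>
  proof -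
    have "(\<Sum>h\<in>H. convolution (f h) (v h) \<theta>) = (\<Sum>h\<in>H. LINT s|lebesgue. indicator {0<..<\<theta>} s * (f h 0 * v h s + convolution (f' h) (v h) s))"
      using \<theta> by (intro sum.cong refl conv_primitive(2)[OF f(1) f(2) f'(1) f'(2) d v]) auto
    also have "\<dots> = (LINT s|lebesgue. (\<Sum>h\<in>H. indicator {0<..<\<theta>} s * (f h 0 * v h s + convolution (f' h) (v h) s)))"
      using i \<theta> by (intro Bochner_Integration.integral_sum[symmetric]) auto
    finally show ?thesis by (simp add: sum_distrib_left)
  qed
  have "integrable lebesgue (\<lambda>s. indicator {0<..<L} s * ?E s)"
    unfolding sum_distrib_left using i L by (intro Bochner_Integration.integrable_sum) auto
  from AE_zero_iff_primitive_zero[OF L this] * show ?thesis by simp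
qed

section \<open>Transport in square integrable functions\<close>

context positive_speed
begin

text \<open>
  Since \<open>integrable_travel\<close> concerns nonnegative functions, the signed function is
  written as a difference of two of them to see that the composition is measurable.
\<close>
lemma L2_on_transport:
  assumes F: "L2_on UNIV F" "\<And>s. \<bar>s\<bar> > R \<Longrightarrow> F s = 0"
  shows "L2_on {0<..<1} (\<lambda>x. F (t - travel x))"
proof -
  obtain C where C: "\<And>x. x \<in> {0..1} \<Longrightarrow> c x \<le> C" using speed_bounded by blast
  have Ft: "L2_on UNIV (\<lambda>s. F (t - s))" using L2_on_translate(1)[OF F(1), of "-1" t] by simp
  have "L2_on {t-R..t+R} (\<lambda>s. F (t - s))" by (rule L2_on_subset[OF Ft]) auto
  hence "integrable (lebesgue_on {t-R..t+R}) (\<lambda>s. F (t - s))" by (rule L2_on_imp_integrable) auto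
  hence "integrable lebesgue (\<lambda>s. indicator {t-R..t+R} s * F (t - s))" by (simp add: integrable_restrict_space)
  also have "(\<lambda>s. indicator {t-R..t+R} s * F (t - s)) = (\<lambda>s. F (t - s))"
  proof
    fix s show "indicator {t-R..t+R} s * F (t - s) = F (t - s)"
      using F(2)[of "t - s"] by (cases "\<bar>t - s\<bar> > R") (auto simp: indicator_def abs_le_iff)
  qed
  finally have Fi: "integrable lebesgue (\<lambda>s. F (t - s))" .
  \<comment> \<open>Both \<open>\<bar>F\<bar> + F\<close> and \<open>\<bar>F\<bar>\<close> are nonnegative.\<close>
  have "integrable (lebesgue_on {0<..<1}) (\<lambda>x. \<bar>F (t - travel x)\<bar> + F (t - travel x))"
    using Fi by (intro integrable_travel(1)[OF _ _ C, of "\<lambda>s. \<bar>F (t - s)\<bar> + F (t - s)"] Bochner_Integration.integrable_add integrable_abs) auto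
  moreover have "integrable (lebesgue_on {0<..<1}) (\<lambda>x. \<bar>F (t - travel x)\<bar>)"
    using Fi by (intro integrable_travel(1)[OF _ _ C, of "\<lambda>s. \<bar>F (t - s)\<bar>"] integrable_abs) auto
  ultimately have "(\<lambda>x. (\<bar>F (t - travel x)\<bar> + F (t - travel x)) - \<bar>F (t - travel x)\<bar>) \<in> borel_measurable (lebesgue_on {0<..<1})"
    by (intro borel_measurable_diff borel_measurable_integrable)
  moreover have "integrable (lebesgue_on {0<..<1}) (\<lambda>x. (F (t - travel x))\<^sup>2)"
    using Ft by (intro integrable_travel(1)[OF _ _ C, of "\<lambda>s. (F (t - s))\<^sup>2"]) (auto simp: L2_on_def lebesgue_on_UNIV_eq)
  ultimately show ?thesis by (simp add: L2_on_def)
qed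

text \<open>
  Up to the bounded Jacobian of the travel time, moving in time translates \<open>F\<close>.
\<close>
lemma continuous_into_L2_transport_time:
  assumes F: "L2_on UNIV F" "\<And>s. \<bar>s\<bar> > R \<Longrightarrow> F s = 0"
  shows "continuous_into_L2 A {0<..<1} (\<lambda>t x. F (t - travel x))"
  unfolding continuous_into_L2_def
proof (intro conjI ballI L2_on_transport[OF F])
  fix a assume "a \<in> A"
  obtain C where C: "\<And>x. x \<in> {0..1} \<Longrightarrow> c x \<le> C" using speed_bounded by blast
  let ?I = "\<lambda>b. LINT s|lebesgue. (F (s + (b - a)) - F s)\<^sup>2"
  show "((\<lambda>b. \<integral>x. (F (b - travel x) - F (a - travel x))\<^sup>2 \<partial>lebesgue_on {0<..<1}) \<longlongrightarrow> 0) (at a within A)"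
  proof (rule tendsto_sandwich[OF _ _ tendsto_const])
    have "((\<lambda>b. b - a) \<longlongrightarrow> a - a) (at a within A)" by (intro tendsto_intros)
    hence "(?I \<longlongrightarrow> 0) (at a within A)" by (intro L2_shift_tendsto[OF F]) simp_all
    thus "((\<lambda>b. C * ?I b) \<longlongrightarrow> 0) (at a within A)" by (rule tendsto_mult_right_zero)
    have "(\<integral>x. (F (b - travel x) - F (a - travel x))\<^sup>2 \<partial>lebesgue_on {0<..<1}) \<le> C * ?I b" for b
    proof -
      have L: "L2_on UNIV (\<lambda>s. F (b - s))" "L2_on UNIV (\<lambda>s. F (a - s))"
        using L2_on_translate(1)[OF F(1), of "-1"] by simp_all
      have "(\<integral>x. (F (b - travel x) - F (a - travel x))\<^sup>2 \<partial>lebesgue_on {0<..<1}) \<le> C * (LINT s|lebesgue. (F (b - s) - F (a - s))\<^sup>2)"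
        using L2_on_diff_integrable[OF L] by (intro integrable_travel(2)[OF _ _ C]) (auto simp: lebesgue_on_UNIV_eq)
      also have "(LINT s|lebesgue. (F (b - s) - F (a - s))\<^sup>2) = ?I b"
        by (subst lebesgue_integral_real_affine[of "-1" _ a]) (simp_all add: algebra_simps)
      finally show ?thesis .
    qed
    thus "\<forall>\<^sub>F b in at a within A. (\<integral>x. (F (b - travel x) - F (a - travel x))\<^sup>2 \<partial>lebesgue_on {0<..<1}) \<le> C * ?I b" by simp
  qed simp
qed

text \<open>
  Moving in space also translates \<open>F\<close>, by a difference of travel times.
\<close>
lemma continuous_into_L2_transport_space:
  assumes F: "L2_on UNIV F" "\<And>s. \<bar>s\<bar> > R \<Longrightarrow> F s = 0" and S: "S \<in> sets lebesgue"
  shows "continuous_into_L2 {0..1} S (\<lambda>x t. F (t - travel x))"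
  unfolding continuous_into_L2_def
proof (intro conjI ballI)
  have L: "L2_on UNIV (\<lambda>t. F (t - travel x))" for x
    using L2_on_translate(1)[OF F(1), of 1 "- travel x"] by simp
  show "L2_on S (\<lambda>t. F (t - travel x))" for x using S by (intro L2_on_subset[OF L]) auto
  fix a :: real assume a: "a \<in> {0..1}"
  let ?I = "\<lambda>b. LINT s|lebesgue. (F (s + (travel a - travel b)) - F s)\<^sup>2"
  show "((\<lambda>b. \<integral>t. (F (t - travel b) - F (t - travel a))\<^sup>2 \<partial>lebesgue_on S) \<longlongrightarrow> 0) (at a within {0..1})"
  proof (rule tendsto_sandwich[OF _ _ tendsto_const])
    have "((\<lambda>b. travel a - travel b) \<longlongrightarrow> travel a - travel a) (at a within {0..1})"
      using continuous_on_travel a by (intro tendsto_intros) (auto simp: continuous_on_def)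
    thus "(?I \<longlongrightarrow> 0) (at a within {0..1})" by (intro L2_shift_tendsto[OF F]) simp_all
    have "(\<integral>t. (F (t - travel b) - F (t - travel a))\<^sup>2 \<partial>lebesgue_on S) \<le> ?I b" for b
    proof -
      have i: "integrable lebesgue (\<lambda>t. (F (t - travel b) - F (t - travel a))\<^sup>2)"
        using L2_on_diff_integrable[OF L L] by (simp add: lebesgue_on_UNIV_eq)
      have "(\<integral>t. (F (t - travel b) - F (t - travel a))\<^sup>2 \<partial>lebesgue_on S)
          = (LINT t|lebesgue. indicator S t * (F (t - travel b) - F (t - travel a))\<^sup>2)"
        using S by (simp add: integral_restrict_space)
      also have "\<dots> \<le> (LINT t|lebesgue. (F (t - travel b) - F (t - travel a))\<^sup>2)"
        using integrable_mult_indicator[OF S i] by (intro integral_mono i) (auto simp: indicator_def)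
      also have "\<dots> = ?I b"
        by (subst lebesgue_integral_real_affine[of 1 _ "travel a"]) (simp_all add: algebra_simps)
      finally show ?thesis .
    qed
    thus "\<forall>\<^sub>F b in at a within {0..1}. (\<integral>t. (F (t - travel b) - F (t - travel a))\<^sup>2 \<partial>lebesgue_on S) \<le> ?I b" by simp
  qed simp
qed

end

section \<open>Iterated derivatives on the unit interval\<close>

lemma D01_eqI:
  assumes "(f has_real_derivative d) (at x within {0..1})" "x \<in> {0..1}"
  shows "D01 f x = d"
  unfolding D01_def using assms
  by (intro vector_derivative_within_closed_interval) (auto simp: has_real_derivative_iff_has_vector_derivative)

lemma has_real_derivative_transform01:
  assumes "\<And>x. x \<in> {0..1} \<Longrightarrow> f x = g x" "x \<in> {0..1}" "(f has_real_derivative d) (at x within {0..1})"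
  shows "(g has_real_derivative d) (at x within {0..1})"
  by (rule has_field_derivative_transform_within[OF assms(3) zero_less_one assms(2)]) (use assms(1) in auto)

lemma D01_cong:
  assumes "\<And>x. x \<in> {0..1} \<Longrightarrow> f x = g x" "x \<in> {0..1}"
  shows "D01 f x = D01 g x"
  unfolding D01_def vector_derivative_def
proof (rule arg_cong[where f = Eps], rule ext)
  fix d
  have "(f has_real_derivative d) (at x within {0..1}) \<longleftrightarrow> (g has_real_derivative d) (at x within {0..1})"
    using has_real_derivative_transform01[of f g] has_real_derivative_transform01[of g f] assms by metis
  thus "(f has_vector_derivative d) (at x within {0..1}) = (g has_vector_derivative d) (at x within {0..1})"
    by (simp only: has_real_derivative_iff_has_vector_derivative)
qed

lemma D01_funpow_cong:
  assumes "\<And>x. x \<in> {0..1} \<Longrightarrow> f x = g x" "x \<in> {0..1}"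
  shows "(D01 ^^ n) f x = (D01 ^^ n) g x"
  using assms(2)
proof (induction n arbitrary: x)
  case (Suc n)
  have "D01 ((D01 ^^ n) f) x = D01 ((D01 ^^ n) g) x" by (rule D01_cong) (use Suc in auto)
  thus ?case by simp
qed (simp add: assms(1))

lemma C_k_on_cong:
  assumes "C_k_on n f {0..1}" "\<And>x. x \<in> {0..1} \<Longrightarrow> f x = g x"
  shows "C_k_on n g {0..1}"
proof (cases n)
  case 0
  thus ?thesis using assms continuous_on_cong[of "{0..1}" "{0..1}" f g] by simp
next
  case (Suc j)
  then obtain f' where f': "\<forall>x\<in>{0..1}. (f has_real_derivative f' x) (at x within {0..1})" "C_k_on j f' {0..1}"
    using assms by auto
  hence "\<forall>x\<in>{0..1}. (g has_real_derivative f' x) (at x within {0..1})"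
    using has_real_derivative_transform01[of f g] assms(2) by blast
  thus ?thesis using f' Suc by auto
qed

text \<open>
  Derivatives relative to the interval are unique, so the derivative in the definition of
  differentiability classes may be taken to be \<open>D01 f\<close>.
\<close>
lemma C_k_on_Suc:
  "C_k_on (Suc n) f {0..1} \<longleftrightarrow>
    (\<forall>x\<in>{0..1}. (f has_real_derivative D01 f x) (at x within {0..1})) \<and> C_k_on n (D01 f) {0..1}" (is "_ \<longleftrightarrow> ?R")
proof
  assume "C_k_on (Suc n) f {0..1}"
  then obtain f' where f': "\<forall>x\<in>{0..1}. (f has_real_derivative f' x) (at x within {0..1})" "C_k_on n f' {0..1}" by auto
  have e: "f' x = D01 f x" if "x \<in> {0..1}" for x using f'(1) that by (intro D01_eqI[symmetric]) auto
  thus ?R using f' C_k_on_cong[OF f'(2) e] by auto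
qed auto

lemma C_k_on_Suc_derivative:
  assumes "C_k_on (Suc n) f {0..1}" "x \<in> {0..1}"
  shows "(f has_real_derivative D01 f x) (at x within {0..1})"
  using assms by (simp only: C_k_on_Suc)

lemma C_k_on_Suc_D01: "C_k_on (Suc n) f {0..1} \<Longrightarrow> C_k_on n (D01 f) {0..1}"
  by (simp only: C_k_on_Suc)

lemma C_k_on_imp_continuous: "C_k_on n f S \<Longrightarrow> continuous_on S f"
  by (cases n) (auto intro: DERIV_continuous_on)

lemma C_k_on_Suc_imp: "C_k_on (Suc n) f S \<Longrightarrow> C_k_on n f S"
proof (induction n arbitrary: f)
  case 0
  thus ?case using C_k_on_imp_continuous[of "Suc 0" f S] by simp
next
  case (Suc n)
  then obtain f' where "\<forall>x\<in>S. (f has_real_derivative f' x) (at x within S)" "C_k_on (Suc n) f' S"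
    using C_k_on.simps(2)[of "Suc n" f S] by blast
  thus ?case using Suc.IH[of f'] by auto
qed

lemma C_k_on_mono: "C_k_on n f S \<Longrightarrow> j \<le> n \<Longrightarrow> C_k_on j f S"
  by (induction n) (auto simp: le_Suc_eq dest: C_k_on_Suc_imp simp del: C_k_on.simps(2))

lemma C_k_on_add: "C_k_on n f S \<Longrightarrow> C_k_on n g S \<Longrightarrow> C_k_on n (\<lambda>x. f x + g x) S"
proof (induction n arbitrary: f g)
  case (Suc n)
  then obtain f' g' where f': "\<forall>x\<in>S. (f has_real_derivative f' x) (at x within S)" "C_k_on n f' S"
    and g': "\<forall>x\<in>S. (g has_real_derivative g' x) (at x within S)" "C_k_on n g' S" by auto
  have "\<forall>x\<in>S. ((\<lambda>x. f x + g x) has_real_derivative f' x + g' x) (at x within S)"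
    using f' g' by (auto intro!: derivative_eq_intros)
  thus ?case using Suc.IH[OF f'(2) g'(2)] by auto
qed (auto intro: continuous_intros)

lemma C_k_on_mult: "C_k_on n f S \<Longrightarrow> C_k_on n g S \<Longrightarrow> C_k_on n (\<lambda>x. f x * g x) S"
proof (induction n arbitrary: f g)
  case (Suc n)
  then obtain f' g' where f': "\<forall>x\<in>S. (f has_real_derivative f' x) (at x within S)" "C_k_on n f' S"
    and g': "\<forall>x\<in>S. (g has_real_derivative g' x) (at x within S)" "C_k_on n g' S" by auto
  have "\<forall>x\<in>S. ((\<lambda>x. f x * g x) has_real_derivative f' x * g x + f x * g' x) (at x within S)"
    using f' g' by (auto intro!: derivative_eq_intros simp: mult.commute)
  moreover have "C_k_on n (\<lambda>x. f' x * g x + f x * g' x) S"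
    using f' g' Suc.prems C_k_on_Suc_imp by (intro C_k_on_add Suc.IH) blast+
  ultimately show ?case by auto
qed (auto intro: continuous_intros)

lemma C_k_on_weighted_D:
  "C_k_on n c {0..1} \<Longrightarrow> C_k_on (Suc n) f {0..1} \<Longrightarrow> C_k_on n (weighted_D c f) {0..1}"
  unfolding weighted_D_def[abs_def] by (intro C_k_on_mult C_k_on_Suc_D01)

lemma C_k_on_weighted_D_funpow:
  assumes "C_k_on n c {0..1}" "C_k_on (Suc n) f {0..1}"
  shows "j \<le> Suc n \<Longrightarrow> C_k_on (Suc n - j) ((weighted_D c ^^ j) f) {0..1}"
proof (induction j)
  case (Suc j)
  have "C_k_on (Suc (n - j)) ((weighted_D c ^^ j) f) {0..1}" using Suc by (simp add: Suc_diff_le del: C_k_on.simps)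
  hence "C_k_on (n - j) (weighted_D c ((weighted_D c ^^ j) f)) {0..1}"
    by (intro C_k_on_weighted_D C_k_on_mono[OF assms(1)]) auto
  thus ?case by simp
qed (use assms in \<open>simp del: C_k_on.simps\<close>)

section \<open>The leading derivative at the inflow point\<close>

lemma D01_add:
  assumes "C_k_on (Suc n) f {0..1}" "C_k_on (Suc n) g {0..1}" "x \<in> {0..1}"
  shows "D01 (\<lambda>x. f x + g x) x = D01 f x + D01 g x"
  using C_k_on_Suc_derivative[OF assms(1,3)] C_k_on_Suc_derivative[OF assms(2,3)] assms(3)
  by (intro D01_eqI) (auto intro!: derivative_eq_intros)

lemma D01_mult:
  assumes "C_k_on (Suc n) f {0..1}" "C_k_on (Suc n) g {0..1}" "x \<in> {0..1}"
  shows "D01 (\<lambda>x. f x * g x) x = D01 f x * g x + f x * D01 g x"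
  using C_k_on_Suc_derivative[OF assms(1,3)] C_k_on_Suc_derivative[OF assms(2,3)] assms(3)
  by (intro D01_eqI) (auto intro!: derivative_eq_intros)

lemma D01_funpow_add:
  assumes "C_k_on n f {0..1}" "C_k_on n g {0..1}" "x \<in> {0..1}"
  shows "(D01 ^^ n) (\<lambda>x. f x + g x) x = (D01 ^^ n) f x + (D01 ^^ n) g x"
  using assms
proof (induction n arbitrary: f g)
  case (Suc n)
  have "(D01 ^^ n) (D01 (\<lambda>x. f x + g x)) x = (D01 ^^ n) (\<lambda>x. D01 f x + D01 g x) x"
    by (rule D01_funpow_cong[OF D01_add]) (use Suc.prems in blast)+
  also have "\<dots> = (D01 ^^ n) (D01 f) x + (D01 ^^ n) (D01 g) x"
    using Suc.prems by (intro Suc.IH C_k_on_Suc_D01)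
  finally show ?case by (simp add: funpow_swap1)
qed simp

text \<open>
  All other terms of the Leibniz rule contain a derivative of \<open>g\<close> at \<open>0\<close> of order less
  than \<open>n\<close>. The induction peels off the innermost derivative.
\<close>
lemma D01_funpow_mult_at_zero:
  assumes "C_k_on n c {0..1}" "C_k_on n g {0..1}" "\<And>i. i < n \<Longrightarrow> (D01 ^^ i) g 0 = 0" "i \<le> n"
  shows "(D01 ^^ i) (\<lambda>x. c x * g x) 0 = c 0 * (D01 ^^ i) g 0"
  using assms
proof (induction n arbitrary: c g i)
  case (Suc n)
  show ?case
  proof (cases i)
    case (Suc j)
    hence j: "j \<le> n" using \<open>i \<le> Suc n\<close> by simp
    note C = Suc.prems(1,2)
    have C': "C_k_on n (D01 c) {0..1}" "C_k_on n (D01 g) {0..1}" "C_k_on n c {0..1}" "C_k_on n g {0..1}"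
      using C by (blast intro: C_k_on_Suc_D01 C_k_on_Suc_imp)+
    have g0: "(D01 ^^ j) g 0 = 0" using Suc.prems(3)[of j] j by simp
    have g'0: "(D01 ^^ k) (D01 g) 0 = 0" if "k < n" for k
      using Suc.prems(3)[of "Suc k"] that by (simp add: funpow_swap1)
    have "(D01 ^^ i) (\<lambda>x. c x * g x) 0 = (D01 ^^ j) (D01 (\<lambda>x. c x * g x)) 0" by (simp add: Suc funpow_swap1)
    also have "\<dots> = (D01 ^^ j) (\<lambda>x. D01 c x * g x + c x * D01 g x) 0"
      by (rule D01_funpow_cong[OF D01_mult[OF C]]) auto
    also have "\<dots> = (D01 ^^ j) (\<lambda>x. D01 c x * g x) 0 + (D01 ^^ j) (\<lambda>x. c x * D01 g x) 0"
      by (intro D01_funpow_add C_k_on_mult C_k_on_mono[OF _ j] C') auto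
    also have "(D01 ^^ j) (\<lambda>x. D01 c x * g x) 0 = D01 c 0 * (D01 ^^ j) g 0"
      by (rule Suc.IH[OF C'(1,4) _ j]) (use Suc.prems(3) in auto)
    also have "(D01 ^^ j) (\<lambda>x. c x * D01 g x) 0 = c 0 * (D01 ^^ j) (D01 g) 0"
      by (rule Suc.IH[OF C'(3,2) g'0 j])
    finally show ?thesis using g0 by (simp add: Suc funpow_swap1)
  qed simp
qed simp

text \<open>
  Each application of \<open>weighted_D c\<close> lowers the order of vanishing at \<open>0\<close> by one and
  contributes one factor \<open>c 0\<close> to the leading derivative.
\<close>
lemma weighted_D_funpow_at_zero:
  assumes "C_k_on n c {0..1}" "C_k_on n f {0..1}" "\<And>i. i < n \<Longrightarrow> (D01 ^^ i) f 0 = 0" "i \<le> n"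
  shows "(weighted_D c ^^ i) f 0 = c 0 ^ i * (D01 ^^ i) f 0"
  using assms
proof (induction n arbitrary: f i)
  case (Suc n)
  show ?case
  proof (cases i)
    case (Suc j)
    hence j: "j \<le> n" using \<open>i \<le> Suc n\<close> by simp
    note C = Suc.prems(1,2)
    have C': "C_k_on n c {0..1}" "C_k_on n (D01 f) {0..1}" "C_k_on n (weighted_D c f) {0..1}"
      using C by (blast intro: C_k_on_Suc_D01 C_k_on_Suc_imp C_k_on_weighted_D)+
    have f'0: "(D01 ^^ k) (D01 f) 0 = 0" if "k < n" for k
      using Suc.prems(3)[of "Suc k"] that by (simp add: funpow_swap1)
    have L: "(D01 ^^ k) (weighted_D c f) 0 = c 0 * (D01 ^^ k) (D01 f) 0" if "k \<le> n" for k
      unfolding weighted_D_def[abs_def] by (rule D01_funpow_mult_at_zero[OF C'(1,2) f'0 that])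
    have "(weighted_D c ^^ i) f 0 = (weighted_D c ^^ j) (weighted_D c f) 0" by (simp add: Suc funpow_swap1)
    also have "\<dots> = c 0 ^ j * (D01 ^^ j) (weighted_D c f) 0"
      by (rule Suc.IH[OF C'(1,3) _ j]) (simp add: L f'0)
    also have "\<dots> = c 0 ^ i * (D01 ^^ i) f 0" by (simp add: L[OF j] Suc funpow_swap1)
    finally show ?thesis .
  qed simp
qed simp

section \<open>Broad solutions in travel time coordinates\<close>

text \<open>
  The trace is extended by zero outside the time interval. Then the source term of a
  characteristic that starts at time \<open>0\<close> inside the domain is given by the same integral
  as that of one that enters through the boundary.
\<close>
definition boundary_trace :: "real \<Rightarrow> (nat \<Rightarrow> real \<Rightarrow> real \<Rightarrow> real) \<Rightarrow> nat \<Rightarrow> real \<Rightarrow> real" where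
  "boundary_trace T y h \<tau> = indicator {0<..<T} \<tau> * y h \<tau> 0"

lemma AE_lebesgue_on_prod:
  assumes "AE z in lebesgue_on ({0<..<T::real} \<times> {0<..<1::real}). P z"
  shows "AE z in lebesgue. z \<in> {0<..<T} \<times> {0<..<1} \<longrightarrow> P z"
proof -
  have "open ({0<..<T} \<times> {0<..<1::real})" by (intro open_Times) auto
  hence "{0<..<T} \<times> {0<..<1::real} \<in> sets lebesgue" by simp
  thus ?thesis using assms by (simp add: AE_restrict_space_iff)
qed

context positive_speed
begin

definition row_source :: "nat \<Rightarrow> (nat \<Rightarrow> real \<Rightarrow> real) \<Rightarrow> (nat \<Rightarrow> real \<Rightarrow> real) \<Rightarrow> real \<Rightarrow> real \<Rightarrow> real" where
  "row_source m g W t \<theta> = (\<Sum>h=1..m. duhamel (\<lambda>\<sigma>. g h (position \<sigma>)) (W h) t \<theta>)"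

lemma continuous_on_compose_position:
  assumes "continuous_on {0..1} f"
  shows "continuous_on UNIV (\<lambda>\<sigma>. f (position \<sigma>))"
  by (rule continuous_on_compose2[OF assms continuous_on_position]) (use position_bounds in auto)

lemma bounded_compose_position:
  fixes f :: "real \<Rightarrow> real"
  assumes "continuous_on {0..1} f"
  obtains B where "\<And>\<sigma>. \<bar>f (position \<sigma>)\<bar> \<le> B"
proof -
  have "bounded (f ` {0..1})"
    by (intro compact_imp_bounded compact_continuous_image assms) simp
  then obtain B where B: "\<forall>y\<in>f ` {0..1}. norm y \<le> B" unfolding bounded_iff by blast
  have "\<bar>f (position \<sigma>)\<bar> \<le> B" for \<sigma>
    using bspec[OF B imageI[OF position_bounds[of \<sigma>]]] by simp
  thus ?thesis by (rule that)
qed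

lemma continuous_row_source:
  assumes g: "\<And>h. h \<in> {1..m} \<Longrightarrow> continuous_on {0..1} (g h)"
    and W: "\<And>h. h \<in> {1..m} \<Longrightarrow> integrable lebesgue (W h)"
  shows "continuous_on UNIV (\<lambda>(t, \<theta>). row_source m g W t \<theta>)"
proof -
  have "continuous_on UNIV (\<lambda>(t, \<theta>). duhamel (\<lambda>\<sigma>. g h (position \<sigma>)) (W h) t \<theta>)" if h: "h \<in> {1..m}" for h
  proof -
    obtain B where "\<And>\<sigma>. \<bar>g h (position \<sigma>)\<bar> \<le> B" using bounded_compose_position[OF g[OF h]] by blast
    thus ?thesis by (intro continuous_duhamel continuous_on_compose_position g W h)
  qed
  hence "continuous_on UNIV (\<lambda>z. \<Sum>h=1..m. (\<lambda>(t, \<theta>). duhamel (\<lambda>\<sigma>. g h (position \<sigma>)) (W h) t \<theta>) z)"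
    by (intro continuous_on_sum) auto
  thus ?thesis by (simp add: row_source_def case_prod_beta)
qed

lemma characteristic_entry_time:
  assumes ch: "characteristic c a t x \<gamma>" and a: "0 \<le> a" "a = 0 \<or> \<gamma> a = 0"
  shows "a = max 0 (t - travel x)"
proof -
  have at: "a \<le> t" and \<gamma>a: "\<gamma> a \<in> {0..1}" using ch by (auto simp: characteristic_def)
  have tr: "travel (\<gamma> a) = travel x - t + a" using characteristic_explicit(1)[OF ch, of a] at by simp
  show ?thesis
  proof (cases "a = 0")
    case True thus ?thesis using tr travel_bounds[OF \<gamma>a] by simp
  next
    case False
    hence "travel (\<gamma> a) = 0" using a by simp
    thus ?thesis using tr a by simp
  qed
qed

text \<open>
  By \<open>characteristic_entry_time\<close> the interval of integration is the Duhamel interval,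
  intersected with the positive times, and the trace is zero at all other times.
\<close>
lemma source_along_characteristic:
  assumes ch: "characteristic c a t x \<gamma>" and a: "0 \<le> a" "a = 0 \<or> \<gamma> a = 0" and t: "t < T"
    and g: "\<And>h. h \<in> {1..m} \<Longrightarrow> continuous_on {0..1} (g h)"
    and W: "\<And>h. h \<in> {1..m} \<Longrightarrow> integrable lebesgue (boundary_trace T y h)"
  shows "(LINT \<tau>|lebesgue_on {a..t}. (\<Sum>h=1..m. g h (\<gamma> \<tau>) * y h \<tau> 0))
      = row_source m g (boundary_trace T y) t (travel x)"
proof -
  note am = characteristic_entry_time[OF ch a]
  let ?W = "boundary_trace T y" and ?\<theta> = "travel x"
  let ?f = "\<lambda>h \<tau>. indicator {t - ?\<theta><..<t} \<tau> * (g h (position (?\<theta> - t + \<tau>)) * ?W h \<tau>)"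
  have i: "integrable lebesgue (?f h)" if h: "h \<in> {1..m}" for h
  proof -
    obtain B where "\<And>\<sigma>. \<bar>g h (position \<sigma>)\<bar> \<le> B" using bounded_compose_position[OF g[OF h]] by blast
    from integrable_duhamel[OF continuous_on_compose_position[OF g[OF h]] this W[OF h], of "t - ?\<theta>" t "?\<theta> - t"]
    show ?thesis by simp
  qed
  have null: "AE \<tau> in (lebesgue :: real measure). \<tau> \<notin> {a, t}"
    by (intro AE_not_in) (simp add: negligible_iff_null_sets[symmetric])
  have ae: "AE \<tau> in lebesgue. indicator {a..t} \<tau> * (\<Sum>h=1..m. g h (\<gamma> \<tau>) * y h \<tau> 0) = (\<Sum>h=1..m. ?f h \<tau>)"
    using null
  proof eventually_elim
    case (elim \<tau>)
    show ?case
    proof (cases "a < \<tau> \<and> \<tau> < t")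
      case True
      hence "\<gamma> \<tau> = position (?\<theta> - t + \<tau>)" using characteristic_explicit(2)[OF ch, of \<tau>] by simp
      moreover have "\<tau> \<in> {t - ?\<theta><..<t}" "\<tau> \<in> {a..t}" using True am by auto
      moreover have "?W h \<tau> = y h \<tau> 0" for h using True a t by (simp add: boundary_trace_def)
      ultimately show ?thesis by simp
    next
      case False
      hence "\<tau> \<notin> {a..t}" using elim by auto
      moreover have "?f h \<tau> = 0" for h
        using False am elim by (auto simp: boundary_trace_def indicator_def max_def split: if_splits)
      hence "(\<Sum>h=1..m. ?f h \<tau>) = 0" by (intro sum.neutral ballI)
      moreover have "indicator {a..t} \<tau> = (0 :: real)" using \<open>\<tau> \<notin> {a..t}\<close> by simp
      ultimately show ?thesis by (simp only: mult_zero_left)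
    qed
  qed
  have fi: "integrable lebesgue (\<lambda>\<tau>. \<Sum>h=1..m. ?f h \<tau>)" using i by (intro Bochner_Integration.integrable_sum) auto
  have "(LINT \<tau>|lebesgue_on {a..t}. (\<Sum>h=1..m. g h (\<gamma> \<tau>) * y h \<tau> 0))
      = (LINT \<tau>|lebesgue. indicator {a..t} \<tau> * (\<Sum>h=1..m. g h (\<gamma> \<tau>) * y h \<tau> 0))"
    by (simp add: integral_restrict_space)
  also have "\<dots> = (LINT \<tau>|lebesgue. (\<Sum>h=1..m. ?f h \<tau>))"
  proof (rule integral_cong_AE[OF _ borel_measurable_integrable[OF fi] ae])
    have "AE \<tau> in lebesgue. (\<Sum>h=1..m. ?f h \<tau>) = indicator {a..t} \<tau> * (\<Sum>h=1..m. g h (\<gamma> \<tau>) * y h \<tau> 0)"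
      using ae by eventually_elim simp
    from borel_measurable_AE[OF borel_measurable_integrable[OF fi] this]
    show "(\<lambda>\<tau>. indicator {a..t} \<tau> * (\<Sum>h=1..m. g h (\<gamma> \<tau>) * y h \<tau> 0)) \<in> borel_measurable lebesgue" .
  qed
  also have "\<dots> = (\<Sum>h=1..m. LINT \<tau>|lebesgue. ?f h \<tau>)"
    using i by (intro Bochner_Integration.integral_sum) auto
  finally show "(LINT \<tau>|lebesgue_on {a..t}. (\<Sum>h=1..m. g h (\<gamma> \<tau>) * y h \<tau> 0)) = row_source m g ?W t ?\<theta>"
    by (simp add: row_source_def duhamel_def)
qed

lemma continuous_into_L2_compose_travel:
  assumes K: "continuous_on UNIV (\<lambda>(t, \<theta>). K t \<theta> :: real)"
  shows "continuous_into_L2 {0..T} {0<..<1} (\<lambda>t x. K t (travel x))"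
    and "continuous_into_L2 {0..1} {0<..<T} (\<lambda>x t. K t (travel x))"
proof -
  have "continuous_on ({0..T} \<times> {0..1}) (\<lambda>z. (\<lambda>(t, \<theta>). K t \<theta>) (fst z, travel (snd z)))"
    by (rule continuous_on_compose2[OF K])
       (auto intro!: continuous_intros continuous_on_compose2[OF continuous_on_travel])
  thus "continuous_into_L2 {0..T} {0<..<1} (\<lambda>t x. K t (travel x))"
    by (intro continuous_into_L2_continuous[where c=0 and d=1]) (auto simp: case_prod_beta)
  have "continuous_on ({0..1} \<times> {0..T}) (\<lambda>z. (\<lambda>(t, \<theta>). K t \<theta>) (snd z, travel (fst z)))"
    by (rule continuous_on_compose2[OF K])
       (auto intro!: continuous_intros continuous_on_compose2[OF continuous_on_travel])
  thus "continuous_into_L2 {0..1} {0<..<T} (\<lambda>x t. K t (travel x))"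
    by (intro continuous_into_L2_continuous[where c=0 and d=T]) (auto simp: case_prod_beta)
qed

text \<open>
  The difference between \<open>Y\<close> and its representation depends continuously on time in the
  mean, so that the representation survives at the final time.
\<close>
lemma null_final_state_equation:
  assumes Y: "continuous_into_L2 {0..T} {0<..<1} Y" and Y0: "AE x in lebesgue_on {0<..<1}. Y T x = 0"
    and F: "L2_on UNIV F" "\<And>s. \<bar>s\<bar> > R \<Longrightarrow> F s = 0"
    and K: "continuous_on UNIV (\<lambda>(t, \<theta>). K t \<theta> :: real)"
    and B: "open B" "B \<subseteq> {0<..<1}" and t0: "0 \<le> t0" "t0 < T"
    and rep: "AE z in lebesgue. fst z \<in> {t0<..<T} \<and> snd z \<in> B \<longrightarrow>
      Y (fst z) (snd z) = F (fst z - travel (snd z)) + K (fst z) (travel (snd z))"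
  shows "AE x in lebesgue. x \<in> B \<longrightarrow> F (T - travel x) + K T (travel x) = 0"
proof -
  let ?d = "\<lambda>t x. Y t x - (F (t - travel x) + K t (travel x))"
  have B': "B \<in> sets lebesgue" using B(1) by simp
  have "AE x in lebesgue. x \<in> B \<longrightarrow> ?d T x = 0"
  proof (rule continuous_into_L2_AE_zero_endpoint[OF _ _ B' B(2) t0])
    show "continuous_into_L2 {0..T} {0<..<1} ?d"
      by (intro continuous_into_L2_diff[OF Y] continuous_into_L2_add continuous_into_L2_transport_time[OF F]
          continuous_into_L2_compose_travel(1)[OF K])
    from AE_lebesgue_prod_slices[where P="\<lambda>t x. t \<in> {t0<..<T} \<and> x \<in> B \<longrightarrow> Y t x = F (t - travel x) + K t (travel x)", OF rep]
    show "AE t in lebesgue. t0 < t \<and> t < T \<longrightarrow> (AE x in lebesgue. x \<in> B \<longrightarrow> ?d t x = 0)"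
      by eventually_elim auto
  qed simp
  moreover have "AE x in lebesgue. x \<in> {0<..<1} \<longrightarrow> Y T x = 0" using Y0 by (simp add: AE_restrict_space_iff)
  ultimately show ?thesis by eventually_elim (use B(2) in auto)
qed

lemma open_travel_preimage:
  assumes "open U"
  shows "open {x \<in> {0<..<1}. travel x \<in> U}"
proof -
  have "open ({0<..<1} \<inter> travel -` U)"
    by (intro continuous_open_preimage continuous_on_subset[OF continuous_on_travel] assms) auto
  thus ?thesis by (simp add: vimage_def Int_def)
qed

text \<open>
  At time \<open>T\<close> the points with travel time less than \<open>T\<close> have been reached from the inflow
  boundary, and the initial datum \<open>I\<close> has disappeared there.
\<close>
lemma transport_final_equation:
  assumes T: "0 < T"
    and Y: "continuous_into_L2 {0..T} {0<..<1} Y" and Y0: "AE x in lebesgue_on {0<..<1}. Y T x = 0"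
    and F: "L2_on UNIV F" "\<And>s. \<bar>s\<bar> > R \<Longrightarrow> F s = 0"
    and K: "continuous_on UNIV (\<lambda>(t, \<theta>). K t \<theta> :: real)"
    and rep: "AE z in lebesgue. z \<in> {0<..<T} \<times> {0<..<1} \<longrightarrow>
      Y (fst z) (snd z) = (if fst z \<le> travel (snd z) then I (travel (snd z) - fst z) else F (fst z - travel (snd z)))
        + K (fst z) (travel (snd z))"
  shows "AE \<theta> in lebesgue. \<theta> \<in> {0<..<duration} \<longrightarrow> \<theta> < T \<longrightarrow> F (T - \<theta>) + K T \<theta> = 0"
proof -
  \<comment> \<open>The representation without \<open>I\<close> holds at time \<open>t\<close> only where \<open>travel x < t\<close>. It is therefore passed to the limit \<open>t \<rightarrow> T\<close> on the sets \<open>travel x < ?s n\<close>, which exhaust \<open>travel x < T\<close>.\<close>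
  let ?s = "\<lambda>n::nat. T - T / (real n + 2)"
  have "AE x in lebesgue. x \<in> {x\<in>{0<..<1}. travel x \<in> {..<?s n}} \<longrightarrow> F (T - travel x) + K T (travel x) = 0" for n
  proof (rule null_final_state_equation[OF Y Y0 F K])
    show "open {x\<in>{0<..<1}. travel x \<in> {..<?s n}}" by (rule open_travel_preimage) simp
    show "0 \<le> ?s n" "?s n < T" using T by (auto simp: field_simps)
    show "AE z in lebesgue. fst z \<in> {?s n<..<T} \<and> snd z \<in> {x\<in>{0<..<1}. travel x \<in> {..<?s n}} \<longrightarrow>
      Y (fst z) (snd z) = F (fst z - travel (snd z)) + K (fst z) (travel (snd z))"
      using rep
    proof eventually_elim
      case (elim z)
      show ?case
      proof
        assume z: "fst z \<in> {?s n<..<T} \<and> snd z \<in> {x\<in>{0<..<1}. travel x \<in> {..<?s n}}"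
        hence "0 < fst z" using travel_open_bounds[of "snd z"] by auto
        hence "z \<in> {0<..<T} \<times> {0<..<1}" using z by (auto simp: mem_Times_iff)
        thus "Y (fst z) (snd z) = F (fst z - travel (snd z)) + K (fst z) (travel (snd z))"
          using elim z by auto
      qed
    qed
  qed auto
  hence "AE x in lebesgue. \<forall>n. x \<in> {x\<in>{0<..<1}. travel x \<in> {..<?s n}} \<longrightarrow> F (T - travel x) + K T (travel x) = 0"
    unfolding AE_all_countable by blast
  hence "AE x in lebesgue. x \<in> {0<..<1} \<longrightarrow> travel x < T \<longrightarrow> F (T - travel x) + K T (travel x) = 0"
  proof eventually_elim
    case (elim x)
    show ?case
    proof (intro impI)
      assume x: "x \<in> {0<..<1}" "travel x < T"
      obtain n :: nat where n: "T / (T - travel x) < real n" using reals_Archimedean2 by blast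
      hence "T < (T - travel x) * (real n + 2)" using x T by (simp add: field_simps)
      hence "travel x < ?s n" by (simp add: field_simps)
      thus "F (T - travel x) + K T (travel x) = 0" using elim x by blast
    qed
  qed
  thus ?thesis by (subst (asm) AE_travel_iff[where P="\<lambda>\<theta>. \<theta> < T \<longrightarrow> F (T - \<theta>) + K T \<theta> = 0"])
qed

text \<open>
  If \<open>T < duration\<close>, the points with travel time greater than \<open>T\<close> still carry the
  transported initial datum. A step at travel time \<open>\<delta>\<close> has moved to travel time \<open>T + \<delta>\<close>,
  and the continuous term \<open>K\<close> would have to compensate it, hence to be \<open>-1\<close> and \<open>0\<close> there.
\<close>
lemma transport_step_unreachable:
  assumes T: "0 < T" "T < duration"
    and Y: "continuous_into_L2 {0..T} {0<..<1} Y" and Y0: "AE x in lebesgue_on {0<..<1}. Y T x = 0"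
    and K: "continuous_on UNIV (\<lambda>(t, \<theta>). K t \<theta> :: real)"
    and rep: "AE z in lebesgue. z \<in> {0<..<T} \<times> {0<..<1} \<longrightarrow>
      Y (fst z) (snd z) = (if fst z \<le> travel (snd z) then indicator {..<(duration - T) / 2} (travel (snd z) - fst z) else J z)
        + K (fst z) (travel (snd z))"
  shows False
proof -
  define \<delta> where "\<delta> = (duration - T) / 2"
  have \<delta>: "0 < \<delta>" "T + \<delta> < duration" using T by (auto simp: \<delta>_def field_simps)
  let ?F = "indicat_real {-\<delta><..0}"
  let ?B = "{x\<in>{0<..<1}. travel x \<in> {T<..}}"
  have i: "integrable lebesgue ?F"
    using \<delta> by (intro integrable_real_indicator) auto
  have "AE x in lebesgue. x \<in> ?B \<longrightarrow> ?F (T - travel x) + K T (travel x) = 0"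
  proof (rule null_final_state_equation[OF Y Y0 _ _ K])
    \<comment> \<open>\<open>?F (t - \<theta>)\<close> is the step at travel time \<open>\<delta>\<close>, transported for the time \<open>t < \<theta>\<close>.\<close>
    show "L2_on UNIV ?F"
    proof -
      have "(\<lambda>s. (?F s)\<^sup>2) = ?F" by (auto simp: indicator_def)
      thus ?thesis using i by (simp only: L2_on_def lebesgue_on_UNIV_eq borel_measurable_integrable simp_thms)
    qed
    show "?F s = 0" if "\<bar>s\<bar> > \<delta>" for s using that \<delta> by (auto simp: indicator_def)
    show "open ?B" by (rule open_travel_preimage) simp
    show "AE z in lebesgue. fst z \<in> {0<..<T} \<and> snd z \<in> ?B \<longrightarrow>
      Y (fst z) (snd z) = ?F (fst z - travel (snd z)) + K (fst z) (travel (snd z))"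
      using rep
    proof eventually_elim
      case (elim z)
      show ?case
      proof
        assume z: "fst z \<in> {0<..<T} \<and> snd z \<in> ?B"
        hence "z \<in> {0<..<T} \<times> {0<..<1}" by (auto simp: mem_Times_iff)
        thus "Y (fst z) (snd z) = ?F (fst z - travel (snd z)) + K (fst z) (travel (snd z))"
          using elim z by (auto simp: \<delta>_def[symmetric] indicator_def)
      qed
    qed
  qed (use T in auto)
  hence "AE x in lebesgue. x \<in> {0<..<1} \<longrightarrow> travel x > T \<longrightarrow> ?F (T - travel x) + K T (travel x) = 0"
    by eventually_elim auto
  hence ae: "AE \<theta> in lebesgue. \<theta> \<in> {0<..<duration} \<longrightarrow> \<theta> > T \<longrightarrow> ?F (T - \<theta>) + K T \<theta> = 0"
    by (subst (asm) AE_travel_iff[where P="\<lambda>\<theta>. \<theta> > T \<longrightarrow> ?F (T - \<theta>) + K T \<theta> = 0"])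
  have KT: "continuous_on UNIV (K T)"
    using continuous_on_compose2[OF K continuous_on_Pair[OF continuous_on_const[of UNIV T] continuous_on_id]] by auto
  have cl: "closed {\<theta>. K T \<theta> = r}" for r
    using continuous_closed_vimage[OF closed_singleton[of r], of "K T"] KT
    by (simp add: vimage_def continuous_on_eq_continuous_at)
  have clos: "K T (T + \<delta>) = r" if ab: "a < b" "T + \<delta> \<in> {a..b}" and "AE \<theta> in lebesgue. \<theta> \<in> {a<..<b} \<longrightarrow> \<theta> \<in> {\<theta>. K T \<theta> = r}" for a b r
  proof -
    have "{a<..<b} \<subseteq> {\<theta>. K T \<theta> = r}"
      using mem_closed_if_AE_lebesgue_open[OF _ cl that(3)] by auto
    hence "closure {a<..<b} \<subseteq> {\<theta>. K T \<theta> = r}" using cl by (rule closure_minimal)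
    thus ?thesis using ab by auto
  qed
  have "K T (T + \<delta>) = -1"
  proof (rule clos[of T "T + \<delta>"])
    show "AE \<theta> in lebesgue. \<theta> \<in> {T<..<T + \<delta>} \<longrightarrow> \<theta> \<in> {\<theta>. K T \<theta> = -1}"
      using ae by eventually_elim (use T \<delta> in \<open>auto simp: indicator_def\<close>)
  qed (use \<delta> in auto)
  moreover have "K T (T + \<delta>) = 0"
  proof (rule clos[of "T + \<delta>" duration])
    show "AE \<theta> in lebesgue. \<theta> \<in> {T + \<delta><..<duration} \<longrightarrow> \<theta> \<in> {\<theta>. K T \<theta> = 0}"
      using ae by eventually_elim (use T \<delta> in \<open>auto simp: indicator_def\<close>)
  qed (use \<delta> in auto)
  ultimately show False by simp
qed

end

section \<open>Replacing one row\<close>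

text \<open>
  The equation that a vanishing final state of a row with speed \<open>c\<close> imposes on the
  time-reversed trace \<open>v\<close>, on travel times up to \<open>L\<close>.
\<close>
definition row_vanishes ::
  "nat \<Rightarrow> (real \<Rightarrow> real) \<Rightarrow> (nat \<Rightarrow> real) \<Rightarrow> (nat \<Rightarrow> real \<Rightarrow> real) \<Rightarrow> real \<Rightarrow> (nat \<Rightarrow> real \<Rightarrow> real) \<Rightarrow> bool" where
  "row_vanishes m c q g L v \<longleftrightarrow> (AE \<theta> in lebesgue. \<theta> \<in> {0<..<L} \<longrightarrow>
     (\<Sum>h=1..m. q h * v h \<theta> + convolution (\<lambda>\<sigma>. g h (positive_speed.position c \<sigma>)) (v h) \<theta>) = 0)"

lemma boundary_trace_L2:
  assumes "continuous_into_L2 {0..1} {0<..<T} (\<lambda>x t. y h t x)"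
  shows "L2_on UNIV (boundary_trace T y h)" and "integrable lebesgue (boundary_trace T y h)"
proof -
  have L: "L2_on {0<..<T} (\<lambda>t. y h t 0)" using assms by (auto simp: continuous_into_L2_def)
  have e: "boundary_trace T y h = (\<lambda>\<tau>. indicator {0<..<T} \<tau> * y h \<tau> 0)"
    by (simp add: boundary_trace_def fun_eq_iff)
  show "L2_on UNIV (boundary_trace T y h)" unfolding e using L L2_on_UNIV_indicator[of "{0<..<T}"] by auto
  have "integrable (lebesgue_on {0<..<T}) (\<lambda>t. y h t 0)" by (rule L2_on_imp_integrable[OF L]) auto
  thus "integrable lebesgue (boundary_trace T y h)" unfolding e by (simp add: integrable_restrict_space)
qed

lemma boundary_trace_zero: "t \<le> 0 \<Longrightarrow> boundary_trace T y h t = 0" "T \<le> t \<Longrightarrow> boundary_trace T y h t = 0"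
  by (auto simp: boundary_trace_def)

text \<open>
  The right-hand side of the integrated equation depends on the characteristic only
  through \<open>(t,x)\<close>, so that the equations of an old and a new row may be subtracted
  pointwise.
\<close>
lemma (in positive_speed) broad_value:
  assumes ch: "characteristic c a t x \<gamma>" and a: "0 \<le> a" "a = 0 \<or> \<gamma> a = inflow_point m (m + j)"
    and j: "1 \<le> j" and t: "t < T"
    and g: "\<And>h. h \<in> {1..m} \<Longrightarrow> continuous_on {0..1} (G j h)"
    and W: "\<And>h. h \<in> {1..m} \<Longrightarrow> integrable lebesgue (boundary_trace T y h)"
  shows "(if a = 0 then y0 (\<gamma> 0) else inflow_value m Q u y (m + j) a)
      + (LINT \<tau>|lebesgue_on {a..t}. source_term m G y (m + j) \<tau> (\<gamma> \<tau>))
    = (if t \<le> travel x then y0 (position (travel x - t)) else (\<Sum>h=1..m. Q j h * boundary_trace T y h (t - travel x)))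
      + row_source m (G j) (boundary_trace T y) t (travel x)"
proof -
  have "a = 0 \<or> \<gamma> a = 0" using a(2) j by (auto simp: inflow_point_def)
  note am = characteristic_entry_time[OF ch a(1) this] and src = source_along_characteristic[OF ch a(1) this t g W]
  have "source_term m G y (m + j) \<tau> (\<gamma> \<tau>) = (\<Sum>h=1..m. G j h (\<gamma> \<tau>) * y h \<tau> 0)" for \<tau>
    using j by (simp add: source_term_def)
  hence 1: "(LINT \<tau>|lebesgue_on {a..t}. source_term m G y (m + j) \<tau> (\<gamma> \<tau>)) = row_source m (G j) (boundary_trace T y) t (travel x)"
    using src by simp
  have at: "a \<le> t" using ch by (simp add: characteristic_def)
  show ?thesis
  proof (cases "a = 0")
    case True
    hence "t \<le> travel x" using am by simp
    moreover have "\<gamma> 0 = position (travel x - t)"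
      using characteristic_explicit(2)[OF ch, of 0] True at by simp
    ultimately show ?thesis using True 1 by simp
  next
    case False
    hence a': "a = t - travel x" "0 < a" "\<not> t \<le> travel x" using am by (auto simp: max_def split: if_splits)
    hence "boundary_trace T y h a = y h a 0" for h using at t by (simp add: boundary_trace_def)
    hence "inflow_value m Q u y (m + j) a = (\<Sum>h=1..m. Q j h * boundary_trace T y h (t - travel x))"
      using j a' by (simp add: inflow_value_def)
    thus ?thesis using a' 1 by simp
  qed
qed

lemma broad_solution_characteristics:
  assumes "broad_solution m p lam Q G T y0 u y" "i \<in> {1..m+p}"
  shows "AE z in lebesgue. z \<in> {0<..<T} \<times> {0<..<1} \<longrightarrow>
    (\<exists>a \<gamma>. 0 \<le> a \<and> characteristic (lam i) a (fst z) (snd z) \<gamma> \<and> (a = 0 \<or> \<gamma> a = inflow_point m i) \<and>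
      y i (fst z) (snd z) = (if a = 0 then y0 i (\<gamma> 0) else inflow_value m Q u y i a)
        + (LINT \<tau>|lebesgue_on {a..fst z}. source_term m G y i \<tau> (\<gamma> \<tau>)))"
  using assms by (intro AE_lebesgue_on_prod) (auto simp: broad_solution_def case_prod_beta)

lemma broad_solution_continuous:
  assumes "broad_solution m p lam Q G T y0 u y" "i \<in> {1..m+p}"
  shows "continuous_into_L2 {0..T} {0<..<1} (\<lambda>t x. y i t x)"
    and "continuous_into_L2 {0..1} {0<..<T} (\<lambda>x t. y i t x)"
  using assms by (auto simp: broad_solution_def)

lemma broad_solution_row:
  assumes bs: "broad_solution m p lam Q G T y0 u y" and j: "j \<in> {1..p}"
    and ps: "positive_speed (lam (m + j))"
    and G: "\<forall>h\<in>{1..m}. continuous_on {0..1} (G j h)"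
  shows "AE z in lebesgue. z \<in> {0<..<T} \<times> {0<..<1} \<longrightarrow>
    y (m + j) (fst z) (snd z) =
      (if fst z \<le> positive_speed.travel (lam (m + j)) (snd z)
       then y0 (m + j) (positive_speed.position (lam (m + j)) (positive_speed.travel (lam (m + j)) (snd z) - fst z))
       else (\<Sum>h=1..m. Q j h * boundary_trace T y h (fst z - positive_speed.travel (lam (m + j)) (snd z))))
      + positive_speed.row_source (lam (m + j)) m (G j) (boundary_trace T y) (fst z) (positive_speed.travel (lam (m + j)) (snd z))"
proof -
  interpret positive_speed "lam (m + j)" by (rule ps)
  have W: "integrable lebesgue (boundary_trace T y h)" if "h \<in> {1..m}" for h
    using broad_solution_continuous(2)[OF bs, of h] that by (intro boundary_trace_L2(2)) auto
  have i: "m + j \<in> {1..m+p}" using j by auto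
  from broad_solution_characteristics[OF bs i] show ?thesis
  proof eventually_elim
    case (elim z)
    show ?case
    proof
      assume z: "z \<in> {0<..<T} \<times> {0<..<1}"
      then obtain a \<gamma> where *: "0 \<le> a" "characteristic (lam (m + j)) a (fst z) (snd z) \<gamma>"
        "a = 0 \<or> \<gamma> a = inflow_point m (m + j)"
        "y (m + j) (fst z) (snd z) = (if a = 0 then y0 (m + j) (\<gamma> 0) else inflow_value m Q u y (m + j) a)
        + (LINT \<tau>|lebesgue_on {a..fst z}. source_term m G y (m + j) \<tau> (\<gamma> \<tau>))"
        using elim by blast
      show "y (m + j) (fst z) (snd z) =
        (if fst z \<le> travel (snd z) then y0 (m + j) (position (travel (snd z) - fst z))
         else (\<Sum>h=1..m. Q j h * boundary_trace T y h (fst z - travel (snd z))))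
        + row_source m (G j) (boundary_trace T y) (fst z) (travel (snd z))"
        unfolding *(4) using z j G by (intro broad_value[OF *(2,1,3)] W) (auto simp: mem_Times_iff)
    qed
  qed
qed

lemma null_controllable_imp_duration_le:
  assumes nc: "null_controllable m p lam Q G T" and T: "0 < T" and k: "k \<in> {1..p}"
    and ps: "positive_speed (lam (m + k))"
    and G: "\<And>h. h \<in> {1..m} \<Longrightarrow> continuous_on {0..1} (G k h)"
  shows "positive_speed.duration (lam (m + k)) \<le> T"
proof (rule ccontr)
  interpret positive_speed "lam (m + k)" by (rule ps)
  assume "\<not> duration \<le> T"
  hence Td: "T < duration" by simp
  define \<delta> where "\<delta> = (duration - T) / 2"
  have \<delta>: "0 < \<delta>" using Td by (simp add: \<delta>_def)
  let ?F = "indicat_real {-\<delta><..0}"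
  \<comment> \<open>A step at travel time \<open>\<delta>\<close>, written so that it is visibly a transported function.\<close>
  define y0 where "y0 = (\<lambda>i x. if i = m + k then ?F (0 - travel x) else 0)"
  have "(\<lambda>s. (?F s)\<^sup>2) = ?F" by (auto simp: indicator_def)
  moreover have "integrable lebesgue ?F" using \<delta> by (intro integrable_real_indicator) auto
  ultimately have F2: "L2_on UNIV ?F"
    by (simp only: L2_on_def lebesgue_on_UNIV_eq borel_measurable_integrable simp_thms)
  have "L2_on {0<..<1} (\<lambda>x. ?F (0 - travel x))"
    by (rule L2_on_transport[OF F2, of \<delta>]) (use \<delta> in \<open>auto simp: indicator_def\<close>)
  moreover have "y0 i = (if i = m + k then (\<lambda>x. ?F (0 - travel x)) else (\<lambda>x. 0))" for i
    by (simp add: y0_def fun_eq_iff)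
  ultimately have "\<forall>i\<in>{1..m+p}. L2_on {0<..<1} (y0 i)" by (simp add: L2_on_def)
  then obtain u y where bs: "broad_solution m p lam Q G T y0 u y"
    and fin: "\<forall>i\<in>{1..m+p}. AE x in lebesgue_on {0<..<1}. y i T x = 0"
    using nc unfolding null_controllable_def by blast
  have i: "m + k \<in> {1..m+p}" using k by auto
  have W: "integrable lebesgue (boundary_trace T y h)" if "h \<in> {1..m}" for h
    using broad_solution_continuous(2)[OF bs, of h] that by (intro boundary_trace_L2(2)) auto
  let ?J = "\<lambda>z. \<Sum>h=1..m. Q k h * boundary_trace T y h (fst z - travel (snd z))"
  have Gk: "\<forall>h\<in>{1..m}. continuous_on {0..1} (G k h)" using G by blast
  show False
  proof (rule transport_step_unreachable[OF T Td broad_solution_continuous(1)[OF bs i] bspec[OF fin i] continuous_row_source])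
    show "AE z in lebesgue. z \<in> {0<..<T} \<times> {0<..<1} \<longrightarrow>
      y (m + k) (fst z) (snd z) = (if fst z \<le> travel (snd z) then indicator {..<(duration - T) / 2} (travel (snd z) - fst z) else ?J z)
        + row_source m (G k) (boundary_trace T y) (fst z) (travel (snd z))"
      using broad_solution_row[OF bs k ps Gk]
    proof eventually_elim
      case (elim z)
      show ?case
      proof
        assume z: "z \<in> {0<..<T} \<times> {0<..<1}"
        have "y0 (m + k) (position (travel (snd z) - fst z)) = indicator {..<\<delta>} (travel (snd z) - fst z)"
          if "fst z \<le> travel (snd z)"
        proof -
          have "travel (snd z) - fst z \<in> {0..duration}"
            using that z travel_bounds[of "snd z"] by (auto simp: mem_Times_iff)
          hence "travel (position (travel (snd z) - fst z)) = travel (snd z) - fst z" by (rule travel_position)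
          thus ?thesis using that by (auto simp: y0_def indicator_def)
        qed
        thus "y (m + k) (fst z) (snd z) = (if fst z \<le> travel (snd z) then indicator {..<(duration - T) / 2} (travel (snd z) - fst z) else ?J z)
          + row_source m (G k) (boundary_trace T y) (fst z) (travel (snd z))"
          using elim z by (simp add: \<delta>_def)
      qed
    qed
  qed (use G W in auto)
qed

text \<open>
  The control and all components but the one of row \<open>k\<close> are kept. To this component the
  function \<open>D\<close> is added, the difference of the right-hand sides of the two integrated
  equations. It contains no initial datum, and its final state is the difference of the
  two row equations, both of which hold.
\<close>
lemma null_controllable_replace_row:
  assumes nc: "null_controllable m p lam Q G T" and T: "0 < T" and k: "k \<in> {1..p}"
    and ps: "\<And>j. j \<in> {1..k} \<Longrightarrow> positive_speed (lam (m + j))"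
    and dur: "\<And>j. j \<in> {1..k} \<Longrightarrow> positive_speed.duration (lam (m + k)) \<le> positive_speed.duration (lam (m + j))"
    and G: "\<And>j h. j \<in> {1..k} \<Longrightarrow> h \<in> {1..m} \<Longrightarrow> continuous_on {0..1} (G j h)"
    and g: "\<And>h. h \<in> {1..m} \<Longrightarrow> continuous_on {0..1} (g h)"
    and imp: "\<And>v. (\<And>h. h \<in> {1..m} \<Longrightarrow> integrable lebesgue (v h)) \<Longrightarrow>
      (\<And>j. j \<in> {1..k} \<Longrightarrow> row_vanishes m (lam (m + j)) (Q j) (G j) (positive_speed.duration (lam (m + k))) v) \<Longrightarrow>
      row_vanishes m (lam (m + k)) q g (positive_speed.duration (lam (m + k))) v"
  shows "null_controllable m p lam (Q(k := q)) (G(k := g)) T"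
  unfolding null_controllable_def
proof (intro allI impI)
  fix y0 assume y0: "\<forall>i\<in>{1..m+p}. L2_on {0<..<1} (y0 i)"
  have kk: "k \<in> {1..k}" using k by simp
  interpret positive_speed "lam (m + k)" by (rule ps[OF kk])
  have dT: "duration \<le> T" by (rule null_controllable_imp_duration_le[OF nc T k ps[OF kk] G[OF kk]])
  obtain u y where u: "\<forall>i\<in>{1..m}. L2_on {0<..<T} (u i)" and bs: "broad_solution m p lam Q G T y0 u y"
    and fin: "\<forall>i\<in>{1..m+p}. AE x in lebesgue_on {0<..<1}. y i T x = 0"
    using nc y0 unfolding null_controllable_def by blast
  let ?W = "boundary_trace T y"
  have W: "L2_on UNIV (?W h)" "integrable lebesgue (?W h)" if "h \<in> {1..m}" for h
    using broad_solution_continuous(2)[OF bs, of h] that by (auto intro!: boundary_trace_L2)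
  have comb: "L2_on UNIV (\<lambda>s. \<Sum>h=1..m. r h * ?W h s)" for r
    using W by (intro L2_on_sum L2_on_cmult) auto
  have supp: "\<bar>s\<bar> > T \<Longrightarrow> (\<Sum>h=1..m. r h * ?W h s) = 0" for r s
    using T by (auto intro!: sum.neutral simp: boundary_trace_zero abs_if split: if_splits)
  define v where "v h \<sigma> = ?W h (T - \<sigma>)" for h \<sigma>
  have v: "integrable lebesgue (v h)" if "h \<in> {1..m}" for h
    using lebesgue_integrable_real_affine_iff[of "-1" "?W h" T] W(2)[OF that] by (simp add: v_def[abs_def])
  have old: "row_vanishes m (lam (m + j)) (Q j) (G j) duration v" if j: "j \<in> {1..k}" for j
  proof -
    interpret J: positive_speed "lam (m + j)" by (rule ps[OF j])
    have jp: "j \<in> {1..p}" and i: "m + j \<in> {1..m+p}" using j k by auto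
    have Gj: "\<forall>h\<in>{1..m}. continuous_on {0..1} (G j h)" using G[OF j] by blast
    have "AE \<theta> in lebesgue. \<theta> \<in> {0<..<J.duration} \<longrightarrow> \<theta> < T \<longrightarrow>
        (\<Sum>h=1..m. Q j h * ?W h (T - \<theta>)) + J.row_source m (G j) ?W T \<theta> = 0"
      by (rule J.transport_final_equation[OF T broad_solution_continuous(1)[OF bs i] bspec[OF fin i] comb supp
            J.continuous_row_source[OF G[OF j] W(2)] broad_solution_row[OF bs jp ps[OF j] Gj]])
    thus ?thesis unfolding row_vanishes_def
    proof eventually_elim
      case (elim \<theta>)
      thus ?case using dur[OF j] dT by (auto simp: v_def[abs_def] J.row_source_def duhamel_eq_conv sum.distrib)
    qed
  qed
  have new: "row_vanishes m (lam (m + k)) q g duration v" by (rule imp[OF v old])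
  define D where "D t x = (\<Sum>h=1..m. (q h - Q k h) * ?W h (t - travel x))
      + (row_source m g ?W t (travel x) - row_source m (G k) ?W t (travel x))" for t x
  define y' where "y' = y(m + k := (\<lambda>t x. y (m + k) t x + D t x))"
  have y'_same: "y' i = y i" if "i \<noteq> m + k" for i using that by (simp add: y'_def)
  have y'_minus: "y' h = y h" if "h \<le> m" for h using that k by (intro y'_same) auto
  have tr_eq: "inflow_value m Q' u y' i t = inflow_value m Q' u y i t" "source_term m G' y' i t x = source_term m G' y i t x" for Q' G' i t x
    by (simp_all add: inflow_value_def source_term_def y'_minus)
  have row_eq: "inflow_value m (Q(k := q)) u y i t = inflow_value m Q u y i t"
    "source_term m (G(k := g)) y i t x = source_term m G y i t x" if "i \<noteq> m + k" for i t x
    using that by (auto simp: inflow_value_def source_term_def)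
  have KD: "continuous_on UNIV (\<lambda>(t, \<theta>). row_source m g ?W t \<theta> - row_source m (G k) ?W t \<theta>)"
    using continuous_on_diff[OF continuous_row_source[OF g W(2)] continuous_row_source[OF G[OF kk] W(2)]]
    by (simp add: case_prod_beta)
  have cont_D: "continuous_into_L2 {0..T} {0<..<1} (\<lambda>t x. D t x)" "continuous_into_L2 {0..1} {0<..<T} (\<lambda>x t. D t x)"
    unfolding D_def using continuous_into_L2_compose_travel[OF KD]
      continuous_into_L2_transport_time[OF comb[of "\<lambda>h. q h - Q k h"] supp[of _ "\<lambda>h. q h - Q k h"]]
      continuous_into_L2_transport_space[OF comb[of "\<lambda>h. q h - Q k h"] supp[of _ "\<lambda>h. q h - Q k h"]]
    by (auto intro!: continuous_into_L2_add)
  have "broad_solution m p lam (Q(k := q)) (G(k := g)) T y0 u y'"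
    unfolding broad_solution_def
  proof (intro ballI conjI)
    fix i assume i: "i \<in> {1..m+p}"
    note cont = broad_solution_continuous[OF bs i]
    show "continuous_into_L2 {0..T} {0<..<1} (y' i)"
      using continuous_into_L2_add[OF cont(1) cont_D(1)] cont(1) by (cases "i = m + k") (auto simp: y'_def)
    show "continuous_into_L2 {0..1} {0<..<T} (\<lambda>x t. y' i t x)"
      using continuous_into_L2_add[OF cont(2) cont_D(2)] cont(2) by (cases "i = m + k") (auto simp: y'_def)
    have bsi: "AE (t, x) in lebesgue_on ({0<..<T} \<times> {0<..<1}).
           \<exists>a c. 0 \<le> a \<and> characteristic (lam i) a t x c \<and> (a = 0 \<or> c a = inflow_point m i) \<and>
                 y i t x = (if a = 0 then y0 i (c 0) else inflow_value m Q u y i a)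
                   + (LINT \<tau>|lebesgue_on {a..t}. source_term m G y i \<tau> (c \<tau>))"
      using bs i by (auto simp: broad_solution_def)
    show "AE (t, x) in lebesgue_on ({0<..<T} \<times> {0<..<1}).
           \<exists>a c. 0 \<le> a \<and> characteristic (lam i) a t x c \<and> (a = 0 \<or> c a = inflow_point m i) \<and>
                 y' i t x = (if a = 0 then y0 i (c 0) else inflow_value m (Q(k := q)) u y' i a)
                   + (LINT \<tau>|lebesgue_on {a..t}. source_term m (G(k := g)) y' i \<tau> (c \<tau>))"
    proof (cases "i = m + k")
      case False
      show ?thesis using bsi by (simp only: tr_eq row_eq[OF False] y'_same[OF False])
    next
      case True
      have "AE z in lebesgue_on ({0<..<T} \<times> {0<..<1}). z \<in> {0<..<T} \<times> {0<..<1 :: real}"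
        by (rule AE_I2) simp
      thus ?thesis using bsi
      proof eventually_elim
        case (elim z)
        obtain t x where z: "z = (t, x)" by fastforce
        have t: "t < T" using elim(1) z by auto
        from elim(2) z True obtain a \<gamma> where *: "0 \<le> a" "characteristic (lam (m + k)) a t x \<gamma>"
          "a = 0 \<or> \<gamma> a = inflow_point m (m + k)"
          "y (m + k) t x = (if a = 0 then y0 (m + k) (\<gamma> 0) else inflow_value m Q u y (m + k) a)
                   + (LINT \<tau>|lebesgue_on {a..t}. source_term m G y (m + k) \<tau> (\<gamma> \<tau>))" by auto
        have k1: "1 \<le> k" using k by simp
        have g': "continuous_on {0..1} ((G(k := g)) k h)" if "h \<in> {1..m}" for h using g[OF that] by simp
        have "y (m + k) t x = (if t \<le> travel x then y0 (m + k) (position (travel x - t)) else (\<Sum>h=1..m. Q k h * ?W h (t - travel x)))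
            + row_source m (G k) ?W t (travel x)"
          unfolding *(4) by (intro broad_value[OF *(2,1,3) k1 t] G[OF kk] W(2))
        moreover have "(\<Sum>h=1..m. (q h - Q k h) * ?W h (t - travel x))
            = (\<Sum>h=1..m. q h * ?W h (t - travel x)) - (\<Sum>h=1..m. Q k h * ?W h (t - travel x))"
          by (simp add: left_diff_distrib sum_subtractf)
        moreover have "(\<Sum>h=1..m. (q h - Q k h) * ?W h (t - travel x)) = 0" if "t \<le> travel x"
          using that by (intro sum.neutral) (simp add: boundary_trace_zero)
        ultimately have "y' (m + k) t x = (if t \<le> travel x then y0 (m + k) (position (travel x - t)) else (\<Sum>h=1..m. q h * ?W h (t - travel x)))
            + row_source m g ?W t (travel x)"
          by (auto simp: y'_def D_def)
        also have "\<dots> = (if a = 0 then y0 (m + k) (\<gamma> 0) else inflow_value m (Q(k := q)) u y (m + k) a)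
                   + (LINT \<tau>|lebesgue_on {a..t}. source_term m (G(k := g)) y (m + k) \<tau> (\<gamma> \<tau>))"
          using broad_value[OF *(2,1,3) k1 t, where G="G(k := g)" and Q="Q(k := q)" and y=y and ?y0.0="y0 (m + k)" and u=u] g' W(2) by simp
        finally show ?case using *(1-3) True z by (auto simp: tr_eq)
      qed
    qed
  qed
  moreover have "AE x in lebesgue_on {0<..<1}. y' i T x = 0" if i: "i \<in> {1..m+p}" for i
  proof (cases "i = m + k")
    case True
    have "AE \<theta> in lebesgue. \<theta> \<in> {0<..<duration} \<longrightarrow>
      (\<Sum>h=1..m. (q h - Q k h) * ?W h (T - \<theta>)) + (row_source m g ?W T \<theta> - row_source m (G k) ?W T \<theta>) = 0"
      using old[OF kk, unfolded row_vanishes_def] new[unfolded row_vanishes_def]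
      by eventually_elim (auto simp: v_def[abs_def] row_source_def duhamel_eq_conv sum.distrib left_diff_distrib sum_subtractf)
    hence "AE x in lebesgue. x \<in> {0<..<1} \<longrightarrow> D T x = 0"
      unfolding D_def by (subst AE_travel_iff[where P="\<lambda>\<theta>. (\<Sum>h=1..m. (q h - Q k h) * ?W h (T - \<theta>)) + (row_source m g ?W T \<theta> - row_source m (G k) ?W T \<theta>) = 0"])
    moreover have "AE x in lebesgue. x \<in> {0<..<1} \<longrightarrow> y (m + k) T x = 0"
      using bspec[OF fin i] True by (simp add: AE_restrict_space_iff)
    ultimately have "AE x in lebesgue. x \<in> {0<..<1} \<longrightarrow> y' i T x = 0"
      by eventually_elim (auto simp: y'_def True)
    thus ?thesis by (simp add: AE_restrict_space_iff)
  next
    case False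
    thus ?thesis using fin i by (simp add: y'_same)
  qed
  ultimately show "\<exists>u y. (\<forall>i\<in>{1..m}. L2_on {0<..<T} (u i)) \<and> broad_solution m p lam (Q(k := q)) (G(k := g)) T y0 u y \<and>
      (\<forall>i\<in>{1..m+p}. AE x in lebesgue_on {0<..<1}. y i T x = 0)"
    using u by blast
qed

section \<open>Elimination of the trace term\<close>

lemma conv_combination:
  fixes A C :: "real \<Rightarrow> real" and B :: "'j \<Rightarrow> real \<Rightarrow> real" and v :: "real \<Rightarrow> real"
  assumes A: "continuous_on UNIV A" "\<And>x. \<bar>A x\<bar> \<le> b"
    and B: "\<And>j. j \<in> J \<Longrightarrow> continuous_on UNIV (B j)" "\<And>j x. j \<in> J \<Longrightarrow> \<bar>B j x\<bar> \<le> b' j"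
    and C: "\<And>x. x \<in> {0..L} \<Longrightarrow> C x = A x + (\<Sum>j\<in>J. \<alpha> j * B j x)"
    and v: "integrable lebesgue v" and \<theta>: "\<theta> \<in> {0<..<L}"
  shows "convolution C v \<theta> = convolution A v \<theta> + (\<Sum>j\<in>J. \<alpha> j * convolution (B j) v \<theta>)"
proof -
  let ?t = "\<lambda>g \<sigma>. indicator {0<..<\<theta>} \<sigma> * (g (\<theta> - \<sigma>) * v \<sigma>)"
  have iA: "integrable lebesgue (?t A)" by (rule integrable_conv_integrand[OF A v])
  have iB: "integrable lebesgue (\<lambda>\<sigma>. \<alpha> j * ?t (B j) \<sigma>)" if "j \<in> J" for j
    using integrable_conv_integrand[OF B(1)[OF that] B(2)[OF that] v] by (rule Bochner_Integration.integrable_mult_right)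
  have "convolution C v \<theta> = (LINT \<sigma>|lebesgue. ?t A \<sigma> + (\<Sum>j\<in>J. \<alpha> j * ?t (B j) \<sigma>))"
    unfolding convolution_def
  proof (intro Bochner_Integration.integral_cong refl)
    fix \<sigma>
    show "?t C \<sigma> = ?t A \<sigma> + (\<Sum>j\<in>J. \<alpha> j * ?t (B j) \<sigma>)"
    proof (cases "\<sigma> \<in> {0<..<\<theta>}")
      case True
      hence "C (\<theta> - \<sigma>) = A (\<theta> - \<sigma>) + (\<Sum>j\<in>J. \<alpha> j * B j (\<theta> - \<sigma>))" using \<theta> by (intro C) auto
      thus ?thesis using True by (simp add: distrib_right sum_distrib_right mult.assoc)
    qed simp
  qed
  also have "\<dots> = (LINT \<sigma>|lebesgue. ?t A \<sigma>) + (LINT \<sigma>|lebesgue. (\<Sum>j\<in>J. \<alpha> j * ?t (B j) \<sigma>))"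
    using iA iB by (intro Bochner_Integration.integral_add Bochner_Integration.integrable_sum) auto
  also have "(LINT \<sigma>|lebesgue. (\<Sum>j\<in>J. \<alpha> j * ?t (B j) \<sigma>)) = (\<Sum>j\<in>J. \<alpha> j * (LINT \<sigma>|lebesgue. ?t (B j) \<sigma>))"
    using iB by (subst Bochner_Integration.integral_sum) auto
  finally show ?thesis by (simp only: convolution_def)
qed

lemma AE_cong_AE: "AE x in M. P x \<longleftrightarrow> R x \<Longrightarrow> (AE x in M. P x) \<longleftrightarrow> (AE x in M. R x)"
  by (auto elim: AE_mp)

text \<open>
  Adding \<open>\<alpha> j\<close> times row \<open>j\<close> for every \<open>j\<close> cancels the term \<open>q \<cdot> v\<close> and adds the kernels
  of these rows to the kernel \<open>A\<close>.
\<close>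
lemma eliminate_trace_term:
  fixes A C :: "nat \<Rightarrow> real \<Rightarrow> real" and B :: "'j \<Rightarrow> nat \<Rightarrow> real \<Rightarrow> real" and v :: "nat \<Rightarrow> real \<Rightarrow> real"
  assumes A: "\<And>h. h \<in> H \<Longrightarrow> continuous_on UNIV (A h)" "\<And>h x. h \<in> H \<Longrightarrow> \<bar>A h x\<bar> \<le> b h"
    and B: "\<And>j h. j \<in> J \<Longrightarrow> h \<in> H \<Longrightarrow> continuous_on UNIV (B j h)" "\<And>j h x. j \<in> J \<Longrightarrow> h \<in> H \<Longrightarrow> \<bar>B j h x\<bar> \<le> b' j h"
    and C: "\<And>h x. h \<in> H \<Longrightarrow> x \<in> {0..L} \<Longrightarrow> C h x = A h x + (\<Sum>j\<in>J. \<alpha> j * B j h x)"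
    and v: "\<And>h. h \<in> H \<Longrightarrow> integrable lebesgue (v h)"
    and fin: "finite J"
    and rows: "\<And>j. j \<in> J \<Longrightarrow> AE \<theta> in lebesgue. \<theta> \<in> {0<..<L} \<longrightarrow> (\<Sum>h\<in>H. Q j h * v h \<theta> + convolution (B j h) (v h) \<theta>) = 0"
    and q: "\<And>h. h \<in> H \<Longrightarrow> q h + (\<Sum>j\<in>J. \<alpha> j * Q j h) = 0"
  shows "(AE \<theta> in lebesgue. \<theta> \<in> {0<..<L} \<longrightarrow> (\<Sum>h\<in>H. q h * v h \<theta> + convolution (A h) (v h) \<theta>) = 0) \<longleftrightarrow>
    (AE \<theta> in lebesgue. \<theta> \<in> {0<..<L} \<longrightarrow> (\<Sum>h\<in>H. convolution (C h) (v h) \<theta>) = 0)"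
proof -
  have q': "- (\<Sum>j\<in>J. \<alpha> j * Q j h) = q h" if "h \<in> H" for h using q[OF that] by linarith
  have rows': "AE \<theta> in lebesgue. \<forall>j\<in>J. \<theta> \<in> {0<..<L} \<longrightarrow> (\<Sum>h\<in>H. Q j h * v h \<theta> + convolution (B j h) (v h) \<theta>) = 0"
    using rows fin by (intro AE_finite_allI) auto
  have "AE \<theta> in lebesgue. \<theta> \<in> {0<..<L} \<longrightarrow>
    (\<Sum>h\<in>H. convolution (C h) (v h) \<theta>) = (\<Sum>h\<in>H. q h * v h \<theta> + convolution (A h) (v h) \<theta>)"
    using rows'
  proof eventually_elim
    case (elim \<theta>)
    show ?case
    proof
      assume \<theta>: "\<theta> \<in> {0<..<L}"
      have "(\<Sum>h\<in>H. convolution (C h) (v h) \<theta>) = (\<Sum>h\<in>H. convolution (A h) (v h) \<theta> + (\<Sum>j\<in>J. \<alpha> j * convolution (B j h) (v h) \<theta>))"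
        by (intro sum.cong refl conv_combination[OF A(1) A(2) B(1) B(2) C v \<theta>]) auto
      also have "\<dots> = (\<Sum>h\<in>H. convolution (A h) (v h) \<theta>) + (\<Sum>j\<in>J. \<alpha> j * (\<Sum>h\<in>H. convolution (B j h) (v h) \<theta>))"
        by (simp add: sum.distrib sum_distrib_left sum.swap[of _ H J])
      also have "(\<Sum>j\<in>J. \<alpha> j * (\<Sum>h\<in>H. convolution (B j h) (v h) \<theta>)) = (\<Sum>j\<in>J. \<alpha> j * - (\<Sum>h\<in>H. Q j h * v h \<theta>))"
        using elim \<theta> by (intro sum.cong refl arg_cong2[where f="(*)"]) (simp add: sum.distrib eq_neg_iff_add_eq_0 add.commute)
      also have "\<dots> = (\<Sum>h\<in>H. - (\<Sum>j\<in>J. \<alpha> j * Q j h) * v h \<theta>)"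
        by (simp add: sum_distrib_left sum_distrib_right sum_negf mult.assoc sum.swap[of _ H J])
      also have "\<dots> = (\<Sum>h\<in>H. q h * v h \<theta>)"
        using q' by (intro sum.cong refl) simp
      finally show "(\<Sum>h\<in>H. convolution (C h) (v h) \<theta>) = (\<Sum>h\<in>H. q h * v h \<theta> + convolution (A h) (v h) \<theta>)"
        by (simp add: sum.distrib)
    qed
  qed
  hence "(AE \<theta> in lebesgue. (\<theta> \<in> {0<..<L} \<longrightarrow> (\<Sum>h\<in>H. q h * v h \<theta> + convolution (A h) (v h) \<theta>) = 0) \<longleftrightarrow>
    (\<theta> \<in> {0<..<L} \<longrightarrow> (\<Sum>h\<in>H. convolution (C h) (v h) \<theta>) = 0))"
    by eventually_elim auto
  thus ?thesis by (rule AE_cong_AE)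
qed

section \<open>Change of coordinates between rows\<close>

lemma (in positive_speed) compose_position_derivative:
  assumes "C_k_on (Suc n) f {0..1}" "\<sigma> \<in> {0..duration}"
  shows "((\<lambda>\<sigma>. f (position \<sigma>)) has_real_derivative weighted_D c f (position \<sigma>)) (at \<sigma> within {0..duration})"
proof -
  have "(f has_real_derivative D01 f (position \<sigma>)) (at (position \<sigma>) within position ` {0..duration})"
    using C_k_on_Suc_derivative[OF assms(1) position_bounds] by (simp add: position_image)
  from DERIV_image_chain[OF this position_derivative[OF assms(2)]]
  show ?thesis by (simp add: weighted_D_def o_def mult.commute)
qed

lemma zeta_derivative:
  assumes "is_zeta m lam k j z" "x \<in> {0..1}"
  shows "(z has_real_derivative lam (m + j) (z x) / lam (m + k) x) (at x within {0..1})" "z x \<in> {0..1}"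
  using assms by (auto simp: is_zeta_def)

lemma compose_zeta_derivative:
  assumes z: "is_zeta m lam k j z" and f: "C_k_on (Suc n) f {0..1}" and x: "x \<in> {0..1}"
  shows "((\<lambda>x. f (z x)) has_real_derivative weighted_D (lam (m + j)) f (z x) / lam (m + k) x) (at x within {0..1})"
proof -
  have "(f has_real_derivative D01 f (z x)) (at (z x) within z ` {0..1})"
    by (rule DERIV_subset[OF C_k_on_Suc_derivative[OF f zeta_derivative(2)[OF z x]] image_subsetI[OF zeta_derivative(2)[OF z]]])
  from DERIV_image_chain[OF this zeta_derivative(1)[OF z x]]
  show ?thesis by (simp add: weighted_D_def o_def mult.commute)
qed

text \<open>
  The functions \<open>\<zeta>\<close> relate positions with equal travel times: the derivative of
  \<open>travel\<^sub>j (\<zeta> x) - travel\<^sub>k x\<close> is zero.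
\<close>
lemma zeta_position:
  assumes pk: "positive_speed (lam (m + k))" and pj: "positive_speed (lam (m + j))"
    and z: "is_zeta m lam k j z" and \<sigma>: "\<sigma> \<in> {0..positive_speed.duration (lam (m + k))}"
  shows "z (positive_speed.position (lam (m + k)) \<sigma>) = positive_speed.position (lam (m + j)) \<sigma>"
proof -
  interpret K: positive_speed "lam (m + k)" by (rule pk)
  interpret J: positive_speed "lam (m + j)" by (rule pj)
  have "\<exists>d. \<forall>x\<in>{0..1}. J.travel (z x) - K.travel x = d"
  proof (rule has_field_derivative_zero_constant)
    fix x :: real assume x: "x \<in> {0..1}"
    have "(J.travel has_real_derivative 1 / lam (m + j) (z x)) (at (z x) within z ` {0..1})"
      by (rule DERIV_subset[OF J.travel_derivative[OF zeta_derivative(2)[OF z x]] image_subsetI[OF zeta_derivative(2)[OF z]]])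
    from DERIV_image_chain[OF this zeta_derivative(1)[OF z x]]
    have "((\<lambda>x. J.travel (z x)) has_real_derivative 1 / lam (m + k) x) (at x within {0..1})"
      using J.speed_pos[OF zeta_derivative(2)[OF z x]] by (simp add: o_def)
    from DERIV_diff[OF this K.travel_derivative[OF x]]
    show "((\<lambda>x. J.travel (z x) - K.travel x) has_real_derivative 0) (at x within {0..1})" by simp
  qed simp
  then obtain d where d: "\<And>x. x \<in> {0..1} \<Longrightarrow> J.travel (z x) - K.travel x = d" by blast
  have "z 0 = 0" using z by (simp add: is_zeta_def)
  hence "d = 0" using d[of 0] by simp
  hence "J.travel (z (K.position \<sigma>)) = \<sigma>" using d[OF K.position_bounds[of \<sigma>]] K.travel_position[OF \<sigma>] by simp
  thus ?thesis using J.position_travel[OF zeta_derivative(2)[OF z K.position_bounds[of \<sigma>]]] by simp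
qed

text \<open>
  Both operators are differentiation with respect to the travel time. This also shows
  that compositions with \<open>\<zeta>\<close> may be differentiated as often as \<open>f\<close>, without a discussion
  of higher derivatives of \<open>\<zeta>\<close>.
\<close>
lemma weighted_D_funpow_compose_zeta:
  assumes z: "is_zeta m lam k j z" and pk: "positive_speed (lam (m + k))" and c: "C_k_on N (lam (m + j)) {0..1}"
    and f: "C_k_on (Suc N) f {0..1}" and n: "n \<le> Suc N" and x: "x \<in> {0..1}"
  shows "(weighted_D (lam (m + k)) ^^ n) (\<lambda>\<xi>. f (z \<xi>)) x = (weighted_D (lam (m + j)) ^^ n) f (z x)"
  using n x
proof (induction n arbitrary: x)
  case (Suc n)
  interpret K: positive_speed "lam (m + k)" by (rule pk)
  let ?g = "(weighted_D (lam (m + j)) ^^ n) f"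
  have g: "C_k_on (Suc (N - n)) ?g {0..1}"
    using C_k_on_weighted_D_funpow[OF c f, of n] Suc.prems by (simp add: Suc_diff_le del: C_k_on.simps)
  have "D01 ((weighted_D (lam (m + k)) ^^ n) (\<lambda>\<xi>. f (z \<xi>))) x = D01 (\<lambda>\<xi>. ?g (z \<xi>)) x"
    using Suc by (intro D01_cong) auto
  also have "\<dots> = weighted_D (lam (m + j)) ?g (z x) / lam (m + k) x"
    by (rule D01_eqI[OF compose_zeta_derivative[OF z g Suc.prems(2)] Suc.prems(2)])
  finally have E: "D01 ((weighted_D (lam (m + k)) ^^ n) (\<lambda>\<xi>. f (z \<xi>))) x = weighted_D (lam (m + j)) ?g (z x) / lam (m + k) x" .
  have "(weighted_D (lam (m + k)) ^^ Suc n) (\<lambda>\<xi>. f (z \<xi>)) x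
      = lam (m + k) x * D01 ((weighted_D (lam (m + k)) ^^ n) (\<lambda>\<xi>. f (z \<xi>))) x"
    by (simp add: weighted_D_def)
  also have "\<dots> = weighted_D (lam (m + j)) ?g (z x)"
    unfolding E using K.speed_pos[OF Suc.prems(2)] by simp
  finally show ?case by simp
qed simp

lemma C_k_on_const: "C_k_on n (\<lambda>x. r) S"
proof (induction n arbitrary: r)
  case (Suc n)
  have "\<forall>x\<in>S. ((\<lambda>x. r) has_real_derivative 0) (at x within S)" by simp
  thus ?case using Suc[of 0] by (auto intro!: exI[of _ "\<lambda>x. 0"])
qed simp

lemma C_k_on_sum: "(\<And>i. i \<in> I \<Longrightarrow> C_k_on n (f i) S) \<Longrightarrow> C_k_on n (\<lambda>x. \<Sum>i\<in>I. f i x) S"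
  by (induction I rule: infinite_finite_induct) (simp_all add: C_k_on_const C_k_on_add del: C_k_on.simps)

lemma C1_compose_zeta:
  assumes z: "is_zeta m lam k j z" and pk: "positive_speed (lam (m + k))"
    and cj: "continuous_on {0..1} (lam (m + j))" and f: "C_k_on (Suc n) f {0..1}"
  shows "C_k_on (Suc 0) (\<lambda>x. f (z x)) {0..1}"
proof -
  interpret K: positive_speed "lam (m + k)" by (rule pk)
  have zc: "continuous_on {0..1} z" using zeta_derivative(1)[OF z] by (rule DERIV_continuous_on)
  have "continuous_on {0..1} (D01 f)" using C_k_on_imp_continuous[OF C_k_on_Suc_D01[OF f]] .
  hence "continuous_on {0..1} (\<lambda>x. D01 f (z x))" "continuous_on {0..1} (\<lambda>x. lam (m + j) (z x))"
    using cj by (auto intro!: continuous_on_compose2[OF _ zc image_subsetI[OF zeta_derivative(2)[OF z]]])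
  hence "continuous_on {0..1} (\<lambda>x. weighted_D (lam (m + j)) f (z x) / lam (m + k) x)"
    unfolding weighted_D_def using K.speed_pos K.speed_continuous by (intro continuous_intros) force+
  moreover have "\<forall>x\<in>{0..1}. ((\<lambda>x. f (z x)) has_real_derivative weighted_D (lam (m + j)) f (z x) / lam (m + k) x) (at x within {0..1})"
    using compose_zeta_derivative[OF z f] by blast
  ultimately show ?thesis by auto
qed

section \<open>The chain of reduced rows\<close>

context
  fixes m s k :: nat and lam :: "nat \<Rightarrow> real \<Rightarrow> real" and Q :: "nat \<Rightarrow> nat \<Rightarrow> real"
    and G :: "nat \<Rightarrow> nat \<Rightarrow> real \<Rightarrow> real" and zeta :: "nat \<Rightarrow> real \<Rightarrow> real" and a :: "nat \<Rightarrow> nat \<Rightarrow> real"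
  assumes k: "1 \<le> k"
    and ps: "\<And>j. j \<in> {1..k} \<Longrightarrow> positive_speed (lam (m + j))"
    and lam: "\<And>j. j \<in> {1..k} \<Longrightarrow> C_k_on s (lam (m + j)) {0..1}"
    and G: "\<And>j h. j \<in> {1..k} \<Longrightarrow> h \<in> {1..m} \<Longrightarrow> C_k_on (Suc s) (G j h) {0..1}"
    and zeta: "\<And>j. j \<in> {1..k-1} \<Longrightarrow> is_zeta m lam k j (zeta j)"
begin

lemma ps_k: "positive_speed (lam (m + k))" using k ps by simp

lemma omega_bar_summands_C1:
  assumes h: "h \<in> {1..m}" and n: "n \<le> s"
  shows "C_k_on (Suc 0) ((weighted_D (lam (m + k)) ^^ n) (G k h)) {0..1}"
    and "j \<in> {1..k-1} \<Longrightarrow> C_k_on (Suc 0) ((weighted_D (lam (m + k)) ^^ n) (\<lambda>\<xi>. G j h (zeta j \<xi>))) {0..1}"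
proof -
  have pow: "C_k_on (Suc (s - n)) ((weighted_D (lam (m + j)) ^^ n) (G j h)) {0..1}" if "j \<in> {1..k}" for j
    using C_k_on_weighted_D_funpow[OF lam[OF that] G[OF that h], of n] n by (simp add: Suc_diff_le del: C_k_on.simps)
  show "C_k_on (Suc 0) ((weighted_D (lam (m + k)) ^^ n) (G k h)) {0..1}"
    using k by (intro C_k_on_mono[OF pow]) auto
  assume j: "j \<in> {1..k-1}"
  hence jk: "j \<in> {1..k}" by auto
  show "C_k_on (Suc 0) ((weighted_D (lam (m + k)) ^^ n) (\<lambda>\<xi>. G j h (zeta j \<xi>))) {0..1}"
  proof (rule C_k_on_cong)
    show "C_k_on (Suc 0) (\<lambda>x. (weighted_D (lam (m + j)) ^^ n) (G j h) (zeta j x)) {0..1}"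
      by (rule C1_compose_zeta[OF zeta[OF j] ps_k C_k_on_imp_continuous[OF lam[OF jk]] pow[OF jk]])
    show "(weighted_D (lam (m + j)) ^^ n) (G j h) (zeta j x) = (weighted_D (lam (m + k)) ^^ n) (\<lambda>\<xi>. G j h (zeta j \<xi>)) x"
      if "x \<in> {0..1}" for x
      using n by (intro weighted_D_funpow_compose_zeta[OF zeta[OF j] ps_k lam[OF jk] G[OF jk h] _ that, symmetric]) auto
  qed
qed

lemma omega_bar_C1:
  assumes h: "h \<in> {1..m}" and l: "1 \<le> l" "l \<le> Suc s"
  shows "C_k_on (Suc 0) (omega_bar m lam G k zeta a l h) {0..1}"
  unfolding omega_bar_def[abs_def] using h l
  by (intro C_k_on_add C_k_on_sum C_k_on_mult C_k_on_const omega_bar_summands_C1) auto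

text \<open>
  The recursion behind the \<open>\<omega>\<close>-functions: differentiate along row \<open>k\<close>, then add the rows
  \<open>j < k\<close> with coefficients \<open>a l\<close>.
\<close>
lemma omega_bar_Suc:
  assumes h: "h \<in> {1..m}" and l: "1 \<le> l" "l \<le> Suc s" and x: "x \<in> {0..1}"
  shows "omega_bar m lam G k zeta a (Suc l) h x = weighted_D (lam (m + k)) (omega_bar m lam G k zeta a l h) x + (\<Sum>j=1..k-1. a l j * G j h (zeta j x))"
proof -
  let ?W = "weighted_D (lam (m + k))"
  let ?A = "(?W ^^ (l - 1)) (G k h)" and ?B = "\<lambda>i j. (?W ^^ (l - 1 - i)) (\<lambda>\<xi>. G j h (zeta j \<xi>))"
  have "(omega_bar m lam G k zeta a l h has_real_derivative D01 ?A x + (\<Sum>i<l. \<Sum>j=1..k-1. a i j * D01 (?B i j) x)) (at x within {0..1})"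
    unfolding omega_bar_def[abs_def] using h l x
    by (intro DERIV_add DERIV_sum DERIV_cmult C_k_on_Suc_derivative[OF omega_bar_summands_C1(1)] C_k_on_Suc_derivative[OF omega_bar_summands_C1(2)]) auto
  hence "?W (omega_bar m lam G k zeta a l h) x = ?W ?A x + (\<Sum>i<l. \<Sum>j=1..k-1. a i j * ?W (?B i j) x)"
    unfolding weighted_D_def using D01_eqI x by (simp add: distrib_left sum_distrib_left mult.left_commute)
  also have "?W ?A = (?W ^^ l) (G k h)" using l by (cases l) auto
  also have "(\<Sum>i<l. \<Sum>j=1..k-1. a i j * ?W (?B i j) x) = (\<Sum>i<l. \<Sum>j=1..k-1. a i j * (?W ^^ (l - i)) (\<lambda>\<xi>. G j h (zeta j \<xi>)) x)"
  proof (intro sum.cong refl arg_cong2[where f="(*)"])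
    fix i j assume "i \<in> {..<l}"
    hence "l - i = Suc (l - 1 - i)" by auto
    thus "?W (?B i j) x = (?W ^^ (l - i)) (\<lambda>\<xi>. G j h (zeta j \<xi>)) x" by simp
  qed
  finally have E: "?W (omega_bar m lam G k zeta a l h) x = (?W ^^ l) (G k h) x
      + (\<Sum>i<l. \<Sum>j=1..k-1. a i j * (?W ^^ (l - i)) (\<lambda>\<xi>. G j h (zeta j \<xi>)) x)" .
  have "omega_bar m lam G k zeta a (Suc l) h x = (?W ^^ l) (G k h) x
      + (\<Sum>i<l. \<Sum>j=1..k-1. a i j * (?W ^^ (l - i)) (\<lambda>\<xi>. G j h (zeta j \<xi>)) x) + (\<Sum>j=1..k-1. a l j * G j h (zeta j x))"
    by (simp add: omega_bar_def)
  thus ?thesis by (simp only: E)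
qed

context
  fixes v :: "nat \<Rightarrow> real \<Rightarrow> real" and L :: real
  assumes v: "\<And>h. h \<in> {1..m} \<Longrightarrow> integrable lebesgue (v h)"
    and L: "L = positive_speed.duration (lam (m + k))"
    and rows: "\<And>j. j \<in> {1..k-1} \<Longrightarrow> row_vanishes m (lam (m + j)) (Q j) (G j) L v"
    and om: "\<And>l h. l \<le> s \<Longrightarrow> h \<in> {1..m} \<Longrightarrow>
      omega_row m lam Q G k zeta a l h + (\<Sum>j=1..k-1. a l j * Q j h) = 0"
begin

text \<open>
  A row equation without trace term; such equations alternate with those that have one.
\<close>
definition "conv_vanishes f \<longleftrightarrow> (AE \<theta> in lebesgue. \<theta> \<in> {0<..<L} \<longrightarrow>
  (\<Sum>h=1..m. convolution (\<lambda>\<sigma>. f h (positive_speed.position (lam (m + k)) \<sigma>)) (v h) \<theta>) = 0)"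

lemma row_vanishes_iff_conv_vanishes:
  assumes g: "\<And>h. h \<in> {1..m} \<Longrightarrow> continuous_on {0..1} (g h)" and l: "l \<le> s"
    and f: "\<And>h x. h \<in> {1..m} \<Longrightarrow> x \<in> {0..1} \<Longrightarrow> f h x = g h x + (\<Sum>j=1..k-1. a l j * G j h (zeta j x))"
  shows "row_vanishes m (lam (m + k)) (omega_row m lam Q G k zeta a l) g L v \<longleftrightarrow> conv_vanishes f"
proof -
  interpret K: positive_speed "lam (m + k)" by (rule ps_k)
  have psj: "positive_speed (lam (m + j))" if "j \<in> {1..k-1}" for j using that by (intro ps) auto
  have "\<exists>b. \<forall>x. \<bar>g h (K.position x)\<bar> \<le> b" if "h \<in> {1..m}" for h
    using K.bounded_compose_position[OF g[OF that]] by metis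
  then obtain b where b: "\<And>h x. h \<in> {1..m} \<Longrightarrow> \<bar>g h (K.position x)\<bar> \<le> b h" by metis
  let ?B = "\<lambda>j h \<sigma>. G j h (positive_speed.position (lam (m + j)) \<sigma>)"
  have Gc: "continuous_on {0..1} (G j h)" if "j \<in> {1..k-1}" "h \<in> {1..m}" for j h
    using that by (intro C_k_on_imp_continuous[OF G]) auto
  have "\<exists>b'. \<forall>x. \<bar>?B j h x\<bar> \<le> b'" if "j \<in> {1..k-1}" "h \<in> {1..m}" for j h
    using positive_speed.bounded_compose_position[OF psj[OF that(1)] Gc[OF that]] by metis
  then obtain b' where b': "\<And>j h x. j \<in> {1..k-1} \<Longrightarrow> h \<in> {1..m} \<Longrightarrow> \<bar>?B j h x\<bar> \<le> b' j h" by metis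
  have f': "f h (K.position \<sigma>) = g h (K.position \<sigma>) + (\<Sum>j=1..k-1. a l j * ?B j h \<sigma>)"
    if "h \<in> {1..m}" "\<sigma> \<in> {0..L}" for h \<sigma>
    using f[OF that(1) K.position_bounds] zeta_position[OF ps_k psj zeta] that(2) by (simp add: L)
  show ?thesis unfolding row_vanishes_def conv_vanishes_def
    by (rule eliminate_trace_term[where B = ?B and b = b and b' = b' and J = "{1..k-1}" and Q = Q and \<alpha> = "a l",
          OF K.continuous_on_compose_position[OF g] b positive_speed.continuous_on_compose_position[OF psj Gc] b' f' v
          _ rows[unfolded row_vanishes_def] om[OF l]]) auto
qed

lemma conv_vanishes_iff_derivative:
  assumes l: "1 \<le> l" "l \<le> Suc s"
  shows "conv_vanishes (omega_bar m lam G k zeta a l) \<longleftrightarrow>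
    row_vanishes m (lam (m + k)) (omega_row m lam Q G k zeta a l) (\<lambda>h. weighted_D (lam (m + k)) (omega_bar m lam G k zeta a l h)) L v"
proof -
  interpret K: positive_speed "lam (m + k)" by (rule ps_k)
  let ?g = "\<lambda>h. weighted_D (lam (m + k)) (omega_bar m lam G k zeta a l h)"
  have C1: "C_k_on (Suc 0) (omega_bar m lam G k zeta a l h) {0..1}" if "h \<in> {1..m}" for h by (rule omega_bar_C1[OF that l])
  have fc: "continuous_on {0..1} (omega_bar m lam G k zeta a l h)" if "h \<in> {1..m}" for h
    by (rule C_k_on_imp_continuous[OF C1[OF that]])
  have gc: "continuous_on {0..1} (?g h)" if "h \<in> {1..m}" for h
    unfolding weighted_D_def[abs_def]
    by (intro continuous_on_mult K.speed_continuous C_k_on_imp_continuous[OF C_k_on_Suc_D01[OF C1[OF that]]])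
  have "\<exists>b. \<forall>x. \<bar>omega_bar m lam G k zeta a l h (K.position x)\<bar> \<le> b" if "h \<in> {1..m}" for h
    using K.bounded_compose_position[OF fc[OF that]] by metis
  then obtain b where b: "\<And>h x. h \<in> {1..m} \<Longrightarrow> \<bar>omega_bar m lam G k zeta a l h (K.position x)\<bar> \<le> b h" by metis
  have "\<exists>b. \<forall>x. \<bar>?g h (K.position x)\<bar> \<le> b" if "h \<in> {1..m}" for h
    using K.bounded_compose_position[OF gc[OF that]] by metis
  then obtain b' where b': "\<And>h x. h \<in> {1..m} \<Longrightarrow> \<bar>?g h (K.position x)\<bar> \<le> b' h" by metis
  have om0: "omega_row m lam Q G k zeta a l h = omega_bar m lam G k zeta a l h (K.position 0)" for h
    using l by (simp add: omega_row_def)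
  show ?thesis unfolding conv_vanishes_def row_vanishes_def om0
  proof (rule conv_zero_iff_derivative[where f = "\<lambda>h \<sigma>. omega_bar m lam G k zeta a l h (K.position \<sigma>)" and f' = "\<lambda>h \<sigma>. ?g h (K.position \<sigma>)" and B = b and B' = b'])
    fix h assume h: "h \<in> {1..m}"
    show "continuous_on UNIV (\<lambda>\<sigma>. omega_bar m lam G k zeta a l h (K.position \<sigma>))" "continuous_on UNIV (\<lambda>\<sigma>. ?g h (K.position \<sigma>))"
      by (intro K.continuous_on_compose_position fc gc h)+
    show "((\<lambda>\<sigma>. omega_bar m lam G k zeta a l h (K.position \<sigma>)) has_real_derivative ?g h (K.position \<sigma>)) (at \<sigma> within {0..L})" if "\<sigma> \<in> {0..L}" for \<sigma>
      using K.compose_position_derivative[OF C1[OF h]] that by (simp add: L)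
  qed (use b b' v L K.duration_pos in auto)
qed

text \<open>
  The trace term is eliminated and the equation is differentiated in turn, starting with
  the elimination in the given row and ending with the differentiation of the equation
  with kernel \<open>omega_bar\<close> of index \<open>s + 1\<close>.
\<close>
lemma reduced_row_vanishes_iff:
  "row_vanishes m (lam (m + k)) (Q k) (G k) L v \<longleftrightarrow>
   row_vanishes m (lam (m + k)) (omega_row m lam Q G k zeta a (s + 1)) (\<lambda>h. weighted_D (lam (m + k)) (omega_bar m lam G k zeta a (s + 1) h)) L v"
proof -
  interpret K: positive_speed "lam (m + k)" by (rule ps_k)
  let ?R = "row_vanishes m (lam (m + k)) (Q k) (G k) L v"
  have "?R \<longleftrightarrow> conv_vanishes (omega_bar m lam G k zeta a (Suc l))" if "l \<le> s" for l
    using that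
  proof (induction l)
    case 0
    have "omega_row m lam Q G k zeta a 0 = Q k" by (simp add: omega_row_def fun_eq_iff)
    moreover have "row_vanishes m (lam (m + k)) (omega_row m lam Q G k zeta a 0) (G k) L v \<longleftrightarrow> conv_vanishes (omega_bar m lam G k zeta a (Suc 0))"
    proof (rule row_vanishes_iff_conv_vanishes)
      show "continuous_on {0..1} (G k h)" if "h \<in> {1..m}" for h
        using k by (intro C_k_on_imp_continuous[OF G[OF _ that]]) simp
    qed (simp_all add: omega_bar_def)
    ultimately show ?case by simp
  next
    case (Suc l)
    have C1: "C_k_on (Suc 0) (omega_bar m lam G k zeta a (Suc l) h) {0..1}" if "h \<in> {1..m}" for h
      using Suc.prems by (intro omega_bar_C1[OF that]) auto
    have "?R \<longleftrightarrow> conv_vanishes (omega_bar m lam G k zeta a (Suc l))" using Suc by simp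
    also have "\<dots> \<longleftrightarrow> row_vanishes m (lam (m + k)) (omega_row m lam Q G k zeta a (Suc l)) (\<lambda>h. weighted_D (lam (m + k)) (omega_bar m lam G k zeta a (Suc l) h)) L v"
      using Suc.prems by (intro conv_vanishes_iff_derivative) auto
    also have "\<dots> \<longleftrightarrow> conv_vanishes (omega_bar m lam G k zeta a (Suc (Suc l)))"
    proof (rule row_vanishes_iff_conv_vanishes[OF _ Suc.prems])
      show "continuous_on {0..1} (weighted_D (lam (m + k)) (omega_bar m lam G k zeta a (Suc l) h))" if "h \<in> {1..m}" for h
        unfolding weighted_D_def[abs_def]
        by (intro continuous_on_mult K.speed_continuous C_k_on_imp_continuous[OF C_k_on_Suc_D01[OF C1[OF that]]])
      show "omega_bar m lam G k zeta a (Suc (Suc l)) h x = weighted_D (lam (m + k)) (omega_bar m lam G k zeta a (Suc l) h) x + (\<Sum>j=1..k-1. a (Suc l) j * G j h (zeta j x))"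
        if "h \<in> {1..m}" "x \<in> {0..1}" for h x
        using Suc.prems by (intro omega_bar_Suc that) auto
    qed
    finally show ?case .
  qed
  from this[of s] conv_vanishes_iff_derivative[of "Suc s"] show ?thesis by simp
qed

end

end

section \<open>Minimal null control times\<close>

lemma hyperbolic_positive:
  assumes hyp: "hyperbolic m p lam" and x: "x \<in> {0..1}"
  shows "j \<in> {1..p} \<Longrightarrow> 0 < lam (m + j) x" "1 \<le> i \<Longrightarrow> i \<le> j \<Longrightarrow> j \<le> p \<Longrightarrow> lam (m + i) x \<le> lam (m + j) x"
proof -
  have lt: "lam i x < lam j x" if "1 \<le> i" "i < j" "j \<le> m + p" for i j
    using hyp x that unfolding hyperbolic_def by blast
  have pos: "0 < lam (m + 1) x" using hyp x unfolding hyperbolic_def by blast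
  show "0 < lam (m + j) x" if "j \<in> {1..p}"
    using lt[of "m + 1" "m + j"] pos that by (cases "j = 1") auto
  show "lam (m + i) x \<le> lam (m + j) x" if "1 \<le> i" "i \<le> j" "j \<le> p"
    using lt[of "m + i" "m + j"] that by (cases "i = j") auto
qed

text \<open>
  Slower rows have longer travel times, so that the rows \<open>j < k\<close> give equations on the
  whole interval of row \<open>k\<close>.
\<close>
lemma duration_antimono:
  assumes c: "positive_speed c" and c': "positive_speed c'" and le: "\<And>x. x \<in> {0..1} \<Longrightarrow> c x \<le> c' x"
  shows "positive_speed.duration c' \<le> positive_speed.duration c"
proof -
  interpret A: positive_speed c by (rule c)
  interpret B: positive_speed c' by (rule c')
  show ?thesis unfolding A.duration_def B.duration_def A.travel_def B.travel_def
  proof (rule integral_le)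
    show "(\<lambda>\<xi>. 1 / c \<xi>) integrable_on {0..1}" "(\<lambda>\<xi>. 1 / c' \<xi>) integrable_on {0..1}"
      using A.speed_pos B.speed_pos
      by (auto intro!: integrable_continuous_real continuous_intros A.speed_continuous B.speed_continuous) force+
    show "1 / c' x \<le> 1 / c x" if "x \<in> {0..1}" for x
      using A.speed_pos[OF that] B.speed_pos[OF that] le[OF that] by (intro divide_left_mono) auto
  qed
qed

text \<open>
  The old system arises from the new one by a replacement of the same row, so that both
  implications are instances of \<open>null_controllable_replace_row\<close>.
\<close>
lemma T_inf_replace_row:
  assumes k: "k \<in> {1..p}"
    and ps: "\<And>j. j \<in> {1..k} \<Longrightarrow> positive_speed (lam (m + j))"
    and dur: "\<And>j. j \<in> {1..k} \<Longrightarrow> positive_speed.duration (lam (m + k)) \<le> positive_speed.duration (lam (m + j))"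
    and G: "\<And>j h. j \<in> {1..k} \<Longrightarrow> h \<in> {1..m} \<Longrightarrow> continuous_on {0..1} (G j h)"
    and g: "\<And>h. h \<in> {1..m} \<Longrightarrow> continuous_on {0..1} (g h)"
    and iff: "\<And>v. (\<And>h. h \<in> {1..m} \<Longrightarrow> integrable lebesgue (v h)) \<Longrightarrow>
      (\<And>j. j \<in> {1..k-1} \<Longrightarrow> row_vanishes m (lam (m + j)) (Q j) (G j) (positive_speed.duration (lam (m + k))) v) \<Longrightarrow>
      row_vanishes m (lam (m + k)) (Q k) (G k) (positive_speed.duration (lam (m + k))) v \<longleftrightarrow>
      row_vanishes m (lam (m + k)) q g (positive_speed.duration (lam (m + k))) v"
  shows "T_inf m p lam Q G = T_inf m p lam (Q(k := q)) (G(k := g))"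
proof -
  let ?L = "positive_speed.duration (lam (m + k))"
  have "null_controllable m p lam Q G T \<longleftrightarrow> null_controllable m p lam (Q(k := q)) (G(k := g)) T" if T: "0 < T" for T
  proof
    assume nc: "null_controllable m p lam Q G T"
    show "null_controllable m p lam (Q(k := q)) (G(k := g)) T"
    proof (rule null_controllable_replace_row[OF nc T k ps dur G g])
      fix v assume v: "\<And>h. h \<in> {1..m} \<Longrightarrow> integrable lebesgue (v h)"
        and rows: "\<And>j. j \<in> {1..k} \<Longrightarrow> row_vanishes m (lam (m + j)) (Q j) (G j) ?L v"
      show "row_vanishes m (lam (m + k)) q g ?L v"
      proof (rule iff[THEN iffD1, OF v])
        show "row_vanishes m (lam (m + j)) (Q j) (G j) ?L v" if "j \<in> {1..k-1}" for j
          using that by (intro rows) auto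
        show "row_vanishes m (lam (m + k)) (Q k) (G k) ?L v" using k by (intro rows) auto
      qed
    qed
  next
    assume nc: "null_controllable m p lam (Q(k := q)) (G(k := g)) T"
    have "null_controllable m p lam ((Q(k := q))(k := Q k)) ((G(k := g))(k := G k)) T"
    proof (rule null_controllable_replace_row[OF nc T k ps dur])
      show "continuous_on {0..1} ((G(k := g)) j h)" if "j \<in> {1..k}" "h \<in> {1..m}" for j h
        using G g that by auto
      show "continuous_on {0..1} (G k h)" if "h \<in> {1..m}" for h using G that k by auto
      fix v assume v: "\<And>h. h \<in> {1..m} \<Longrightarrow> integrable lebesgue (v h)"
        and rows: "\<And>j. j \<in> {1..k} \<Longrightarrow> row_vanishes m (lam (m + j)) ((Q(k := q)) j) ((G(k := g)) j) ?L v"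
      have "row_vanishes m (lam (m + j)) (Q j) (G j) ?L v" if j: "j \<in> {1..k-1}" for j
      proof -
        have "j \<noteq> k" "j \<in> {1..k}" using j by auto
        thus ?thesis using rows[of j] by simp
      qed
      thus "row_vanishes m (lam (m + k)) (Q k) (G k) ?L v"
        using iff[OF v] rows[of k] k by auto
    qed
    thus "null_controllable m p lam Q G T" by simp
  qed
  hence "{T. 0 < T \<and> null_controllable m p lam Q G T} = {T. 0 < T \<and> null_controllable m p lam (Q(k := q)) (G(k := g)) T}"
    by blast
  thus ?thesis by (simp add: T_inf_def)
qed

lemma row_vanishes_cong:
  assumes "\<And>h. h \<in> {1..m} \<Longrightarrow> q h = q' h"
  shows "row_vanishes m c q g L v \<longleftrightarrow> row_vanishes m c q' g L v"
proof -
  have "(\<Sum>h=1..m. q h * v h \<theta> + convolution (\<lambda>\<sigma>. g h (positive_speed.position c \<sigma>)) (v h) \<theta>)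
    = (\<Sum>h=1..m. q' h * v h \<theta> + convolution (\<lambda>\<sigma>. g h (positive_speed.position c \<sigma>)) (v h) \<theta>)" for \<theta>
    using assms by (intro sum.cong) auto
  thus ?thesis by (simp only: row_vanishes_def)
qed

lemma T_inf_reduced_system:
  assumes k: "k \<in> {1..p}" and sr: "s \<le> r"
    and lam: "\<forall>i\<in>{1..m+p}. C_k_on (r + 1) (lam i) {0..1}" and hyp: "hyperbolic m p lam"
    and G: "\<forall>j\<in>{1..p}. \<forall>h\<in>{1..m}. C_k_on (s + 1) (G j h) {0..1}"
    and zeta: "\<forall>i\<in>{1..k-1}. is_zeta m lam k i (zeta i)"
    and om: "\<forall>l\<in>{0..s}. \<forall>h\<in>{1..m}. omega_row m lam Q G k zeta a l h + (\<Sum>j=1..k-1. a l j * Q j h) = 0"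
    and q: "\<And>h. h \<in> {1..m} \<Longrightarrow> q h = omega_row m lam Q G k zeta a (s + 1) h"
  shows "T_inf m p lam Q G = T_inf m p lam (Q(k := q))
    (G(k := (\<lambda>h. weighted_D (lam (m + k)) (omega_bar m lam G k zeta a (s + 1) h))))"
proof -
  have lamC: "C_k_on s (lam (m + j)) {0..1}" if "j \<in> {1..k}" for j
    using that k sr by (intro C_k_on_mono[OF bspec[OF lam, of "m + j"]]) auto
  have ps: "positive_speed (lam (m + j))" if "j \<in> {1..k}" for j
    using hyperbolic_positive(1)[OF hyp] C_k_on_imp_continuous[OF lamC[OF that]] that k
    by unfold_locales auto
  have dur: "positive_speed.duration (lam (m + k)) \<le> positive_speed.duration (lam (m + j))" if "j \<in> {1..k}" for j
    using that k by (intro duration_antimono ps hyperbolic_positive(2)[OF hyp]) auto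
  have GC: "C_k_on (Suc s) (G j h) {0..1}" if "j \<in> {1..k}" "h \<in> {1..m}" for j h
    using G that k by (auto simp del: C_k_on.simps)
  have z: "is_zeta m lam k j (zeta j)" if "j \<in> {1..k-1}" for j using zeta that by blast
  have k1: "1 \<le> k" and kk: "k \<in> {1..k}" using k by auto
  show ?thesis
  proof (rule T_inf_replace_row[where lam = lam and m = m, OF k ps dur])
    show "continuous_on {0..1} (G j h)" if "j \<in> {1..k}" "h \<in> {1..m}" for j h
      by (rule C_k_on_imp_continuous[OF GC[OF that]])
  next
    interpret K: positive_speed "lam (m + k)" by (rule ps[OF kk])
    show "continuous_on {0..1} (weighted_D (lam (m + k)) (omega_bar m lam G k zeta a (s + 1) h))" if "h \<in> {1..m}" for h
    proof -
      have "C_k_on (Suc 0) (omega_bar m lam G k zeta a (s + 1) h) {0..1}"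
        by (rule omega_bar_C1[OF k1 ps lamC GC z that]) simp_all
      from continuous_on_mult[OF K.speed_continuous C_k_on_imp_continuous[OF C_k_on_Suc_D01[OF this]]]
      show ?thesis unfolding weighted_D_def[abs_def] .
    qed
    fix v assume v: "\<And>h. h \<in> {1..m} \<Longrightarrow> integrable lebesgue (v h)"
      and rows: "\<And>j. j \<in> {1..k-1} \<Longrightarrow> row_vanishes m (lam (m + j)) (Q j) (G j) K.duration v"
    have om': "omega_row m lam Q G k zeta a l h + (\<Sum>j=1..k-1. a l j * Q j h) = 0" if "l \<le> s" "h \<in> {1..m}" for l h
      using om that by auto
    let ?g = "\<lambda>h. weighted_D (lam (m + k)) (omega_bar m lam G k zeta a (s + 1) h)"
    have "row_vanishes m (lam (m + k)) (Q k) (G k) K.duration v \<longleftrightarrow>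
      row_vanishes m (lam (m + k)) (omega_row m lam Q G k zeta a (s + 1)) ?g K.duration v"
      by (rule reduced_row_vanishes_iff[OF k1 ps lamC GC z v refl rows om'])
    also have "\<dots> \<longleftrightarrow> row_vanishes m (lam (m + k)) q ?g K.duration v"
      by (rule row_vanishes_cong) (simp add: q)
    finally show "row_vanishes m (lam (m + k)) (Q k) (G k) K.duration v \<longleftrightarrow>
      row_vanishes m (lam (m + k)) q ?g K.duration v" .
  qed
qed

theorem theorem3p3:
  fixes m p r s :: nat
    and lam :: "nat \<Rightarrow> real \<Rightarrow> real"
    and Q :: "nat \<Rightarrow> nat \<Rightarrow> real"
    and G :: "nat \<Rightarrow> nat \<Rightarrow> real \<Rightarrow> real"
  assumes "1 \<le> m" and "1 \<le> p" and "s \<le> r"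
    and "\<forall>i\<in>{1..m+p}. C_k_on (r + 1) (lam i) {0..1}"
    and "hyperbolic m p lam"
    and "\<forall>j\<in>{1..p}. \<forall>h\<in>{1..m}. C_k_on (s + 1) (G j h) {0..1}"
  shows
    "((\<forall>l\<in>{0..s}. \<forall>h\<in>{1..m}. gamma_row Q G l h = 0) \<longrightarrow>
        T_inf m p lam Q G =
        T_inf m p lam
          (Q(1 := (\<lambda>h. lam (m + 1) 0 ^ s * (D01 ^^ s) (G 1 h) 0)))
          (G(1 := (\<lambda>h. (weighted_D (lam (m + 1)) ^^ (s + 1)) (G 1 h)))))
     \<and>
     (\<forall>k\<in>{2..p}. \<forall>zeta :: nat \<Rightarrow> real \<Rightarrow> real. \<forall>a :: nat \<Rightarrow> nat \<Rightarrow> real.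
        (\<forall>i\<in>{1..k-1}. is_zeta m lam k i (zeta i)) \<longrightarrow>
        (\<forall>l\<in>{0..s}. \<forall>h\<in>{1..m}.
           omega_row m lam Q G k zeta a l h + (\<Sum>j=1..k-1. a l j * Q j h) = 0) \<longrightarrow>
        T_inf m p lam Q G =
        T_inf m p lam
          (Q(k := omega_row m lam Q G k zeta a (s + 1)))
          (G(k := (\<lambda>h. weighted_D (lam (m + k)) (omega_bar m lam G k zeta a (s + 1) h)))))"
proof (intro conjI impI ballI allI)
  fix k and zeta :: "nat \<Rightarrow> real \<Rightarrow> real" and a :: "nat \<Rightarrow> nat \<Rightarrow> real"
  assume k: "k \<in> {2..p}" and zeta: "\<forall>i\<in>{1..k-1}. is_zeta m lam k i (zeta i)"
    and om: "\<forall>l\<in>{0..s}. \<forall>h\<in>{1..m}. omega_row m lam Q G k zeta a l h + (\<Sum>j=1..k-1. a l j * Q j h) = 0"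
  show "T_inf m p lam Q G = T_inf m p lam (Q(k := omega_row m lam Q G k zeta a (s + 1)))
          (G(k := (\<lambda>h. weighted_D (lam (m + k)) (omega_bar m lam G k zeta a (s + 1) h))))"
    using k by (intro T_inf_reduced_system[OF _ assms(3-6) zeta om refl]) auto
next
  assume \<gamma>: "\<forall>l\<in>{0..s}. \<forall>h\<in>{1..m}. gamma_row Q G l h = 0"
  let ?z = "\<lambda>_ _. 0 :: real" and ?c = "lam (m + 1)"
  have bar: "omega_bar m lam G 1 ?z ?z l h = (weighted_D ?c ^^ (l - 1)) (G 1 h)" for l h
    by (simp add: omega_bar_def fun_eq_iff)
  have c: "C_k_on s ?c {0..1}" using assms(2,3) by (intro C_k_on_mono[OF bspec[OF assms(4), of "m + 1"]]) auto
  have D0: "(weighted_D ?c ^^ i) (G 1 h) 0 = ?c 0 ^ i * (D01 ^^ i) (G 1 h) 0" if h: "h \<in> {1..m}" and i: "i \<le> s" for h i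
  proof (rule weighted_D_funpow_at_zero[OF c _ _ i])
    show "C_k_on s (G 1 h) {0..1}"
      using assms(2) by (intro C_k_on_mono[OF bspec[OF bspec[OF assms(6), of 1] h]]) auto
    show "(D01 ^^ j) (G 1 h) 0 = 0" if "j < s" for j
      using bspec[OF bspec[OF \<gamma>, of "Suc j"] h] that by (simp add: gamma_row_def)
  qed
  have row: "omega_row m lam Q G 1 ?z ?z l h = 0" if "l \<in> {0..s}" "h \<in> {1..m}" for l h
  proof (cases l)
    case 0
    thus ?thesis using bspec[OF bspec[OF \<gamma>, of 0] that(2)] by (simp add: omega_row_def gamma_row_def)
  next
    case (Suc i)
    thus ?thesis using bspec[OF bspec[OF \<gamma> that(1)] that(2)] D0[OF that(2), of i] that(1)
      by (simp add: omega_row_def gamma_row_def bar del: One_nat_def)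
  qed
  have "T_inf m p lam Q G = T_inf m p lam (Q(1 := (\<lambda>h. ?c 0 ^ s * (D01 ^^ s) (G 1 h) 0)))
          (G(1 := (\<lambda>h. weighted_D ?c (omega_bar m lam G 1 ?z ?z (s + 1) h))))"
  proof (rule T_inf_reduced_system[OF _ assms(3-6)])
    show "?c 0 ^ s * (D01 ^^ s) (G 1 h) 0 = omega_row m lam Q G 1 ?z ?z (s + 1) h" if "h \<in> {1..m}" for h
      using D0[OF that, of s] by (simp add: omega_row_def bar del: One_nat_def)
  qed (use assms(2) row in auto)
  moreover have "(\<lambda>h. weighted_D ?c (omega_bar m lam G 1 ?z ?z (s + 1) h)) = (\<lambda>h. (weighted_D ?c ^^ (s + 1)) (G 1 h))"
    by (simp only: bar add_diff_cancel_right' Suc_eq_plus1[symmetric] funpow.simps o_apply diff_Suc_1)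
  ultimately show "T_inf m p lam Q G = T_inf m p lam (Q(1 := (\<lambda>h. ?c 0 ^ s * (D01 ^^ s) (G 1 h) 0)))
          (G(1 := (\<lambda>h. (weighted_D ?c ^^ (s + 1)) (G 1 h))))"
    by simp
qed

end
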